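(* Let $\pi\colon E\to X$ be a smooth fiber bundle, let $k\in\mathbb{N}$, and let $\mathsf{E}\subset\mathsf{J}^k(\pi)$ be a formally integrable partial differential equation. Then $(\mathsf{J}^i(\pi),\pi_{i,j},\pi_{i,\infty})$ induces on $\mathsf{E}^{(\infty)}=\bigcap_{i\in\mathbb{N}}\pi_{k+i,\infty}^{-1}(\mathsf{E}^{(i)})$ the structure of a profinite dimensional submanifold of the manifold of $\infty$-jets $(\mathsf{J}^\infty(\pi),\mathcal{C}^\infty_\pi)$. (The set $\mathsf{E}^{(\infty)}$ is called the manifold of formal solutions of $\mathsf{E}$.)
   Context: Manifolds are smooth and finite dimensional; a fibered manifold is a surjective submersion. Jets. $\mathsf{j}^k_p\psi$ denotes the $k$-jet at $p\in X$ of a local smooth section $\psi$ of $\pi$ around $p$ (sections are identified when in fibered charts all partial derivatives at $p$ of orders $0,\dots,k$ agree); $\mathsf{J}^k(\pi)$ is the manifold of all $k$-jets, $\mathsf{J}^0(\pi)=E$, $\mathsf{J}^{-1}(\pi)=X$, $\pi_k(\mathsf{j}^k_p\psi)=p$, $\pi_{l,k}(\mathsf{j}^k_p\psi)=\mathsf{j}^l_p\psi$ for $l\le k$ (with $\mathsf{j}^{-1}_p\psi=p$). $\mathsf{j}^k\psi$ is the local section $p\mapsto\mathsf{j}^k_p\psi$ of $\pi_k$. $\mathsf{J}^\infty(\pi)$ is the set of $\infty$-jets $\mathsf{j}^\infty_p\psi$ (sections identified when all partial derivatives of all orders at $p$ agree), with maps $\pi_{i,\infty}\colon\mathsf{J}^\infty(\pi)\to\mathsf{J}^i(\pi)$,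 $\mathsf{j}^\infty_p\psi\mapsto\mathsf{j}^i_p\psi$, $i\in\mathbb{Z}_{\ge-1}$, the initial topology with respect to these maps, and the structure sheaf $\mathcal{C}^\infty_\pi$ of continuous real functions that are locally of the form $f_i\circ\pi_{i,\infty}$ with $f_i$ smooth on an open subset of some $\mathsf{J}^i(\pi)$. It is a profinite dimensional manifold with smooth projective representation $(\mathsf{J}^i(\pi),\pi_{i,j},\pi_{i,\infty})$, $i\le j$ in $\mathbb{Z}_{\ge-1}$. PDEs. A partial differential equation on $\pi$ of order $\le k$ is a submanifold $\mathsf{E}\subset\mathsf{J}^k(\pi)$ such that $\pi_{k|\mathsf{E}}\colon\mathsf{E}\to X$ is a fibered manifold. $\mathsf{E}^{(0)}=\mathsf{E}$, and for $l\ge1$, $\mathsf{E}^{(l)}\subset\mathsf{J}^{k+l}(\pi)$ is the set of all $\mathsf{j}^{k+l}_p\psi$ for which there is a local smooth section $\Psi$ of $\pi_k$ around $p$ with values in $\mathsf{E}$ and $\mathsf{j}^l_p\Psi=\mathsf{j}^l_p(\mathsf{j}^k\psi)$ in $\mathsf{J}^l(\pi_k)$. One has $\pi_{k+l,k+l+1}(\mathsf{E}^{(l+1)})\subset\mathsf{E}^{(l)}$. $\mathsf{E}$ is formally integrable if for every $l\in\mathbb{N}$ (including $0$) $\mathsf{E}^{(l)}$ is a submanifold of $\mathsf{J}^{k+l}(\pi)$ and $\pi_{k+l,k+l+1}\colon\mathsf{E}^{(l+1)}\to\mathsf{E}^{(l)}$ is a fibered manifold. Profinite dimensional manifolds. A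 smooth projective representation of a commutative locally $\mathbb{R}$-ringed space $(M,\mathcal{C}^\infty_M)$ is a family $(M_i,\mu_{ij},\mu_i)$ of manifolds $M_i$ (indexed by $\mathbb{N}$ or a set order-isomorphic to it), surjective submersions $\mu_{ij}\colon M_j\to M_i$ ($i\le j$) with $\mu_{ii}=\mathrm{id}$, $\mu_{ij}\circ\mu_{jk}=\mu_{ik}$, and continuous maps $\mu_i\colon M\to M_i$ such that $M$ with the $\mu_i$ is a topological projective limit of $(M_i,\mu_{ij})$ and $\mathcal{C}^\infty_M$ is the sheaf of continuous functions that are locally of the form $f_i\circ\mu_i$ with $f_i$ smooth on an open subset of some $M_i$. A profinite dimensional manifold is such a ringed space together with a (suitable equivalence class of) smooth projective representation(s). A subset $N\subset M$ is a profinite dimensional submanifold, with $(M_i,\mu_{ij},\mu_i)$ inducing the submanifold structure on $N$, if: there is a strictly increasing sequence $(l_i)_{i\in\mathbb{N}}$ of indices such that each $N_i:=\mu_{l_i}(N)$ is a submanifold of $M_{l_i}$; $N=\bigcap_{i}\mu_{l_i}^{-1}(N_i)$; and $\mu_{l_il_j|N_j}\colon N_j\to N_i$ is a submersion for all $i\le j$. In that case $(N_i,\mu_{l_il_j|N_j},\mu_{l_i|N})$ is a smooth projective representation of $N$ equipped with the subspace topology and the sheaf of functions which are locally restrictions of smooth functions on $M$, and defines the profinite dimensional manifold structure of $N$. *)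

theory Defs
  imports "HOL-Analysis.Analysis" "HOL-Library.Multiset"
begin

section \<open>Smooth functions on coordinate spaces\<close>

text \<open>
  The dimension of the manifold of k-jets depends on k, so it cannot be encoded in a type.
  The Euclidean space with coordinates labelled by a finite set I is therefore represented by the
  functions that vanish outside I, with the (product) topology of the function type.
\<close>

definition coord_space :: "'i set \<Rightarrow> ('i \<Rightarrow> real) set" where
  "coord_space I = {v. \<forall>i. i \<notin> I \<longrightarrow> v i = 0}"

definition partial :: "'i \<Rightarrow> (('i \<Rightarrow> real) \<Rightarrow> real) \<Rightarrow> ('i \<Rightarrow> real) \<Rightarrow> real" where
  "partial i g v = deriv (\<lambda>t. g (v(i := t))) (v i)"

text \<open>
  A multi-index is a multiset of coordinate labels, of order its size.  The order of
  differentiation is irrelevant for smooth functions; the sorted one is chosen.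
\<close>

definition multi_partial ::
  "'i::linorder multiset \<Rightarrow> (('i \<Rightarrow> real) \<Rightarrow> real) \<Rightarrow> ('i \<Rightarrow> real) \<Rightarrow> real" where
  "multi_partial \<alpha> g = foldr partial (sorted_list_of_multiset \<alpha>) g"

text \<open>
  In the following two definitions W is meant to be relatively open in \<open>coord_space I\<close>.
\<close>

fun C_diff_on :: "nat \<Rightarrow> 'i set \<Rightarrow> ('i \<Rightarrow> real) set \<Rightarrow> (('i \<Rightarrow> real) \<Rightarrow> real) \<Rightarrow> bool" where
  "C_diff_on 0 I W g \<longleftrightarrow> continuous_on W g"
| "C_diff_on (Suc n) I W g \<longleftrightarrow>
     continuous_on W g \<and>
     (\<forall>i\<in>I. (\<forall>v\<in>W. (\<lambda>t. g (v(i := t))) differentiable (at (v i))) \<and>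
            C_diff_on n I W (partial i g))"

definition smooth_on :: "'i set \<Rightarrow> ('i \<Rightarrow> real) set \<Rightarrow> (('i \<Rightarrow> real) \<Rightarrow> real) \<Rightarrow> bool" where
  "smooth_on I W g \<longleftrightarrow> (\<forall>n. C_diff_on n I W g)"


section \<open>Manifolds\<close>

record ('a, 'i) chart =
  chart_dom :: "'a set"
  chart_idx :: "'i set"
  chart_map :: "'a \<Rightarrow> 'i \<Rightarrow> real"

definition chart_inv :: "('a, 'i) chart \<Rightarrow> ('i \<Rightarrow> real) \<Rightarrow> 'a" where
  "chart_inv c = inv_into (chart_dom c) (chart_map c)"

record ('a, 'i) manifold =
  mtop :: "'a topology"
  atlas :: "('a, 'i) chart set"

abbreviation points :: "('a, 'i) manifold \<Rightarrow> 'a set" where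
  "points M \<equiv> topspace (mtop M)"

text \<open>Smoothness, and surjectivity of the differential, of a map f read in charts c and d.\<close>

definition smooth_rep :: "('a, 'i) chart \<Rightarrow> ('b, 'j) chart \<Rightarrow> ('a \<Rightarrow> 'b) \<Rightarrow> bool" where
  "smooth_rep c d f \<longleftrightarrow>
     (\<forall>j\<in>chart_idx d. smooth_on (chart_idx c)
        (chart_map c ` {p \<in> chart_dom c. f p \<in> chart_dom d})
        (\<lambda>v. chart_map d (f (chart_inv c v)) j))"

definition surj_diff_rep :: "('a, 'i) chart \<Rightarrow> ('b, 'j) chart \<Rightarrow> ('a \<Rightarrow> 'b) \<Rightarrow> 'a \<Rightarrow> bool" where
  "surj_diff_rep c d f p \<longleftrightarrow>
     (\<forall>w. \<exists>h. \<forall>j\<in>chart_idx d.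
        (\<Sum>i\<in>chart_idx c.
           h i * partial i (\<lambda>v. chart_map d (f (chart_inv c v)) j) (chart_map c p)) = w j)"

text \<open>
  The charts of M are all charts compatible with its atlas.  Their labels may be of
  another type than those of the atlas.
\<close>

definition chart_of :: "('a, 'i) manifold \<Rightarrow> ('a, 'k) chart \<Rightarrow> bool" where
  "chart_of M c \<longleftrightarrow>
     openin (mtop M) (chart_dom c) \<and>
     finite (chart_idx c) \<and>
     openin (top_of_set (coord_space (chart_idx c))) (chart_map c ` chart_dom c) \<and>
     homeomorphic_map (subtopology (mtop M) (chart_dom c))
       (top_of_set (chart_map c ` chart_dom c)) (chart_map c) \<and>
     (\<forall>d\<in>atlas M. smooth_rep c d (\<lambda>p. p) \<and> smooth_rep d c (\<lambda>p. p))"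

text \<open>The dimension is only required to be locally constant.\<close>

definition manifold :: "('a, 'i) manifold \<Rightarrow> bool" where
  "manifold M \<longleftrightarrow>
     Hausdorff_space (mtop M) \<and>
     second_countable (mtop M) \<and>
     (\<forall>c\<in>atlas M. chart_of M c) \<and>
     (\<Union>c\<in>atlas M. chart_dom c) = points M"

definition smooth_map :: "('a, 'i) manifold \<Rightarrow> ('b, 'j) manifold \<Rightarrow> ('a \<Rightarrow> 'b) \<Rightarrow> bool" where
  "smooth_map M N f \<longleftrightarrow>
     continuous_map (mtop M) (mtop N) f \<and>
     (\<forall>c\<in>atlas M. \<forall>d\<in>atlas N. smooth_rep c d f)"

definition diffeomorphism :: "('a, 'i) manifold \<Rightarrow> ('b, 'j) manifold \<Rightarrow> ('a \<Rightarrow> 'b) \<Rightarrow> bool" where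
  "diffeomorphism M N f \<longleftrightarrow>
     bij_betw f (points M) (points N) \<and>
     smooth_map M N f \<and> smooth_map N M (inv_into (points M) f)"

definition submersion :: "('a, 'i) manifold \<Rightarrow> ('b, 'j) manifold \<Rightarrow> ('a \<Rightarrow> 'b) \<Rightarrow> bool" where
  "submersion M N f \<longleftrightarrow>
     smooth_map M N f \<and>
     (\<forall>c\<in>atlas M. \<forall>d\<in>atlas N. \<forall>p\<in>chart_dom c.
        f p \<in> chart_dom d \<longrightarrow> surj_diff_rep c d f p)"

definition fibered_manifold ::
  "('a, 'i) manifold \<Rightarrow> ('b, 'j) manifold \<Rightarrow> ('a \<Rightarrow> 'b) \<Rightarrow> bool" where
  "fibered_manifold M N f \<longleftrightarrow> submersion M N f \<and> f ` points M = points N"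

text \<open>Submanifolds are embedded: S is locally given by the vanishing of some coordinates.\<close>

definition slice_chart ::
  "('a, 'i) manifold \<Rightarrow> 'a set \<Rightarrow> ('a, 'i) chart \<Rightarrow> 'i set \<Rightarrow> bool" where
  "slice_chart M S c K \<longleftrightarrow>
     chart_of M c \<and> K \<subseteq> chart_idx c \<and>
     (\<forall>p\<in>chart_dom c. p \<in> S \<longleftrightarrow> (\<forall>i\<in>chart_idx c - K. chart_map c p i = 0))"

definition is_submanifold :: "('a, 'i) manifold \<Rightarrow> 'a set \<Rightarrow> bool" where
  "is_submanifold M S \<longleftrightarrow>
     S \<subseteq> points M \<and> (\<forall>p\<in>S. \<exists>c K. slice_chart M S c K \<and> p \<in> chart_dom c)"

definition submanifold :: "('a, 'i) manifold \<Rightarrow> 'a set \<Rightarrow> ('a, 'i) manifold" where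
  "submanifold M S =
     \<lparr>mtop = subtopology (mtop M) S,
      atlas = {\<lparr>chart_dom = chart_dom c \<inter> S, chart_idx = K, chart_map = chart_map c\<rparr> |c K.
                 slice_chart M S c K}\<rparr>"

definition product_manifold ::
  "('a, 'i) manifold \<Rightarrow> ('b, 'j) manifold \<Rightarrow> ('a \<times> 'b, 'i + 'j) manifold" where
  "product_manifold M N =
     \<lparr>mtop = prod_topology (mtop M) (mtop N),
      atlas = {\<lparr>chart_dom = chart_dom c \<times> chart_dom d,
                chart_idx = chart_idx c <+> chart_idx d,
                chart_map = (\<lambda>(p, q). case_sum (chart_map c p) (chart_map d q))\<rparr> |c d.
                 c \<in> atlas M \<and> d \<in> atlas N}\<rparr>"

definition smooth_fiber_bundle ::
  "('x, 'i) manifold \<Rightarrow> ('e, 'j) manifold \<Rightarrow> ('f, 'k) manifold \<Rightarrow> ('e \<Rightarrow> 'x) \<Rightarrow> bool" where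
  "smooth_fiber_bundle X E F \<pi> \<longleftrightarrow>
     manifold X \<and> manifold E \<and> manifold F \<and>
     smooth_map E X \<pi> \<and> \<pi> ` points E = points X \<and>
     (\<forall>p\<in>points X. \<exists>U \<Phi>. openin (mtop X) U \<and> p \<in> U \<and>
        diffeomorphism (submanifold E {e \<in> points E. \<pi> e \<in> U})
          (product_manifold (submanifold X U) F) \<Phi> \<and>
        (\<forall>e\<in>points E. \<pi> e \<in> U \<longrightarrow> fst (\<Phi> e) = \<pi> e))"


section \<open>Jets of local sections\<close>

definition section_on ::
  "('x, nat) manifold \<Rightarrow> ('e, 'j) manifold \<Rightarrow> ('e \<Rightarrow> 'x) \<Rightarrow> 'x set \<Rightarrow> ('x \<Rightarrow> 'e) \<Rightarrow> bool" where
  "section_on X E \<pi> U \<psi> \<longleftrightarrow>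
     openin (mtop X) U \<and> smooth_map (submanifold X U) E \<psi> \<and> (\<forall>q\<in>U. \<pi> (\<psi> q) = q)"

text \<open>Local sections are total functions whose values away from the point are irrelevant.\<close>

definition section_at ::
  "('x, nat) manifold \<Rightarrow> ('e, 'j) manifold \<Rightarrow> ('e \<Rightarrow> 'x) \<Rightarrow> 'x \<Rightarrow> ('x \<Rightarrow> 'e) \<Rightarrow> bool" where
  "section_at X E \<pi> p \<psi> \<longleftrightarrow> (\<exists>U. p \<in> U \<and> section_on X E \<pi> U \<psi>)"

text \<open>
  A fibered chart c over a chart x of the base: its coordinates are those of x, labelled by
  \<open>Inl\<close>, and further fibre coordinates, labelled by \<open>Inr\<close>.
\<close>

definition fibered_chart ::
  "('x, nat) manifold \<Rightarrow> ('e, 'j) manifold \<Rightarrow> ('e \<Rightarrow> 'x) \<Rightarrow>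
   ('x, nat) chart \<Rightarrow> ('e, nat + 'j) chart \<Rightarrow> bool" where
  "fibered_chart X E \<pi> x c \<longleftrightarrow>
     chart_of X x \<and> chart_of E c \<and>
     \<pi> ` chart_dom c = chart_dom x \<and>
     Inl -` chart_idx c = chart_idx x \<and>
     (\<forall>e\<in>chart_dom c. \<forall>i\<in>chart_idx x. chart_map c e (Inl i) = chart_map x (\<pi> e) i)"

definition section_partial ::
  "('x, nat) chart \<Rightarrow> ('e, nat + 'j) chart \<Rightarrow> nat multiset \<Rightarrow> 'j \<Rightarrow> ('x \<Rightarrow> 'e) \<Rightarrow> 'x \<Rightarrow> real" where
  "section_partial x c \<alpha> a \<psi> p =
     multi_partial \<alpha> (\<lambda>v. chart_map c (\<psi> (chart_inv x v)) (Inr a)) (chart_map x p)"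

text \<open>
  Jets of all orders are treated uniformly by means of the set D of orders of derivatives
  that are compared: \<open>orders_upto k\<close> for k-jets (the empty set for \<open>k = -1\<close>) and \<open>UNIV\<close> for
  infinite jets.
\<close>

definition orders_upto :: "int \<Rightarrow> nat set" where
  "orders_upto k = {d. int d \<le> k}"

definition same_jet ::
  "('x, nat) manifold \<Rightarrow> ('e, 'j) manifold \<Rightarrow> ('e \<Rightarrow> 'x) \<Rightarrow> nat set \<Rightarrow> 'x \<Rightarrow>
   ('x \<Rightarrow> 'e) \<Rightarrow> ('x \<Rightarrow> 'e) \<Rightarrow> bool" where
  "same_jet X E \<pi> D p \<phi> \<psi> \<longleftrightarrow>
     (0 \<in> D \<longrightarrow> \<phi> p = \<psi> p) \<and>
     (\<forall>x c \<alpha> a. fibered_chart X E \<pi> x c \<and> \<psi> p \<in> chart_dom c \<and>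
        size \<alpha> \<in> D \<and> set_mset \<alpha> \<subseteq> chart_idx x \<and> Inr a \<in> chart_idx c \<longrightarrow>
        section_partial x c \<alpha> a \<phi> p = section_partial x c \<alpha> a \<psi> p)"

text \<open>
  A jet is its base point with the set of all sections representing it.  Jets of order
  \<open>-1\<close> and 0 correspond to the points of X and E.
\<close>

type_synonym ('x, 'e) jet = "'x \<times> ('x \<Rightarrow> 'e) set"

definition jet ::
  "('x, nat) manifold \<Rightarrow> ('e, 'j) manifold \<Rightarrow> ('e \<Rightarrow> 'x) \<Rightarrow> nat set \<Rightarrow> 'x \<Rightarrow> ('x \<Rightarrow> 'e) \<Rightarrow>
   ('x, 'e) jet" where
  "jet X E \<pi> D p \<psi> = (p, {\<phi>. section_at X E \<pi> p \<phi> \<and> same_jet X E \<pi> D p \<phi> \<psi>})"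

definition jet_rep :: "('x, 'e) jet \<Rightarrow> 'x \<Rightarrow> 'e" where
  "jet_rep z = (SOME \<psi>. \<psi> \<in> snd z)"

text \<open>The projection to jets of lower order; the projection to X is \<open>fst\<close>.\<close>

definition jet_proj ::
  "('x, nat) manifold \<Rightarrow> ('e, 'j) manifold \<Rightarrow> ('e \<Rightarrow> 'x) \<Rightarrow> int \<Rightarrow> ('x, 'e) jet \<Rightarrow> ('x, 'e) jet"
  where "jet_proj X E \<pi> k z = jet X E \<pi> (orders_upto k) (fst z) (jet_rep z)"

text \<open>
  The chart of the manifold of k-jets given by a fibered chart c over x: the base coordinates, and
  the derivatives of order at most k of the fibre coordinates of a section.
\<close>

definition jet_idx ::
  "('x, nat) chart \<Rightarrow> ('e, nat + 'j) chart \<Rightarrow> int \<Rightarrow> (nat + nat multiset \<times> 'j) set" where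
  "jet_idx x c k = chart_idx x <+>
     {(\<alpha>, a). size \<alpha> \<in> orders_upto k \<and> set_mset \<alpha> \<subseteq> chart_idx x \<and> Inr a \<in> chart_idx c}"

definition jet_chart ::
  "('x, nat) manifold \<Rightarrow> ('e, 'j) manifold \<Rightarrow> ('e \<Rightarrow> 'x) \<Rightarrow> int \<Rightarrow>
   ('x, nat) chart \<Rightarrow> ('e, nat + 'j) chart \<Rightarrow> (('x, 'e) jet, nat + nat multiset \<times> 'j) chart" where
  "jet_chart X E \<pi> k x c =
     \<lparr>chart_dom = {jet X E \<pi> (orders_upto k) p \<psi> |p \<psi>. section_at X E \<pi> p \<psi> \<and> \<psi> p \<in> chart_dom c},
      chart_idx = jet_idx x c k,
      chart_map = (\<lambda>z s. if s \<in> jet_idx x c k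
        then (case s of
                Inl i \<Rightarrow> chart_map x (fst z) i
              | Inr (\<alpha>, a) \<Rightarrow> section_partial x c \<alpha> a (jet_rep z) (fst z))
        else 0)\<rparr>"

definition jet_manifold ::
  "('x, nat) manifold \<Rightarrow> ('e, 'j) manifold \<Rightarrow> ('e \<Rightarrow> 'x) \<Rightarrow> int \<Rightarrow>
   (('x, 'e) jet, nat + nat multiset \<times> 'j) manifold" where
  "jet_manifold X E \<pi> k =
     (let A = {jet_chart X E \<pi> k x c |x c. fibered_chart X E \<pi> x c} in
      \<lparr>mtop = topology_generated_by
         {{z \<in> chart_dom d. chart_map d z \<in> W} |d W. d \<in> A \<and> open W},
       atlas = A\<rparr>)"


section \<open>Partial differential equations\<close>

definition is_pde ::
  "('x, nat) manifold \<Rightarrow> ('e, 'j) manifold \<Rightarrow> ('e \<Rightarrow> 'x) \<Rightarrow> nat \<Rightarrow> ('x, 'e) jet set \<Rightarrow> bool" where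
  "is_pde X E \<pi> k R \<longleftrightarrow>
     is_submanifold (jet_manifold X E \<pi> (int k)) R \<and>
     fibered_manifold (submanifold (jet_manifold X E \<pi> (int k)) R) X fst"

text \<open>
  In the second case, the l-jets at p of \<open>\<Psi>\<close> and of the k-jet prolongation of \<open>\<psi>\<close> are
  jets of sections of the bundle of k-jets over X.
\<close>

definition prolongation ::
  "('x, nat) manifold \<Rightarrow> ('e, 'j) manifold \<Rightarrow> ('e \<Rightarrow> 'x) \<Rightarrow> nat \<Rightarrow> ('x, 'e) jet set \<Rightarrow> nat \<Rightarrow>
   ('x, 'e) jet set" where
  "prolongation X E \<pi> k R l =
     (if l = 0 then R
      else {jet X E \<pi> (orders_upto (int (k + l))) p \<psi> |p \<psi>.
              section_at X E \<pi> p \<psi> \<and>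
              (\<exists>U \<Psi>. p \<in> U \<and> section_on X (jet_manifold X E \<pi> (int k)) fst U \<Psi> \<and> \<Psi> ` U \<subseteq> R \<and>
                 jet X (jet_manifold X E \<pi> (int k)) fst (orders_upto (int l)) p \<Psi> =
                 jet X (jet_manifold X E \<pi> (int k)) fst (orders_upto (int l)) p
                   (\<lambda>q. jet X E \<pi> (orders_upto (int k)) q \<psi>))})"

definition formally_integrable ::
  "('x, nat) manifold \<Rightarrow> ('e, 'j) manifold \<Rightarrow> ('e \<Rightarrow> 'x) \<Rightarrow> nat \<Rightarrow> ('x, 'e) jet set \<Rightarrow> bool" where
  "formally_integrable X E \<pi> k R \<longleftrightarrow>
     (\<forall>l. is_submanifold (jet_manifold X E \<pi> (int (k + l))) (prolongation X E \<pi> k R l) \<and>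
          fibered_manifold
            (submanifold (jet_manifold X E \<pi> (int (k + l + 1))) (prolongation X E \<pi> k R (l + 1)))
            (submanifold (jet_manifold X E \<pi> (int (k + l))) (prolongation X E \<pi> k R l))
            (jet_proj X E \<pi> (int (k + l))))"


section \<open>Profinite dimensional manifolds\<close>

text \<open>
  The data of a profinite dimensional manifold: a topological space with a sheaf of real functions
  (on an open set, extended by \<open>undefined\<close>) and a smooth projective representation.  The map
  \<open>ptrans P i j\<close> goes from level j to level i.  That the data satisfy the axioms of a
  profinite dimensional manifold is not part of the following definition, just as
  \<open>is_submanifold M S\<close> does not include \<open>manifold M\<close>.
\<close>

record ('m, 'a, 'i) profinite =
  ptop :: "'m topology"
  psheaf :: "'m set \<Rightarrow> ('m \<Rightarrow> real) set"
  pindex :: "int set"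
  plevel :: "int \<Rightarrow> ('a, 'i) manifold"
  ptrans :: "int \<Rightarrow> int \<Rightarrow> 'a \<Rightarrow> 'a"
  pproj :: "int \<Rightarrow> 'm \<Rightarrow> 'a"

definition profinite_submanifold :: "('m, 'a, 'i) profinite \<Rightarrow> 'm set \<Rightarrow> bool" where
  "profinite_submanifold P N \<longleftrightarrow>
     N \<subseteq> topspace (ptop P) \<and>
     (\<exists>l :: nat \<Rightarrow> int. strict_mono l \<and> range l \<subseteq> pindex P \<and>
        (\<forall>i. is_submanifold (plevel P (l i)) (pproj P (l i) ` N)) \<and>
        N = (\<Inter>i. {m \<in> topspace (ptop P). pproj P (l i) m \<in> pproj P (l i) ` N}) \<and>
        (\<forall>i j. i \<le> j \<longrightarrow>
           submersion (submanifold (plevel P (l j)) (pproj P (l j) ` N))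
             (submanifold (plevel P (l i)) (pproj P (l i) ` N))
             (ptrans P (l i) (l j))))"


section \<open>Infinite jets\<close>

definition infinite_jets ::
  "('x, nat) manifold \<Rightarrow> ('e, 'j) manifold \<Rightarrow> ('e \<Rightarrow> 'x) \<Rightarrow> ('x, 'e) jet set" where
  "infinite_jets X E \<pi> = {jet X E \<pi> UNIV p \<psi> |p \<psi>. section_at X E \<pi> p \<psi>}"

definition infinite_jet_topology ::
  "('x, nat) manifold \<Rightarrow> ('e, 'j) manifold \<Rightarrow> ('e \<Rightarrow> 'x) \<Rightarrow> ('x, 'e) jet topology" where
  "infinite_jet_topology X E \<pi> =
     topology_generated_by
       {{z \<in> infinite_jets X E \<pi>. jet_proj X E \<pi> i z \<in> W} |i W.
          - 1 \<le> i \<and> openin (mtop (jet_manifold X E \<pi> i)) W}"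

definition infinite_jet_sheaf ::
  "('x, nat) manifold \<Rightarrow> ('e, 'j) manifold \<Rightarrow> ('e \<Rightarrow> 'x) \<Rightarrow>
   ('x, 'e) jet set \<Rightarrow> (('x, 'e) jet \<Rightarrow> real) set" where
  "infinite_jet_sheaf X E \<pi> U =
     {f \<in> extensional U.
        openin (infinite_jet_topology X E \<pi>) U \<and>
        continuous_map (subtopology (infinite_jet_topology X E \<pi>) U) euclideanreal f \<and>
        (\<forall>z\<in>U. \<exists>i V W g. - 1 \<le> i \<and>
           openin (infinite_jet_topology X E \<pi>) V \<and> z \<in> V \<and> V \<subseteq> U \<and>
           openin (mtop (jet_manifold X E \<pi> i)) W \<and> jet_proj X E \<pi> i ` V \<subseteq> W \<and>
           (\<forall>c\<in>atlas (jet_manifold X E \<pi> i). smooth_on (chart_idx c)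
              (chart_map c ` (chart_dom c \<inter> W)) (\<lambda>v. g (chart_inv c v))) \<and>
           (\<forall>y\<in>V. f y = g (jet_proj X E \<pi> i y)))}"

definition infinite_jet_manifold ::
  "('x, nat) manifold \<Rightarrow> ('e, 'j) manifold \<Rightarrow> ('e \<Rightarrow> 'x) \<Rightarrow>
   (('x, 'e) jet, ('x, 'e) jet, nat + nat multiset \<times> 'j) profinite" where
  "infinite_jet_manifold X E \<pi> =
     \<lparr>ptop = infinite_jet_topology X E \<pi>,
      psheaf = infinite_jet_sheaf X E \<pi>,
      pindex = {-1..},
      plevel = jet_manifold X E \<pi>,
      ptrans = (\<lambda>i j. jet_proj X E \<pi> i),
      pproj = jet_proj X E \<pi>\<rparr>"

definition formal_solutions ::
  "('x, nat) manifold \<Rightarrow> ('e, 'j) manifold \<Rightarrow> ('e \<Rightarrow> 'x) \<Rightarrow> nat \<Rightarrow> ('x, 'e) jet set \<Rightarrow>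
   ('x, 'e) jet set" where
  "formal_solutions X E \<pi> k R =
     (\<Inter>i. {z \<in> infinite_jets X E \<pi>. jet_proj X E \<pi> (int (k + i)) z \<in> prolongation X E \<pi> k R i})"

end

theory Submission
  imports Defs
begin

text \<open>
  The levels used for the manifold of formal solutions are k, k + 1, ..., and everything rests on the
  fact that the projection of the set of formal solutions to level k + i is exactly the i-th
  prolongation (proved in \<open>mainTheorem4\<close> from \<open>section_with_compatible_jets\<close>).  Given this, the
  set is the intersection of the preimages of its projections by definition, and its projections are
  submanifolds by formal integrability.

  The projection is contained in the prolongation by definition.  Conversely, formal integrability makes
  each prolongation map onto the previous one, so that a point of the i-th prolongation extends to a
  compatible sequence of jets of increasing orders, each lying in its prolongation.  Such a
  sequence prescribes, in one fibered chart, all derivatives of a section at a point, and by the lemma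
  of Borel (\<open>borel_lemma\<close>) there is a smooth section with these derivatives; its infinite jet is a formal
  solution.  That agreement of derivatives in one fibered chart implies equality of jets is the
  transformation law \<open>partial_composite_jet_coordinates\<close>: in another chart the derivatives up to order n
  are functions of those up to order n in the first one.

  It remains to see that the projections between the prolongations are submersions.  For successive
  levels this is formal integrability, and submersions compose (\<open>submersion_compose\<close>).  For equal
  levels it is the statement that the slice charts of a prolongation are compatible with each other.
  Charts are only required to be compatible with the atlas, so their changes have to be factored
  through jet charts; this requires that jet charts are homeomorphisms onto open sets
  (\<open>jet_chart_top_chart\<close>), which follows from the same two facts, the transformation law
  and the lemma of Borel.

  The underlying calculus on coordinate spaces (chain rule, symmetry of second derivatives) is
  developed directly from the existence and continuity of iterated partial derivatives.
\<close>

section \<open>Functions of class n on coordinate spaces\<close>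

abbreviation rel_open :: "'i set \<Rightarrow> ('i \<Rightarrow> real) set \<Rightarrow> bool" where
  "rel_open I W \<equiv> openin (top_of_set (coord_space I)) W"

lemma coord_space_update: "v \<in> coord_space I \<Longrightarrow> i \<in> I \<Longrightarrow> v(i := t) \<in> coord_space I"
  by (auto simp: coord_space_def)

lemma rel_open_subset: "rel_open I W \<Longrightarrow> W \<subseteq> coord_space I"
  by (simp add: openin_imp_subset)

text \<open>
  Basic open sets of the product topology restrict finitely many coordinates; since the labels in
  \<open>I\<close> are finite in number and all other coordinates vanish, a cube is a neighbourhood.
\<close>

lemma rel_open_box:
  fixes I :: "'i set"
  assumes fin: "finite I" and op: "rel_open I W" and v: "v \<in> W"
  obtains e where "e > 0"
    "\<And>u. u \<in> coord_space I \<Longrightarrow> (\<And>i. i \<in> I \<Longrightarrow> \<bar>u i - v i\<bar> < e) \<Longrightarrow> u \<in> W"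
proof -
  obtain T where T: "open T" "W = coord_space I \<inter> T"
    using op by (auto simp: openin_open)
  have "openin (product_topology (\<lambda>i. euclidean) UNIV) T"
    using T(1) by (simp add: open_fun_def)
  then obtain B where B: "v \<in> (\<Pi>\<^sub>E i\<in>UNIV. B i)" "\<And>i. openin euclidean (B i)" 
      "(\<Pi>\<^sub>E i\<in>UNIV. B i) \<subseteq> T"
    using product_topology_open_contains_basis[of "\<lambda>i. euclidean" UNIV T v] v T(2) by auto
  have "\<exists>e>0. ball (v i) e \<subseteq> B i" for i
    using B(1) B(2)[of i] by (auto simp: open_contains_ball PiE_iff)
  then obtain e where e: "\<And>i. e i > 0" "\<And>i. ball (v i) (e i) \<subseteq> B i"
    by metis
  define d where "d = Min (insert 1 (e ` I))"
  show ?thesis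
  proof
    show "d > 0"
      unfolding d_def using fin e(1) by (subst Min_gr_iff) auto
    fix u assume u: "u \<in> coord_space I" "\<And>i. i \<in> I \<Longrightarrow> \<bar>u i - v i\<bar> < d"
    have "u i \<in> B i" for i
    proof (cases "i \<in> I")
      case True
      then have "d \<le> e i" unfolding d_def using fin by (intro Min_le) auto
      then have "u i \<in> ball (v i) (e i)"
        using u(2)[OF True] by (simp add: dist_real_def abs_minus_commute)
      then show ?thesis using e(2) by blast
    next
      case False
      then have "u i = v i" using u(1) v T(2) by (auto simp: coord_space_def)
      then show ?thesis using B(1) by (auto simp: PiE_iff)
    qed
    then have "u \<in> T" using B(3) by (auto simp: PiE_iff)
    then show "u \<in> W" using u(1) T(2) by blast
  qed
qed

lemma rel_open_update_nhds:
  assumes fin: "finite I" and op: "rel_open I W" and v: "v \<in> W" and i: "i \<in> I"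
  shows "\<forall>\<^sub>F t in nhds (v i). v(i := t) \<in> W"
proof -
  obtain e where e: "e > 0"
    "\<And>u. u \<in> coord_space I \<Longrightarrow> (\<And>i. i \<in> I \<Longrightarrow> \<bar>u i - v i\<bar> < e) \<Longrightarrow> u \<in> W"
    using rel_open_box[OF fin op v] by blast
  have "v \<in> coord_space I" using rel_open_subset[OF op] v by blast
  then have "v(i := t) \<in> W" if "dist t (v i) < e" for t
    using that e(1) i by (intro e(2)) (auto simp: dist_real_def coord_space_update)
  then show ?thesis
    using e(1) by (auto simp: eventually_nhds_metric)
qed

lemma rel_open_whole: "rel_open I (coord_space I)"
  by simp

lemma C_diff_on_continuous: "C_diff_on n I W g \<Longrightarrow> continuous_on W g"
  by (cases n) auto

lemma C_diff_on_mono: "C_diff_on n I W g \<Longrightarrow> W' \<subseteq> W \<Longrightarrow> I' \<subseteq> I \<Longrightarrow> C_diff_on n I' W' g"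
proof (induction n arbitrary: g)
  case 0
  then show ?case using continuous_on_subset by auto
next
  case (Suc n)
  then show ?case using continuous_on_subset[of W g W'] by (simp add: subset_iff)
qed

lemma C_diff_on_SucD: "C_diff_on (Suc n) I W g \<Longrightarrow> C_diff_on n I W g"
  by (induction n arbitrary: g) auto

lemma smooth_on_mono: "smooth_on I W g \<Longrightarrow> W' \<subseteq> W \<Longrightarrow> I' \<subseteq> I \<Longrightarrow> smooth_on I' W' g"
  unfolding smooth_on_def by (intro allI, rule C_diff_on_mono) simp_all

lemma C_diff_on_has_partial:
  assumes "C_diff_on (Suc n) I W g" "v(i := t) \<in> W" "i \<in> I"
  shows "((\<lambda>s. g (v(i := s))) has_field_derivative partial i g (v(i := t))) (at t)"
proof -
  have "(\<lambda>s. g ((v(i := t))(i := s))) differentiable (at ((v(i := t)) i))"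
    using assms(2,3) C_diff_on.simps(2)[THEN iffD1, OF assms(1)] by blast
  then have "(\<lambda>s. g (v(i := s))) differentiable (at t)" by simp
  then have "((\<lambda>s. g (v(i := s))) has_field_derivative deriv (\<lambda>s. g (v(i := s))) t) (at t)"
    by (simp add: DERIV_deriv_iff_real_differentiable)
  then show ?thesis by (simp add: partial_def)
qed

lemma C_diff_on_has_partial':
  assumes "C_diff_on (Suc n) I W g" "v \<in> W" "i \<in> I"
  shows "((\<lambda>s. g (v(i := s))) has_field_derivative partial i g v) (at (v i))"
  using C_diff_on_has_partial[OF assms(1), of v i "v i"] assms by simp

lemma smooth_onD: "smooth_on I W g \<Longrightarrow> C_diff_on n I W g"
  by (simp add: smooth_on_def)

lemma smooth_on_partial: "smooth_on I W g \<Longrightarrow> i \<in> I \<Longrightarrow> smooth_on I W (partial i g)"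
  unfolding smooth_on_def
proof
  fix n assume "\<forall>n. C_diff_on n I W g" "i \<in> I"
  then have "C_diff_on (Suc n) I W g" by blast
  then show "C_diff_on n I W (partial i g)" using \<open>i \<in> I\<close> by simp
qed

lemma smooth_on_foldr_partial:
  "smooth_on I W g \<Longrightarrow> set L \<subseteq> I \<Longrightarrow> smooth_on I W (foldr partial L g)"
  by (induction L) (simp_all add: smooth_on_partial)

lemma smooth_on_continuous: "smooth_on I W g \<Longrightarrow> continuous_on W g"
  using smooth_onD[of I W g 0] by simp

context
  fixes I :: "'i set" and W :: "('i \<Rightarrow> real) set"
  assumes fin: "finite I" and op: "rel_open I W"
begin

text \<open>
  A partial derivative at v sees the values near v, and functions read in charts are arbitrary
  off the image of the chart.  This is why openness accompanies every congruence rule below.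
\<close>

lemma partial_cong:
  assumes "\<And>v. v \<in> W \<Longrightarrow> f v = g v" "v \<in> W" "i \<in> I"
  shows "partial i f v = partial i g v"
  unfolding partial_def
proof (rule deriv_cong_ev)
  show "\<forall>\<^sub>F t in nhds (v i). f (v(i := t)) = g (v(i := t))"
    using rel_open_update_nhds[OF fin op assms(2,3)] by eventually_elim (rule assms(1))
qed simp

lemma foldr_partial_cong:
  assumes "\<And>v. v \<in> W \<Longrightarrow> f v = g v" "set L \<subseteq> I" "v \<in> W"
  shows "foldr partial L f v = foldr partial L g v"
  using assms(2,3)
proof (induction L arbitrary: v)
  case (Cons i L)
  then show ?case by (auto intro!: partial_cong)
qed (simp add: assms(1))

lemma C_diff_on_cong:
  assumes "\<And>v. v \<in> W \<Longrightarrow> f v = g v" "C_diff_on n I W f"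
  shows "C_diff_on n I W g"
  using assms
proof (induction n arbitrary: f g)
  case 0
  then show ?case using continuous_on_cong[of W W f g] by auto
next
  case (Suc n)
  have "continuous_on W g"
    using continuous_on_cong[of W W f g] Suc.prems by auto
  moreover have "(\<lambda>t. g (v(i := t))) differentiable (at (v i))" if "v \<in> W" "i \<in> I" for v i
  proof -
    have "((\<lambda>t. f (v(i := t))) has_field_derivative partial i f v) (at (v i))"
      using C_diff_on_has_partial'[OF Suc.prems(2) that] .
    moreover have "\<forall>\<^sub>F t in nhds (v i). f (v(i := t)) = g (v(i := t))"
      using rel_open_update_nhds[OF fin op that] by eventually_elim (rule Suc.prems(1))
    ultimately have "((\<lambda>t. g (v(i := t))) has_field_derivative partial i f v) (at (v i))"
      by (subst (asm) DERIV_cong_ev[OF refl _ refl]) auto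
    then show ?thesis by (auto simp: real_differentiable_def)
  qed
  moreover have "C_diff_on n I W (partial i g)" if "i \<in> I" for i
  proof (rule Suc.IH[of "partial i f"])
    show "partial i f v = partial i g v" if "v \<in> W" for v
      using Suc.prems(1) that \<open>i \<in> I\<close> by (rule partial_cong)
    show "C_diff_on n I W (partial i f)" using Suc.prems(2) that by simp
  qed
  ultimately show ?case by simp
qed

lemma C_diff_on_SucI:
  assumes "continuous_on W g"
    and "\<And>i. i \<in> I \<Longrightarrow> C_diff_on n I W (g' i)"
    and "\<And>i v. i \<in> I \<Longrightarrow> v \<in> W \<Longrightarrow>
      ((\<lambda>t. g (v(i := t))) has_field_derivative g' i v) (at (v i))"
  shows "C_diff_on (Suc n) I W g"
proof -
  have eq: "partial i g v = g' i v" if "i \<in> I" "v \<in> W" for i v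
    using assms(3)[OF that] by (simp add: partial_def DERIV_imp_deriv)
  have "C_diff_on n I W (partial i g)" if "i \<in> I" for i
    by (rule C_diff_on_cong[of "g' i"]) (simp_all add: eq assms(2) that)
  moreover have "(\<lambda>t. g (v(i := t))) differentiable (at (v i))" if "i \<in> I" "v \<in> W" for i v
    using assms(3)[OF that] by (auto simp: real_differentiable_def)
  ultimately show ?thesis using assms(1) by simp
qed

lemma smooth_on_cong:
  assumes "\<And>v. v \<in> W \<Longrightarrow> f v = g v" "smooth_on I W f"
  shows "smooth_on I W g"
  unfolding smooth_on_def
proof
  show "C_diff_on n I W g" for n
    using assms(1) smooth_onD[OF assms(2)] by (rule C_diff_on_cong)
qed

lemma C_diff_on_const: "C_diff_on n I W (\<lambda>v. c)"
proof (induction n arbitrary: c)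
  case (Suc n)
  show ?case by (rule C_diff_on_SucI[where g' = "\<lambda>i v. 0"]) (auto intro: Suc)
qed auto

lemma C_diff_on_coord: "C_diff_on n I W (\<lambda>v. v j)"
proof (cases n)
  case 0
  then show ?thesis
    using continuous_on_subset[OF continuous_on_product_coordinates subset_UNIV] by simp
next
  case (Suc m)
  show ?thesis unfolding Suc
  proof (rule C_diff_on_SucI[where g' = "\<lambda>i v. if i = j then 1 else 0"])
    show "continuous_on W (\<lambda>v. v j)"
      by (rule continuous_on_subset[OF continuous_on_product_coordinates subset_UNIV])
    show "((\<lambda>t. (v(i := t)) j) has_real_derivative (if i = j then 1 else 0)) (at (v i))" for i v
      by (cases "i = j") auto
  qed (rule C_diff_on_const)
qed

lemma C_diff_on_add:
  "C_diff_on n I W f \<Longrightarrow> C_diff_on n I W g \<Longrightarrow> C_diff_on n I W (\<lambda>v. f v + g v)"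
proof (induction n arbitrary: f g)
  case 0
  then show ?case by (auto intro: continuous_on_add)
next
  case (Suc n)
  show ?case
  proof (rule C_diff_on_SucI[where g' = "\<lambda>i v. partial i f v + partial i g v"])
    show "C_diff_on n I W (\<lambda>v. partial i f v + partial i g v)" if "i \<in> I" for i
      using Suc.prems that by (intro Suc.IH) simp_all
    show "continuous_on W (\<lambda>v. f v + g v)"
      using Suc.prems[THEN C_diff_on_continuous] by (rule continuous_on_add)
    fix i v assume "i \<in> I" "v \<in> W"
    then show "((\<lambda>t. f (v(i := t)) + g (v(i := t))) has_field_derivative 
      partial i f v + partial i g v) (at (v i))"
      using Suc.prems by (intro DERIV_add C_diff_on_has_partial')
  qed
qed

lemma C_diff_on_mult:
  "C_diff_on n I W f \<Longrightarrow> C_diff_on n I W g \<Longrightarrow> C_diff_on n I W (\<lambda>v. f v * g v)"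
proof (induction n arbitrary: f g)
  case 0
  then show ?case by (auto intro: continuous_on_mult)
next
  case (Suc n)
  show ?case
  proof (rule C_diff_on_SucI[where g' = "\<lambda>i v. partial i f v * g v + partial i g v * f v"])
    show "C_diff_on n I W (\<lambda>v. partial i f v * g v + partial i g v * f v)" if "i \<in> I" for i
      using Suc.prems that C_diff_on_SucD[OF Suc.prems(1)] C_diff_on_SucD[OF Suc.prems(2)]
      by (intro C_diff_on_add Suc.IH) simp_all
    show "continuous_on W (\<lambda>v. f v * g v)"
      using Suc.prems[THEN C_diff_on_continuous] by (rule continuous_on_mult)
    fix i v assume "i \<in> I" "v \<in> W"
    then have "((\<lambda>t. f (v(i := t)) * g (v(i := t))) has_field_derivative 
      partial i f v * g (v(i := v i)) + partial i g v * f (v(i := v i))) (at (v i))"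
      using Suc.prems by (intro DERIV_mult C_diff_on_has_partial')
    then show "((\<lambda>t. f (v(i := t)) * g (v(i := t))) has_field_derivative 
      partial i f v * g v + partial i g v * f v) (at (v i))" by simp
  qed
qed

lemma C_diff_on_sum:
  "(\<And>j. j \<in> J \<Longrightarrow> C_diff_on n I W (f j)) \<Longrightarrow> C_diff_on n I W (\<lambda>v. \<Sum>j\<in>J. f j v)"
  by (induction J rule: infinite_finite_induct) (simp_all add: C_diff_on_const C_diff_on_add)

lemma smooth_on_const: "smooth_on I W (\<lambda>v. c)"
  by (simp add: smooth_on_def C_diff_on_const)

lemma smooth_on_coord: "smooth_on I W (\<lambda>v. v j)"
  by (simp add: smooth_on_def C_diff_on_coord)

lemma smooth_on_mult: "smooth_on I W f \<Longrightarrow> smooth_on I W g \<Longrightarrow> smooth_on I W (\<lambda>v. f v * g v)"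
  by (simp add: smooth_on_def C_diff_on_mult)

lemma smooth_on_add: "smooth_on I W f \<Longrightarrow> smooth_on I W g \<Longrightarrow> smooth_on I W (\<lambda>v. f v + g v)"
  by (simp add: smooth_on_def C_diff_on_add)

lemma smooth_on_sum:
  "(\<And>j. j \<in> J \<Longrightarrow> smooth_on I W (f j)) \<Longrightarrow> smooth_on I W (\<lambda>v. \<Sum>j\<in>J. f j v)"
  by (simp add: smooth_on_def C_diff_on_sum)

end

text \<open>
  The partial derivatives in the definition are those of the globally given function, so the claim
  reduces to the locality of continuity.
\<close>

lemma C_diff_on_local:
  assumes "\<And>v. v \<in> W \<Longrightarrow> \<exists>V. openin (top_of_set W) V \<and> v \<in> V \<and> C_diff_on n I V g"
  shows "C_diff_on n I W g"
proof -
  have cont: "continuous_on W f"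
    if loc: "\<And>v. v \<in> W \<Longrightarrow> \<exists>V. openin (top_of_set W) V \<and> v \<in> V \<and> continuous_on V f" for f :: "_ \<Rightarrow> real"
  proof -
    have "(f \<longlongrightarrow> f v) (at v within W)" if v: "v \<in> W" for v
    proof -
      obtain V where V: "openin (top_of_set W) V" "v \<in> V" "continuous_on V f"
        using loc v by blast
      obtain T where T: "open T" "V = W \<inter> T" using V(1) by (auto simp: openin_open)
      have "at v within V = at v within W"
        unfolding T(2) using T V(2) by (intro at_within_nhd[of _ T]) auto
      then show ?thesis
        using V(2,3) by (auto simp: continuous_on_def)
    qed
    then show ?thesis by (simp add: continuous_on_def)
  qed
  show ?thesis using assms
  proof (induction n arbitrary: g)
    case 0
    then show ?case by (auto intro: cont)
  next
    case (Suc n)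
    have "continuous_on W g"
    proof (rule cont)
      fix v assume "v \<in> W"
      from Suc.prems[OF this]
      show "\<exists>V. openin (top_of_set W) V \<and> v \<in> V \<and> continuous_on V g" by auto
    qed
    moreover have "(\<lambda>t. g (v(i := t))) differentiable (at (v i))" if "v \<in> W" "i \<in> I" for v i
      using Suc.prems[OF that(1)] that by auto
    moreover have "C_diff_on n I W (partial i g)" if "i \<in> I" for i
    proof (rule Suc.IH)
      fix v assume "v \<in> W"
      from Suc.prems[OF this]
      show "\<exists>V. openin (top_of_set W) V \<and> v \<in> V \<and> C_diff_on n I V (partial i g)"
        using that by auto
    qed
    ultimately show ?case by simp
  qed
qed

lemma smooth_on_local:
  assumes "\<And>v. v \<in> W \<Longrightarrow> \<exists>V. openin (top_of_set W) V \<and> v \<in> V \<and> smooth_on I V g"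
  shows "smooth_on I W g"
  unfolding smooth_on_def
proof
  fix n show "C_diff_on n I W g"
  proof (rule C_diff_on_local)
    fix v assume "v \<in> W"
    from assms[OF this] obtain V where "openin (top_of_set W) V" "v \<in> V" "smooth_on I V g"
      by blast
    then show "\<exists>V. openin (top_of_set W) V \<and> v \<in> V \<and> C_diff_on n I V g"
      using smooth_onD by blast
  qed
qed

section \<open>Chain rule and composition\<close>

text \<open>
  Continuity of the partial derivatives is what makes the linear approximation hold in all
  directions at once: the coordinates are moved one at a time, and the mean value inequality bounds
  each of these moves.
\<close>

lemma increment_estimate:
  fixes G :: "('j \<Rightarrow> real) \<Rightarrow> real"
  assumes fin: "finite J" and op: "rel_open J W" and G: "C_diff_on (Suc 0) J W G"
    and y0: "y0 \<in> W" and eps: "\<epsilon> > 0"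
  obtains d where "d > 0"
    "\<And>y. y \<in> coord_space J \<Longrightarrow> (\<And>j. j \<in> J \<Longrightarrow> \<bar>y j - y0 j\<bar> < d) \<Longrightarrow>
      \<bar>G y - G y0 - (\<Sum>j\<in>J. partial j G y0 * (y j - y0 j))\<bar> \<le> \<epsilon> * (\<Sum>j\<in>J. \<bar>y j - y0 j\<bar>)"
proof -
  have y0': "y0 \<in> coord_space J" using rel_open_subset[OF op] y0 by blast
  \<comment> \<open>The sum allows one open condition to control all partial derivatives.\<close>
  define q where "q u = (\<Sum>j\<in>J. \<bar>partial j G u - partial j G y0\<bar>)" for u
  have "continuous_on W q"
    unfolding q_def using G by (intro continuous_intros) auto
  then have "openin (top_of_set W) (W \<inter> q -` {..<\<epsilon>})"
    by (intro continuous_openin_preimage_gen) auto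
  then have "rel_open J (W \<inter> q -` {..<\<epsilon>})"
    using op openin_trans by blast
  moreover have "y0 \<in> W \<inter> q -` {..<\<epsilon>}"
    using y0 eps by (simp add: q_def)
  ultimately obtain d where d: "d > 0"
    "\<And>u. u \<in> coord_space J \<Longrightarrow> (\<And>j. j \<in> J \<Longrightarrow> \<bar>u j - y0 j\<bar> < d) \<Longrightarrow> u \<in> W \<inter> q -` {..<\<epsilon>}"
    using rel_open_box[OF fin] by metis
  have est: "\<bar>G y - G y0 - (\<Sum>j\<in>S. partial j G y0 * (y j - y0 j))\<bar> \<le> \<epsilon> * (\<Sum>j\<in>S. \<bar>y j - y0 j\<bar>)"
    if "finite S" "S \<subseteq> J" "y \<in> coord_space J" "\<And>j. j \<in> J \<Longrightarrow> \<bar>y j - y0 j\<bar> < d"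
      "\<And>j. j \<in> J - S \<Longrightarrow> y j = y0 j" for S y
    using that
  proof (induction S arbitrary: y rule: finite_induct)
    case empty
    then have "y = y0" using y0' by (fastforce simp: coord_space_def)
    then show ?case by simp
  next
    case (insert s S)
    \<comment> \<open>The point from which the coordinate s is moved.\<close>
    let ?y = "y(s := y0 s)"
    have s: "s \<in> J" using insert.prems by blast
    have dif: "(\<Sum>j\<in>S. f ((y(s := c)) j) j) = (\<Sum>j\<in>S. f (y j) j)" for f :: "real \<Rightarrow> 'j \<Rightarrow> real" and c
      using insert.hyps by (intro sum.cong) auto
    have 1: "\<bar>G ?y - G y0 - (\<Sum>j\<in>S. partial j G y0 * (y j - y0 j))\<bar> \<le> \<epsilon> * (\<Sum>j\<in>S. \<bar>y j - y0 j\<bar>)"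
    proof -
      have "\<bar>G ?y - G y0 - (\<Sum>j\<in>S. partial j G y0 * (?y j - y0 j))\<bar> \<le> \<epsilon> * (\<Sum>j\<in>S. \<bar>?y j - y0 j\<bar>)"
        using insert.prems s d(1)
        by (intro insert.IH coord_space_update) auto
      then show ?thesis
        using dif[where f = "\<lambda>z j. partial j G y0 * (z - y0 j)" and c = "y0 s"]
          dif[where f = "\<lambda>z j. \<bar>z - y0 j\<bar>" and c = "y0 s"] by simp
    qed
    let ?S = "closed_segment (y0 s) (y s)"
    have inq: "y(s := t) \<in> W \<inter> q -` {..<\<epsilon>}" if "t \<in> ?S" for t
    proof (rule d(2))
      show "y(s := t) \<in> coord_space J" using insert.prems s by (intro coord_space_update) auto
      have "\<bar>t - y0 s\<bar> \<le> \<bar>y s - y0 s\<bar>"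
        using that by (auto simp: closed_segment_eq_real_ivl split: if_splits)
      then show "\<bar>(y(s := t)) j - y0 j\<bar> < d" if "j \<in> J" for j
        using insert.prems(3)[OF that] insert.prems(3)[OF s] by auto
    qed
    have "norm ((G (y(s := y s)) - partial s G y0 * y s) - (G (y(s := y0 s)) - partial s G y0 * y0 s))
        \<le> \<epsilon> * norm (y s - y0 s)"
    proof (rule field_differentiable_bound[where S = ?S
          and f' = "\<lambda>t. partial s G (y(s := t)) - partial s G y0"])
      fix t assume t: "t \<in> ?S"
      show "((\<lambda>t. G (y(s := t)) - partial s G y0 * t) has_field_derivative
          partial s G (y(s := t)) - partial s G y0) (at t within ?S)"
        using inq[OF t] s
        by (auto intro!: derivative_eq_intros DERIV_subset[OF C_diff_on_has_partial[OF G]])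
      have "\<bar>partial s G (y(s := t)) - partial s G y0\<bar> \<le> q (y(s := t))"
        unfolding q_def using fin s by (intro member_le_sum) auto
      also have "\<dots> \<le> \<epsilon>" using inq[OF t] by auto
      finally show "norm (partial s G (y(s := t)) - partial s G y0) \<le> \<epsilon>" by simp
    qed auto
    then have 2: "\<bar>G y - G ?y - partial s G y0 * (y s - y0 s)\<bar> \<le> \<epsilon> * \<bar>y s - y0 s\<bar>"
      by (simp add: algebra_simps)
    have "\<bar>G y - G y0 - (partial s G y0 * (y s - y0 s) + (\<Sum>j\<in>S. partial j G y0 * (y j - y0 j)))\<bar>
       \<le> \<epsilon> * \<bar>y s - y0 s\<bar> + \<epsilon> * (\<Sum>j\<in>S. \<bar>y j - y0 j\<bar>)"
      using 1 2 by linarith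
    then show ?case
      using insert.hyps by (simp add: distrib_left)
  qed
  show ?thesis
    by (rule that[OF d(1)]) (use est[OF fin] in auto)
qed

lemma has_field_derivative_along_curve:
  fixes G :: "('j \<Rightarrow> real) \<Rightarrow> real" and \<gamma> :: "real \<Rightarrow> 'j \<Rightarrow> real"
  assumes fin: "finite J" and op: "rel_open J W" and G: "C_diff_on (Suc 0) J W G"
    and t0: "\<gamma> t0 \<in> W" and \<gamma>: "\<forall>\<^sub>F t in at t0. \<gamma> t \<in> coord_space J"
    and der: "\<And>j. j \<in> J \<Longrightarrow> ((\<lambda>t. \<gamma> t j) has_field_derivative d j) (at t0)"
  shows "((\<lambda>t. G (\<gamma> t)) has_field_derivative (\<Sum>j\<in>J. partial j G (\<gamma> t0) * d j)) (at t0)"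
proof -
  let ?D = "\<lambda>j. partial j G (\<gamma> t0)"
  have quot: "((\<lambda>t. (\<gamma> t j - \<gamma> t0 j) / (t - t0)) \<longlongrightarrow> d j) (at t0)" if "j \<in> J" for j
    using der[OF that] by (simp add: has_field_derivative_iff)
  define R where "R t = G (\<gamma> t) - G (\<gamma> t0) - (\<Sum>j\<in>J. ?D j * (\<gamma> t j - \<gamma> t0 j))" for t
  have "((\<lambda>t. R t / (t - t0)) \<longlongrightarrow> 0) (at t0)"
  proof (rule tendstoI)
    fix e :: real assume e: "e > 0"
    define B where "B = (\<Sum>j\<in>J. \<bar>d j\<bar>) + 1"
    have B: "B > 0" unfolding B_def by (simp add: add_nonneg_pos sum_nonneg)
    obtain c where c: "c > 0"
      "\<And>y. y \<in> coord_space J \<Longrightarrow> (\<And>j. j \<in> J \<Longrightarrow> \<bar>y j - \<gamma> t0 j\<bar> < c) \<Longrightarrow>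
        \<bar>G y - G (\<gamma> t0) - (\<Sum>j\<in>J. ?D j * (y j - \<gamma> t0 j))\<bar> \<le> e / (2 * B) * (\<Sum>j\<in>J. \<bar>y j - \<gamma> t0 j\<bar>)"
      using increment_estimate[OF fin op G t0, of "e / (2 * B)"] e B by auto
    have "((\<lambda>t. \<gamma> t j) \<longlongrightarrow> \<gamma> t0 j) (at t0)" if "j \<in> J" for j
      using DERIV_isCont[OF der[OF that]] by (simp add: isCont_def)
    then have "\<forall>\<^sub>F t in at t0. \<bar>\<gamma> t j - \<gamma> t0 j\<bar> < c" if "j \<in> J" for j
      using that c(1) tendstoD[of "\<lambda>t. \<gamma> t j" "\<gamma> t0 j" "at t0" c] by (simp add: dist_real_def)
    then have near: "\<forall>\<^sub>F t in at t0. \<forall>j\<in>J. \<bar>\<gamma> t j - \<gamma> t0 j\<bar> < c"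
      using fin by (intro eventually_ball_finite) auto
    have "((\<lambda>t. \<Sum>j\<in>J. \<bar>(\<gamma> t j - \<gamma> t0 j) / (t - t0)\<bar>) \<longlongrightarrow> (\<Sum>j\<in>J. \<bar>d j\<bar>)) (at t0)"
      by (intro tendsto_sum tendsto_rabs quot)
    then have "\<forall>\<^sub>F t in at t0. (\<Sum>j\<in>J. \<bar>(\<gamma> t j - \<gamma> t0 j) / (t - t0)\<bar>) < B"
      by (rule order_tendstoD) (simp add: B_def)
    with near \<gamma> show "\<forall>\<^sub>F t in at t0. dist (R t / (t - t0)) 0 < e"
    proof (eventually_elim)
      case (elim t)
      have "\<bar>R t\<bar> \<le> e / (2 * B) * (\<Sum>j\<in>J. \<bar>\<gamma> t j - \<gamma> t0 j\<bar>)"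
        unfolding R_def using elim by (intro c(2)) auto
      then have "\<bar>R t\<bar> / \<bar>t - t0\<bar> \<le> e / (2 * B) * (\<Sum>j\<in>J. \<bar>\<gamma> t j - \<gamma> t0 j\<bar>) / \<bar>t - t0\<bar>"
        by (rule divide_right_mono) simp
      also have "\<dots> = e / (2 * B) * (\<Sum>j\<in>J. \<bar>(\<gamma> t j - \<gamma> t0 j) / (t - t0)\<bar>)"
        by (simp add: sum_divide_distrib[symmetric])
      also have "\<dots> \<le> e / (2 * B) * B"
        using elim e B by (intro mult_left_mono) auto
      also have "\<dots> < e" using e B by simp
      finally show ?case by (simp add: dist_real_def)
    qed
  qed
  then have "((\<lambda>t. R t / (t - t0) + (\<Sum>j\<in>J. ?D j * ((\<gamma> t j - \<gamma> t0 j) / (t - t0)))) \<longlongrightarrow>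
      0 + (\<Sum>j\<in>J. ?D j * d j)) (at t0)"
    by (intro tendsto_add tendsto_sum tendsto_mult_left quot)
  moreover have "R t / (t - t0) + (\<Sum>j\<in>J. ?D j * ((\<gamma> t j - \<gamma> t0 j) / (t - t0)))
      = (G (\<gamma> t) - G (\<gamma> t0)) / (t - t0)" for t
  proof -
    have "(\<Sum>j\<in>J. ?D j * ((\<gamma> t j - \<gamma> t0 j) / (t - t0))) =
        (\<Sum>j\<in>J. ?D j * (\<gamma> t j - \<gamma> t0 j)) / (t - t0)"
      by (simp add: sum_divide_distrib)
    then show ?thesis
      by (simp add: R_def add_divide_distrib[symmetric])
  qed
  ultimately show ?thesis by (simp add: has_field_derivative_iff)
qed

lemma has_partial_compose:
  fixes F :: "('i \<Rightarrow> real) \<Rightarrow> 'j \<Rightarrow> real"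
  assumes "finite I" "rel_open I V" "finite J" "rel_open J W" "\<And>v. v \<in> V \<Longrightarrow> F v \<in> W"
    and "\<And>j. j \<in> J \<Longrightarrow> C_diff_on (Suc 0) I V (\<lambda>v. F v j)" "C_diff_on (Suc 0) J W G"
    and v: "v \<in> V" and i: "i \<in> I"
  shows "((\<lambda>t. G (F (v(i := t)))) has_field_derivative
    (\<Sum>j\<in>J. partial j G (F v) * partial i (\<lambda>v. F v j) v)) (at (v i))"
proof -
  have "((\<lambda>t. G (F (v(i := t)))) has_field_derivative
    (\<Sum>j\<in>J. partial j G (F (v(i := v i))) * partial i (\<lambda>v. F v j) v)) (at (v i))"
  proof (rule has_field_derivative_along_curve[OF assms(3,4,7)])
    show "F (v(i := v i)) \<in> W" using assms(5) v by simp
    have "\<forall>\<^sub>F t in nhds (v i). v(i := t) \<in> V"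
      using assms(1,2) v i by (rule rel_open_update_nhds)
    then have "\<forall>\<^sub>F t in at (v i). v(i := t) \<in> V"
      by (rule eventually_nhds_conv_at[THEN iffD1, THEN conjunct1])
    then show "\<forall>\<^sub>F t in at (v i). F (v(i := t)) \<in> coord_space J"
      by eventually_elim (use assms(5) rel_open_subset[OF assms(4)] in blast)
    show "((\<lambda>t. F (v(i := t)) j) has_real_derivative partial i (\<lambda>v. F v j) v) (at (v i))"
      if "j \<in> J" for j
      using C_diff_on_has_partial'[OF assms(6)[OF that] v i] .
  qed
  then show ?thesis by simp
qed

text \<open>
  The chain rule expresses the partial derivatives of a composition through functions of the same
  kind with one derivative less, so that induction on the order applies.
\<close>

lemma C_diff_on_compose:
  fixes F :: "('i \<Rightarrow> real) \<Rightarrow> 'j \<Rightarrow> real"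
  assumes I: "finite I" "rel_open I V" and J: "finite J" "rel_open J W"
    and F: "\<And>v. v \<in> V \<Longrightarrow> F v \<in> W"
    and "\<And>j. j \<in> J \<Longrightarrow> C_diff_on n I V (\<lambda>v. F v j)" "C_diff_on n J W G"
  shows "C_diff_on n I V (\<lambda>v. G (F v))"
  using assms(6-)
proof (induction n arbitrary: G)
  have cont: "continuous_on V (\<lambda>v. G (F v))"
    if "\<And>j. j \<in> J \<Longrightarrow> continuous_on V (\<lambda>v. F v j)" "continuous_on W G" for G
  proof (rule continuous_on_compose2[OF that(2)])
    show "continuous_on V F"
    proof (rule continuous_on_coordinatewise_then_product)
      fix j
      show "continuous_on V (\<lambda>v. F v j)"
      proof (cases "j \<in> J")
        case False
        then have "F v j = 0" if "v \<in> V" for v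
          using F[OF that] rel_open_subset[OF J(2)] by (auto simp: coord_space_def)
        then show ?thesis using continuous_on_cong[of V V "\<lambda>v. F v j" "\<lambda>v. 0"] by simp
      qed (use that in auto)
    qed
  qed (use F in auto)
  {
    case 0
    then show ?case using cont by simp
  next
    case (Suc n)
    show ?case
    proof (rule C_diff_on_SucI[OF I, where g' =
          "\<lambda>i v. \<Sum>j\<in>J. partial j G (F v) * partial i (\<lambda>v. F v j) v"])
      show "continuous_on V (\<lambda>v. G (F v))"
        using C_diff_on_continuous[OF Suc.prems(1)] C_diff_on_continuous[OF Suc.prems(2)]
        by (rule cont)
      show "C_diff_on n I V (\<lambda>v. \<Sum>j\<in>J. partial j G (F v) * partial i (\<lambda>v. F v j) v)"
        if "i \<in> I" for i
      proof (intro C_diff_on_sum[OF I] C_diff_on_mult[OF I])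
        fix j assume j: "j \<in> J"
        show "C_diff_on n I V (\<lambda>v. partial j G (F v))"
          by (rule Suc.IH[OF C_diff_on_SucD[OF Suc.prems(1)]]) (use Suc.prems(2) j in simp_all)
        show "C_diff_on n I V (partial i (\<lambda>v. F v j))"
          using Suc.prems(1)[OF j] that by simp
      qed
      have down: "C_diff_on (Suc 0) I' W' g" if "C_diff_on (Suc n) I' W' g"
        for I' :: "'k set" and W' g
      proof -
        have "C_diff_on n I' W' (partial i g)" if "i \<in> I'" for i
          using \<open>C_diff_on (Suc n) I' W' g\<close> that by simp
        then have "continuous_on W' (partial i g)" if "i \<in> I'" for i
          using C_diff_on_continuous that by blast
        then show ?thesis using that by simp
      qed
      show "((\<lambda>t. G (F (v(i := t)))) has_real_derivative
          (\<Sum>j\<in>J. partial j G (F v) * partial i (\<lambda>v. F v j) v)) (at (v i))"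
        if "i \<in> I" "v \<in> V" for i v
        by (rule has_partial_compose[OF I J F])
          (use that Suc.prems(1)[THEN down] Suc.prems(2)[THEN down] in simp_all)
    qed
  }
qed

lemma smooth_on_compose:
  fixes F :: "('i \<Rightarrow> real) \<Rightarrow> 'j \<Rightarrow> real"
  assumes I: "finite I" "rel_open I V" and J: "finite J" "rel_open J W"
    and F: "\<And>v. v \<in> V \<Longrightarrow> F v \<in> W"
    and "\<And>j. j \<in> J \<Longrightarrow> smooth_on I V (\<lambda>v. F v j)" "smooth_on J W G"
  shows "smooth_on I V (\<lambda>v. G (F v))"
  unfolding smooth_on_def
proof
  show "C_diff_on n I V (\<lambda>v. G (F v))" for n
    by (rule C_diff_on_compose[OF I J]) (simp_all add: F smooth_onD assms(6,7))
qed

lemma partial_compose: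
  fixes F :: "('i \<Rightarrow> real) \<Rightarrow> 'j \<Rightarrow> real"
  assumes "finite I" "rel_open I V" "finite J" "rel_open J W" "\<And>v. v \<in> V \<Longrightarrow> F v \<in> W"
    and "\<And>j. j \<in> J \<Longrightarrow> smooth_on I V (\<lambda>v. F v j)" "smooth_on J W G"
    and v: "v \<in> V" and i: "i \<in> I"
  shows "partial i (\<lambda>v. G (F v)) v = (\<Sum>j\<in>J. partial j G (F v) * partial i (\<lambda>v. F v j) v)"
  using DERIV_imp_deriv[OF has_partial_compose[OF assms(1-5) smooth_onD[OF assms(6)]
      smooth_onD[OF assms(7)] v i]]
  by (simp add: partial_def)

section \<open>Symmetry of second derivatives\<close>

text \<open>
  The left-hand side of the equation is symmetric in i and j.  Applying the lemma with both orders
  of the labels therefore compares the two mixed second derivatives at nearby points.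
\<close>

lemma second_difference:
  assumes g: "C_diff_on (Suc (Suc 0)) I W g" and ij: "i \<in> I" "j \<in> I" "i \<noteq> j" and h: "h > 0"
    and box: "\<And>s t. v i \<le> s \<Longrightarrow> s \<le> v i + h \<Longrightarrow> v j \<le> t \<Longrightarrow> t \<le> v j + h \<Longrightarrow> v(i := s, j := t) \<in> W"
  obtains s t where "v i \<le> s" "s \<le> v i + h" "v j \<le> t" "t \<le> v j + h"
    "g (v(i := v i + h, j := v j + h)) - g (v(i := v i + h)) - g (v(j := v j + h)) + g v
      = h * h * partial j (partial i g) (v(i := s, j := t))"
proof -
  define f where "f s = g (v(j := v j + h, i := s)) - g (v(i := s))" for s
  have box': "v(j := v j + h, i := s) \<in> W" "v(i := s) \<in> W" if "v i \<le> s" "s \<le> v i + h" for s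
  proof -
    have "v(i := s, j := v j) = v(i := s)" using ij(3) by (auto simp: fun_eq_iff)
    then show "v(j := v j + h, i := s) \<in> W" "v(i := s) \<in> W"
      using box[OF that, of "v j + h"] box[OF that, of "v j"] h ij(3)
      by (simp_all add: fun_upd_twist)
  qed
  have "(f has_real_derivative partial i g (v(j := v j + h, i := s)) - partial i g (v(i := s))) (at s)"
    if "v i \<le> s" "s \<le> v i + h" for s
    unfolding f_def using box'[OF that] ij
    by (intro DERIV_diff C_diff_on_has_partial[OF C_diff_on_SucD[OF g]])
  from MVT2[of "v i" "v i + h" f, OF _ this] h
  obtain s where s: "v i < s" "s < v i + h"
    "f (v i + h) - f (v i) = h * (partial i g (v(j := v j + h, i := s)) - partial i g (v(i := s)))"
    by auto
  have "((\<lambda>t. partial i g (v(i := s, j := t))) has_real_derivative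
      partial j (partial i g) (v(i := s, j := t))) (at t)" if "v j \<le> t" "t \<le> v j + h" for t
  proof (rule C_diff_on_has_partial[where I = I and W = W and n = 0 and v = "v(i := s)"])
    show "C_diff_on (Suc 0) I W (partial i g)" using g ij(1) by simp
    show "v(i := s, j := t) \<in> W" using box[of s t] s(1,2) that by simp
  qed (rule ij(2))
  from MVT2[of "v j" "v j + h" "\<lambda>t. partial i g (v(i := s, j := t))", OF _ this] h
  obtain t where t: "v j < t" "t < v j + h"
    "partial i g (v(i := s, j := v j + h)) - partial i g (v(i := s, j := v j)) =
      h * partial j (partial i g) (v(i := s, j := t))"
    by auto
  have "v(i := s, j := v j) = v(i := s)" using ij(3) by (auto simp: fun_eq_iff)
  then have "f (v i + h) - f (v i) = h * (h * partial j (partial i g) (v(i := s, j := t)))"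
    using s(3) t(3) ij(3) by (simp add: fun_upd_twist)
  then have "g (v(i := v i + h, j := v j + h)) - g (v(i := v i + h)) - g (v(j := v j + h)) + g v
      = h * h * partial j (partial i g) (v(i := s, j := t))"
    using ij(3) by (simp add: f_def fun_upd_twist)
  from that[OF _ _ _ _ this] show ?thesis using s(1,2) t(1,2) by simp
qed

lemma partial_commute:
  fixes I :: "'i set"
  assumes fin: "finite I" and op: "rel_open I W" and g: "C_diff_on (Suc (Suc 0)) I W g"
    and v: "v \<in> W" and ij: "i \<in> I" "j \<in> I"
  shows "partial i (partial j g) v = partial j (partial i g) v"
proof (cases "i = j")
  case False
  define q where "q u = \<bar>partial i (partial j g) u - partial i (partial j g) v\<bar> +
    \<bar>partial j (partial i g) u - partial j (partial i g) v\<bar>" for u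
  have "continuous_on W q"
    unfolding q_def using g ij by (intro continuous_intros) auto
  have "\<bar>partial i (partial j g) v - partial j (partial i g) v\<bar> \<le> 0 + e" if "e > 0" for e
  proof -
    have "openin (top_of_set W) (W \<inter> q -` {..<e / 2})"
      using \<open>continuous_on W q\<close> by (intro continuous_openin_preimage_gen) auto
    then have "rel_open I (W \<inter> q -` {..<e / 2})"
      using op openin_trans by blast
    moreover have "v \<in> W \<inter> q -` {..<e / 2}"
      using v that by (simp add: q_def)
    ultimately obtain d where d: "d > 0"
      "\<And>u. u \<in> coord_space I \<Longrightarrow> (\<And>i. i \<in> I \<Longrightarrow> \<bar>u i - v i\<bar> < d) \<Longrightarrow> u \<in> W \<inter> q -` {..<e / 2}"
      using rel_open_box[OF fin] by metis
    define h where "h = d / 2"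
    have h: "h > 0" "h < d" using d(1) by (auto simp: h_def)
    have inq: "v(i := s, j := t) \<in> W \<inter> q -` {..<e / 2}"
      if "v i \<le> s" "s \<le> v i + h" "v j \<le> t" "t \<le> v j + h" for s t
      using that h d(1) v rel_open_subset[OF op] ij
      by (intro d(2) coord_space_update) auto
    obtain s t where st: "v i \<le> s" "s \<le> v i + h" "v j \<le> t" "t \<le> v j + h"
      "g (v(i := v i + h, j := v j + h)) - g (v(i := v i + h)) - g (v(j := v j + h)) + g v
        = h * h * partial j (partial i g) (v(i := s, j := t))"
      by (rule second_difference[where v = v, OF g ij False h(1)]) (use inq in blast)+
    have inq': "v(j := t, i := s) \<in> W"
      if "v j \<le> t" "t \<le> v j + h" "v i \<le> s" "s \<le> v i + h" for s t
      using inq[OF that(3,4,1,2)] False by (simp add: fun_upd_twist)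
    obtain s' t' where st': "v j \<le> t'" "t' \<le> v j + h" "v i \<le> s'" "s' \<le> v i + h"
      "g (v(j := v j + h, i := v i + h)) - g (v(j := v j + h)) - g (v(i := v i + h)) + g v
        = h * h * partial i (partial j g) (v(j := t', i := s'))"
      by (rule second_difference[where v = v, OF g ij(2,1) False[symmetric] h(1)]) (use inq' in blast)+
    have "h * h * partial j (partial i g) (v(i := s, j := t)) =
        h * h * partial i (partial j g) (v(i := s', j := t'))"
      using st(5) st'(5)[unfolded fun_upd_twist[OF False[symmetric]]] by linarith
    then have eq: "partial j (partial i g) (v(i := s, j := t)) =
        partial i (partial j g) (v(i := s', j := t'))"
      using h(1) by simp
    have "q (v(i := s, j := t)) < e / 2" "q (v(i := s', j := t')) < e / 2"
      using inq[OF st(1-4)] inq[OF st'(3,4,1,2)] by auto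
    then show ?thesis using eq unfolding q_def by linarith
  qed
  then have "\<bar>partial i (partial j g) v - partial j (partial i g) v\<bar> \<le> 0"
    by (rule field_le_epsilon)
  then show ?thesis by simp
qed simp

lemma foldr_partial_insort:
  fixes I :: "'i::linorder set"
  assumes fin: "finite I" and op: "rel_open I W" and g: "smooth_on I W g"
  shows "v \<in> W \<Longrightarrow> insert i (set L) \<subseteq> I \<Longrightarrow>
    foldr partial (insort i L) g v = partial i (foldr partial L g) v"
proof (induction L arbitrary: v)
  case (Cons a L)
  show ?case
  proof (cases "i \<le> a")
    case False
    have "smooth_on I W (foldr partial L g)"
      using g Cons.prems by (intro smooth_on_foldr_partial) auto
    then have "partial a (partial i (foldr partial L g)) v = partial i (partial a (foldr partial L g)) v"
      using Cons.prems by (intro partial_commute[OF fin op smooth_onD]) auto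
    moreover have "partial a (foldr partial (insort i L) g) v = partial a (partial i (foldr partial L g)) v"
      using Cons.prems by (intro partial_cong[OF fin op] Cons.IH) auto
    ultimately show ?thesis using False by simp
  qed simp
qed simp

text \<open>
  The chain rule produces derivatives in arbitrary order, whereas jets record only the sorted ones.
\<close>

lemma foldr_partial_eq_multi_partial:
  fixes I :: "'i::linorder set"
  assumes fin: "finite I" and op: "rel_open I W" and g: "smooth_on I W g"
  shows "v \<in> W \<Longrightarrow> set L \<subseteq> I \<Longrightarrow> foldr partial L g v = multi_partial (mset L) g v"
  unfolding multi_partial_def sorted_list_of_multiset_mset
proof (induction L arbitrary: v)
  case (Cons i L)
  have "partial i (foldr partial L g) v = partial i (foldr partial (sort L) g) v"
    using Cons.prems by (intro partial_cong[OF fin op] Cons.IH) auto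
  also have "\<dots> = foldr partial (insort i (sort L)) g v"
    using Cons.prems by (intro foldr_partial_insort[OF fin op g, symmetric]) auto
  finally show ?case by simp
qed simp

lemma multi_partial_empty [simp]: "multi_partial {#} g = g"
  by (simp add: multi_partial_def)

lemma smooth_on_multi_partial:
  "smooth_on I W g \<Longrightarrow> set_mset \<alpha> \<subseteq> I \<Longrightarrow> smooth_on I W (multi_partial \<alpha> g)"
  unfolding multi_partial_def by (rule smooth_on_foldr_partial) simp_all

lemma partial_multi_partial:
  fixes I :: "'i::linorder set"
  assumes fin: "finite I" and op: "rel_open I W" and g: "smooth_on I W g"
    and "v \<in> W" "i \<in> I" "set_mset \<alpha> \<subseteq> I"
  shows "partial i (multi_partial \<alpha> g) v = multi_partial (add_mset i \<alpha>) g v"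
  using foldr_partial_eq_multi_partial[OF fin op g, of v "i # sorted_list_of_multiset \<alpha>"] assms(4-)
  by (simp add: multi_partial_def)

section \<open>The lemma of Borel\<close>

text \<open>
  A family of functions labelled by lists of directions, in which consing a label means
  differentiation, consists of iterated partial derivatives of its first member.  It serves to
  compute all derivatives of explicit functions and of uniform limits simultaneously.
\<close>

lemma derivative_family:
  fixes \<Phi> :: "'i list \<Rightarrow> ('i \<Rightarrow> real) \<Rightarrow> real"
  assumes fin: "finite I" and op: "rel_open I W"
    and cont: "\<And>L. set L \<subseteq> I \<Longrightarrow> continuous_on W (\<Phi> L)"
    and der: "\<And>L i v. set L \<subseteq> I \<Longrightarrow> i \<in> I \<Longrightarrow> v \<in> W \<Longrightarrow>
      ((\<lambda>t. \<Phi> L (v(i := t))) has_field_derivative \<Phi> (i # L) v) (at (v i))"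
  shows "set L \<subseteq> I \<Longrightarrow> smooth_on I W (\<Phi> L)"
    and "set L \<subseteq> I \<Longrightarrow> v \<in> W \<Longrightarrow> foldr partial L (\<Phi> []) v = \<Phi> L v"
proof -
  have "C_diff_on n I W (\<Phi> L)" if "set L \<subseteq> I" for n L
    using that
  proof (induction n arbitrary: L)
    case 0
    then show ?case using cont by simp
  next
    case (Suc n)
    show ?case
    proof (rule C_diff_on_SucI[OF fin op, where g' = "\<lambda>i. \<Phi> (i # L)"])
      show "continuous_on W (\<Phi> L)" using Suc.prems by (rule cont)
      show "C_diff_on n I W (\<Phi> (i # L))" if "i \<in> I" for i
        using Suc.prems that by (intro Suc.IH) simp
    qed (rule der[OF Suc.prems])
  qed
  then show "set L \<subseteq> I \<Longrightarrow> smooth_on I W (\<Phi> L)" by (simp add: smooth_on_def)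
  show "set L \<subseteq> I \<Longrightarrow> v \<in> W \<Longrightarrow> foldr partial L (\<Phi> []) v = \<Phi> L v"
  proof (induction L arbitrary: v)
    case (Cons i L)
    have "partial i (foldr partial L (\<Phi> [])) v = partial i (\<Phi> L) v"
      using Cons.prems by (intro partial_cong[OF fin op] Cons.IH) auto
    also have "\<dots> = \<Phi> (i # L) v"
      unfolding partial_def using Cons.prems by (intro DERIV_imp_deriv der) auto
    finally show ?case by simp
  qed simp
qed

lemma foldr_partial_add:
  assumes fin: "finite I" and op: "rel_open I W" and "smooth_on I W f" "smooth_on I W g"
  shows "set L \<subseteq> I \<Longrightarrow> v \<in> W \<Longrightarrow>
    foldr partial L (\<lambda>v. f v + g v) v = foldr partial L f v + foldr partial L g v"
proof (rule derivative_family(2)[OF fin op, of "\<lambda>L v. foldr partial L f v + foldr partial L g v",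
      unfolded foldr.simps id_apply])
  show "continuous_on W (\<lambda>v. foldr partial L f v + foldr partial L g v)" if "set L \<subseteq> I" for L
    using assms(3,4) that
    by (intro continuous_on_add smooth_on_continuous[of I] smooth_on_foldr_partial)
  show "((\<lambda>t. foldr partial L f (v(i := t)) + foldr partial L g (v(i := t))) has_real_derivative
      (partial i \<circ> foldr partial L) f v + (partial i \<circ> foldr partial L) g v) (at (v i))"
    if "set L \<subseteq> I" "i \<in> I" "v \<in> W" for L i v
    unfolding o_apply using assms(3,4) that
    by (intro DERIV_add C_diff_on_has_partial'[where n = 0 and I = I and W = W]
        smooth_onD smooth_on_foldr_partial) simp_all
qed

text \<open>
  Trigonometric polynomials are bounded together with all their derivatives.  In Borel's lemma they
  take the place of the monomials multiplied by cut-off functions.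
\<close>

inductive_set trig_poly :: "(real \<Rightarrow> real) set" where
  trig_poly_const: "(\<lambda>t. c) \<in> trig_poly"
| trig_poly_sin: "sin \<in> trig_poly"
| trig_poly_cos: "cos \<in> trig_poly"
| trig_poly_add: "f \<in> trig_poly \<Longrightarrow> g \<in> trig_poly \<Longrightarrow> (\<lambda>t. f t + g t) \<in> trig_poly"
| trig_poly_mult: "f \<in> trig_poly \<Longrightarrow> g \<in> trig_poly \<Longrightarrow> (\<lambda>t. f t * g t) \<in> trig_poly"

lemma trig_poly_bounded: "f \<in> trig_poly \<Longrightarrow> \<exists>B. \<forall>t. \<bar>f t\<bar> \<le> B"
proof (induction rule: trig_poly.induct)
  case (trig_poly_const c)
  show ?case by (rule exI[of _ "\<bar>c\<bar>"]) simp
next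
  case trig_poly_sin
  show ?case by (rule exI[of _ 1]) simp
next
  case trig_poly_cos
  show ?case by (rule exI[of _ 1]) simp
next
  case (trig_poly_add f g)
  then obtain A B where "\<And>t. \<bar>f t\<bar> \<le> A" "\<And>t. \<bar>g t\<bar> \<le> B" by blast
  then have "\<bar>f t + g t\<bar> \<le> A + B" for t
    by (meson abs_triangle_ineq add_mono order_trans)
  then show ?case by blast
next
  case (trig_poly_mult f g)
  then obtain A B where AB: "\<And>t. \<bar>f t\<bar> \<le> A" "\<And>t. \<bar>g t\<bar> \<le> B" by blast
  then have "0 \<le> A" using abs_ge_zero order_trans by blast
  then have "\<bar>f t * g t\<bar> \<le> A * B" for t
    unfolding abs_mult using AB by (intro mult_mono) auto
  then show ?case by blast
qed

lemma trig_poly_derivative: "f \<in> trig_poly \<Longrightarrow> \<exists>f'\<in>trig_poly. \<forall>t. (f has_field_derivative f' t) (at t)"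
proof (induction rule: trig_poly.induct)
  case (trig_poly_const c)
  show ?case by (rule bexI[OF _ trig_poly.trig_poly_const[of 0]]) simp
next
  case trig_poly_sin
  show ?case by (rule bexI[OF _ trig_poly.trig_poly_cos]) (simp add: DERIV_sin)
next
  case trig_poly_cos
  show ?case
    by (rule bexI[OF _ trig_poly.trig_poly_mult[OF trig_poly.trig_poly_const[of "-1"] trig_poly.trig_poly_sin]])
      (simp add: DERIV_cos)
next
  case (trig_poly_add f g)
  then obtain f' g' where "f' \<in> trig_poly" "g' \<in> trig_poly" "\<forall>t. (f has_field_derivative f' t) (at t)"
    "\<forall>t. (g has_field_derivative g' t) (at t)" by blast
  then show ?case
    by (intro bexI[OF _ trig_poly.trig_poly_add[of f' g']]) (auto intro: DERIV_add)
next
  case (trig_poly_mult f g)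
  then obtain f' g' where *: "f' \<in> trig_poly" "g' \<in> trig_poly" "\<forall>t. (f has_field_derivative f' t) (at t)"
    "\<forall>t. (g has_field_derivative g' t) (at t)" by blast
  show ?case
    by (rule bexI[OF _ trig_poly.trig_poly_add[OF trig_poly.trig_poly_mult[OF *(1) trig_poly_mult(2)]
            trig_poly.trig_poly_mult[OF *(2) trig_poly_mult(1)]]]) (use * in \<open>auto intro: DERIV_mult\<close>)
qed

lemma trig_poly_deriv: "f \<in> trig_poly \<Longrightarrow> deriv f \<in> trig_poly"
  and trig_poly_has_deriv: "f \<in> trig_poly \<Longrightarrow> (f has_field_derivative deriv f t) (at t)"
proof -
  assume "f \<in> trig_poly"
  then obtain f' where f': "f' \<in> trig_poly" "\<And>t. (f has_field_derivative f' t) (at t)"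
    using trig_poly_derivative by blast
  then have "deriv f = f'" by (auto simp: fun_eq_iff DERIV_imp_deriv)
  then show "deriv f \<in> trig_poly" "(f has_field_derivative deriv f t) (at t)" using f' by auto
qed

lemma trig_poly_funpow_deriv: "f \<in> trig_poly \<Longrightarrow> (deriv ^^ k) f \<in> trig_poly"
  by (induction k) (auto intro: trig_poly_deriv)

lemma trig_poly_power: "f \<in> trig_poly \<Longrightarrow> (\<lambda>t. f t ^ n) \<in> trig_poly"
  by (induction n) (auto intro: trig_poly_const[of 1] trig_poly_mult)

text \<open>
  The derivative of \<open>sin\<^sup>m \<cdot> q\<close> is again of the form \<open>sin\<^sup>m\<^sup>-\<^sup>1 \<cdot> r\<close>; hence the zero of order m at 0
  is only removed by the m-th derivative.
\<close>

lemma funpow_deriv_sin_power: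
  "q \<in> trig_poly \<Longrightarrow> k \<le> m \<Longrightarrow>
    (deriv ^^ k) (\<lambda>t. sin t ^ m * q t) 0 = (if k = m then fact m * q 0 else 0)"
proof (induction k arbitrary: m q)
  case 0
  then show ?case by (cases m) auto
next
  case (Suc k)
  then obtain m' where m: "m = Suc m'" by (cases m) auto
  let ?r = "\<lambda>t. real m * (cos t * q t) + sin t * deriv q t"
  have "deriv (\<lambda>t. sin t ^ m * q t) = (\<lambda>t. sin t ^ m' * ?r t)"
  proof (intro ext DERIV_imp_deriv)
    fix t
    show "((\<lambda>t. sin t ^ m * q t) has_real_derivative sin t ^ m' * ?r t) (at t)"
      using DERIV_mult[OF DERIV_power_Suc[OF DERIV_sin, of m' t] trig_poly_has_deriv[OF Suc.prems(1)]]
      by (simp add: m algebra_simps)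
  qed
  then have "(deriv ^^ Suc k) (\<lambda>t. sin t ^ m * q t) 0 = (deriv ^^ k) (\<lambda>t. sin t ^ m' * ?r t) 0"
    by (simp only: funpow_Suc_right o_apply)
  also have "\<dots> = (if k = m' then fact m' * ?r 0 else 0)"
    using Suc.prems m by (intro Suc.IH trig_poly.intros trig_poly_deriv) auto
  finally show ?case by (simp add: m algebra_simps)
qed

text \<open>
  Derivatives of \<open>sin\<^sup>m / m!\<close>, which has the same Taylor polynomial of order m at 0 as \<open>t\<^sup>m / m!\<close> but is
  bounded together with all its derivatives.
\<close>

definition sin_jet :: "nat \<Rightarrow> nat \<Rightarrow> real \<Rightarrow> real" where
  "sin_jet m k = (deriv ^^ k) (\<lambda>t. sin t ^ m * (1 / fact m))"

lemma sin_jet_trig_poly: "sin_jet m k \<in> trig_poly"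
  unfolding sin_jet_def by (intro trig_poly_funpow_deriv trig_poly.intros trig_poly_power)

lemma sin_jet_derivative: "(sin_jet m k has_field_derivative sin_jet m (Suc k) t) (at t)"
  using trig_poly_has_deriv[OF sin_jet_trig_poly, of m k t] by (simp add: sin_jet_def)

lemma sin_jet_0: "k \<le> m \<Longrightarrow> sin_jet m k 0 = (if k = m then 1 else 0)"
  unfolding sin_jet_def by (subst funpow_deriv_sin_power) (auto intro: trig_poly.intros)

lemma continuous_on_sin_jet: "continuous_on A (sin_jet m k)"
  by (rule continuous_at_imp_continuous_on) (use sin_jet_derivative DERIV_isCont in blast)

lemma prod_sin_jet_derivative:
  assumes "finite I" "i \<in> I" "\<epsilon> \<noteq> 0"
  shows "((\<lambda>t. \<Prod>j\<in>I. sin_jet (m j) (c j) (((v(i := t)) j - a j) / \<epsilon>)) has_field_derivative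
    (1 / \<epsilon>) * (\<Prod>j\<in>I. sin_jet (m j) (if j = i then Suc (c j) else c j) ((v j - a j) / \<epsilon>))) (at (v i))"
proof -
  let ?C = "\<Prod>j\<in>I - {i}. sin_jet (m j) (c j) ((v j - a j) / \<epsilon>)"
  have eq: "(\<Prod>j\<in>I. sin_jet (m j) (c j) (((v(i := t)) j - a j) / \<epsilon>)) =
      sin_jet (m i) (c i) ((t - a i) / \<epsilon>) * ?C" for t
    using assms by (subst prod.remove[of _ i]) (auto intro!: prod.cong)
  have "((\<lambda>t. sin_jet (m i) (c i) ((t - a i) / \<epsilon>)) has_field_derivative
      sin_jet (m i) (Suc (c i)) ((v i - a i) / \<epsilon>) * (1 / \<epsilon>)) (at (v i))"
    by (rule DERIV_chain2[OF sin_jet_derivative]) (auto intro!: derivative_eq_intros simp: assms)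
  then have "((\<lambda>t. sin_jet (m i) (c i) ((t - a i) / \<epsilon>) * ?C) has_field_derivative
      (sin_jet (m i) (Suc (c i)) ((v i - a i) / \<epsilon>) * (1 / \<epsilon>)) * ?C) (at (v i))"
    by (rule DERIV_cmult_right)
  moreover have "(\<Prod>j\<in>I. sin_jet (m j) (if j = i then Suc (c j) else c j) ((v j - a j) / \<epsilon>)) =
      sin_jet (m i) (Suc (c i)) ((v i - a i) / \<epsilon>) * ?C"
    using assms by (subst prod.remove[of _ i]) (auto intro!: prod.cong)
  ultimately show ?thesis unfolding eq by (simp add: mult_ac)
qed

text \<open>
  Replacing \<open>g(v)\<close> by \<open>\<epsilon>\<^sup>n g((v - a) / \<epsilon>)\<close> leaves derivatives of order n at a unchanged and multiplies
  derivatives of order l by \<open>\<epsilon>\<^sup>n\<^sup>-\<^sup>l\<close>.  For products g of the functions \<open>sin_jet\<close> of total order n,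
  whose derivatives are bounded, the lower derivatives thus become arbitrarily small.
\<close>

lemma small_function_with_jet:
  fixes I :: "'i::linorder set" and c :: "'i multiset \<Rightarrow> real"
  assumes fin: "finite I" and \<delta>: "\<delta> > 0"
  obtains f where "smooth_on I (coord_space I) f"
    "\<And>L v. set L \<subseteq> I \<Longrightarrow> length L < n \<Longrightarrow> v \<in> coord_space I \<Longrightarrow> \<bar>foldr partial L f v\<bar> \<le> \<delta>"
    "\<And>L. set L \<subseteq> I \<Longrightarrow> length L \<le> n \<Longrightarrow> a \<in> coord_space I \<Longrightarrow>
      foldr partial L f a = (if length L = n then c (mset L) else 0)"
proof -
  define B where "B = multisets_of_size I n"
  have finB: "finite B" unfolding B_def using fin by blast
  have B: "set_mset \<beta> \<subseteq> I" "size \<beta> = n" if "\<beta> \<in> B" for \<beta>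
    using that by (auto simp: B_def multisets_of_size_def)
  have "\<exists>C. \<forall>t. \<bar>sin_jet m k t\<bar> \<le> C" for m k
    using trig_poly_bounded[OF sin_jet_trig_poly] .
  then obtain C where C: "\<And>m k t. \<bar>sin_jet m k t\<bar> \<le> C m k" by metis
  have C0: "C m k \<ge> 0" for m k using C[of m k 0] by linarith
  \<comment> \<open>The multi-indices whose derivatives have to become small.\<close>
  define A where "A = (\<Union>l<n. multisets_of_size I l)"
  have finA: "finite A" unfolding A_def using fin by blast
  define M where "M = 1 + (\<Sum>\<alpha>\<in>A. \<Sum>\<beta>\<in>B. \<bar>c \<beta>\<bar> * (\<Prod>i\<in>I. C (count \<beta> i) (count \<alpha> i)))"
  have sum0: "0 \<le> (\<Sum>\<beta>\<in>B. \<bar>c \<beta>\<bar> * (\<Prod>i\<in>I. C (count \<beta> i) (count \<alpha> i)))" for \<alpha>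
    by (intro sum_nonneg mult_nonneg_nonneg prod_nonneg) (simp_all add: C0)
  have M: "M > 0" unfolding M_def using sum_nonneg[of A, OF sum0] by (simp add: add_pos_nonneg)
  \<comment> \<open>A derivative of order l below n carries the factor \<epsilon>^(n - l), which is at most \<epsilon> as \<epsilon> is at most 1.\<close>
  define \<epsilon> where "\<epsilon> = min 1 (\<delta> / M)"
  have \<epsilon>: "0 < \<epsilon>" "\<epsilon> \<le> 1" "\<epsilon> * M \<le> \<delta>"
    using M \<delta> by (auto simp: \<epsilon>_def min_def field_simps)
  define \<Phi> where "\<Phi> L v = (\<Sum>\<beta>\<in>B. c \<beta> * (\<epsilon> ^ n * (1 / \<epsilon>) ^ length L *
    (\<Prod>i\<in>I. sin_jet (count \<beta> i) (count (mset L) i) ((v i - a i) / \<epsilon>))))" for L v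
  have cont: "continuous_on (coord_space I) (\<Phi> L)" if "set L \<subseteq> I" for L
    unfolding \<Phi>_def
    by (intro continuous_intros continuous_on_compose2[OF continuous_on_sin_jet[of UNIV]]
        continuous_on_subset[OF continuous_on_product_coordinates]) (use \<epsilon> in auto)
  have der: "((\<lambda>t. \<Phi> L (v(i := t))) has_field_derivative \<Phi> (i # L) v) (at (v i))"
    if "set L \<subseteq> I" and i: "i \<in> I" and "v \<in> coord_space I" for L i v
  proof -
    have eq: "(if j = i then Suc (count (mset L) j) else count (mset L) j) = count (mset (i # L)) j"
      for j by simp
    have "((\<lambda>t. \<Phi> L (v(i := t))) has_field_derivative
      (\<Sum>\<beta>\<in>B. c \<beta> * (\<epsilon> ^ n * (1 / \<epsilon>) ^ length L * ((1 / \<epsilon>) *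
        (\<Prod>j\<in>I. sin_jet (count \<beta> j) (count (mset (i # L)) j) ((v j - a j) / \<epsilon>)))))) (at (v i))"
      unfolding \<Phi>_def eq[symmetric] using \<epsilon>(1)
      by (intro DERIV_sum DERIV_cmult prod_sin_jet_derivative fin i) simp
    moreover have "(\<Sum>\<beta>\<in>B. c \<beta> * (\<epsilon> ^ n * (1 / \<epsilon>) ^ length L * ((1 / \<epsilon>) *
        (\<Prod>j\<in>I. sin_jet (count \<beta> j) (count (mset (i # L)) j) ((v j - a j) / \<epsilon>))))) = \<Phi> (i # L) v"
      unfolding \<Phi>_def by (simp only: list.size power_Suc mult_ac add_0_right add_Suc_right)
    ultimately show ?thesis by simp
  qed
  have fam: "smooth_on I (coord_space I) (\<Phi> L)"
    "v \<in> coord_space I \<Longrightarrow> foldr partial L (\<Phi> []) v = \<Phi> L v" if "set L \<subseteq> I" for L v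
    using derivative_family[OF fin rel_open_whole, of \<Phi>, OF cont der _] that by simp_all
  show ?thesis
  proof
    show "smooth_on I (coord_space I) (\<Phi> [])" by (rule fam(1)) simp
    fix L assume L: "set L \<subseteq> I"
    show "\<bar>foldr partial L (\<Phi> []) v\<bar> \<le> \<delta>" if "length L < n" "v \<in> coord_space I" for v
    proof -
      have "n = length L + Suc (n - length L - 1)" using that by simp
      then have "\<epsilon> ^ n = \<epsilon> ^ length L * \<epsilon> * \<epsilon> ^ (n - length L - 1)"
        by (metis power_add power_Suc mult.assoc)
      then have "\<epsilon> ^ n * (1 / \<epsilon>) ^ length L = \<epsilon> * \<epsilon> ^ (n - length L - 1)"
        using \<epsilon>(1) by (simp add: field_simps)
      also have "\<dots> \<le> \<epsilon> * 1"
        using \<epsilon> by (intro mult_left_mono power_le_one) auto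
      finally have e: "\<epsilon> ^ n * (1 / \<epsilon>) ^ length L \<le> \<epsilon>" by simp
      have "\<bar>\<Phi> L v\<bar> \<le> (\<Sum>\<beta>\<in>B. \<bar>c \<beta> * (\<epsilon> ^ n * (1 / \<epsilon>) ^ length L *
          (\<Prod>i\<in>I. sin_jet (count \<beta> i) (count (mset L) i) ((v i - a i) / \<epsilon>)))\<bar>)"
        unfolding \<Phi>_def by (rule sum_abs)
      also have "\<dots> \<le> (\<Sum>\<beta>\<in>B. \<bar>c \<beta>\<bar> * (\<epsilon> * (\<Prod>i\<in>I. C (count \<beta> i) (count (mset L) i))))"
        unfolding abs_mult abs_prod
        using e \<epsilon>(1) by (intro sum_mono mult_mono prod_mono prod_nonneg mult_nonneg_nonneg)
           (auto simp: C C0 power_abs)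
      also have "\<dots> = \<epsilon> * (\<Sum>\<beta>\<in>B. \<bar>c \<beta>\<bar> * (\<Prod>i\<in>I. C (count \<beta> i) (count (mset L) i)))"
        by (simp add: sum_distrib_left mult_ac)
      also have "\<dots> \<le> \<epsilon> * M"
      proof -
        have "mset L \<in> A" using L that by (auto simp: A_def multisets_of_size_def)
        then have "(\<Sum>\<beta>\<in>B. \<bar>c \<beta>\<bar> * (\<Prod>i\<in>I. C (count \<beta> i) (count (mset L) i))) \<le> M - 1"
          unfolding M_def using member_le_sum[OF _ sum0 finA] by simp
        then show ?thesis using \<epsilon>(1) by (intro mult_left_mono) auto
      qed
      also have "\<dots> \<le> \<delta>" by (rule \<epsilon>(3))
      finally show ?thesis using fam(2)[OF L that(2)] by simp
    qed
    assume len: "length L \<le> n" and a: "a \<in> coord_space I"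
    have p: "(\<Prod>i\<in>I. sin_jet (count \<beta> i) (count (mset L) i) 0) = (if \<beta> = mset L then 1 else 0)"
      if \<beta>: "\<beta> \<in> B" for \<beta>
    proof (cases "\<beta> = mset L")
      case True
      then show ?thesis by (auto simp: sin_jet_0 intro!: prod.neutral)
    next
      case False
      have "\<exists>i\<in>I. count (mset L) i < count \<beta> i"
      proof (rule ccontr)
        assume "\<not> (\<exists>i\<in>I. count (mset L) i < count \<beta> i)"
        then have "count \<beta> i \<le> count (mset L) i" for i
        proof (cases "i \<in> I")
          case False
          then have "i \<notin># \<beta>" using B(1)[OF \<beta>] by blast
          then show ?thesis by (simp add: not_in_iff)
        qed (simp add: not_less)
        then have sub: "\<beta> \<subseteq># mset L" by (rule mset_subset_eqI)
        have "size (mset L - \<beta>) = 0"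
          using size_Diff_submset[OF sub] len B(2)[OF \<beta>] by simp
        then show False
          using False subset_mset.add_diff_inverse[OF sub] by simp
      qed
      then obtain i where "i \<in> I" "count (mset L) i < count \<beta> i" by blast
      then have "\<exists>i\<in>I. sin_jet (count \<beta> i) (count (mset L) i) 0 = 0"
        by (intro bexI[of _ i]) (simp_all add: sin_jet_0)
      then show ?thesis using False fin by (simp add: prod_zero)
    qed
    have "\<Phi> L a = (\<Sum>\<beta>\<in>B. if \<beta> = mset L then c \<beta> * (\<epsilon> ^ n * (1 / \<epsilon>) ^ length L) else 0)"
      unfolding \<Phi>_def using p by (intro sum.cong) auto
    also have "\<dots> = (if mset L \<in> B then c (mset L) * (\<epsilon> ^ n * (1 / \<epsilon>) ^ length L) else 0)"
      using finB by simp
    also have "\<dots> = (if length L = n then c (mset L) else 0)"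
      using \<epsilon>(1) L by (auto simp: B_def multisets_of_size_def field_simps)
    finally show "foldr partial L (\<Phi> []) a = (if length L = n then c (mset L) else 0)"
      using fam(2)[OF L a] by simp
  qed
qed

text \<open>
  Every family of numbers is the family of Taylor coefficients of a smooth function.  The
  function is a series whose n-th summand corrects the derivatives of order n at a, does not change
  the lower ones at a, and contributes at most \<open>2\<^sup>-\<^sup>n\<close> to the lower ones elsewhere, so that all
  derivatives of the series converge uniformly.
\<close>

lemma borel_lemma:
  fixes I :: "'i::linorder set" and c :: "'i multiset \<Rightarrow> real"
  assumes fin: "finite I" and a: "a \<in> coord_space I"
  obtains f where "smooth_on I (coord_space I) f"
    "\<And>\<alpha>. set_mset \<alpha> \<subseteq> I \<Longrightarrow> multi_partial \<alpha> f a = c \<alpha>"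
proof -
  let ?S = "coord_space I"
  \<comment> \<open>F is the sum of the first n summands; f is the next summand.\<close>
  define P where "P n F \<longleftrightarrow> smooth_on I ?S F \<and>
    (\<forall>L. set L \<subseteq> I \<and> length L < n \<longrightarrow> foldr partial L F a = c (mset L))" for n F
  define D where "D n f \<longleftrightarrow> smooth_on I ?S f \<and>
    (\<forall>L v. set L \<subseteq> I \<and> length L < n \<and> v \<in> ?S \<longrightarrow> \<bar>foldr partial L f v\<bar> \<le> (1 / 2) ^ n)" for n f
  have "\<exists>F. \<forall>n. P n (F n) \<and> (\<exists>f. F (Suc n) = (\<lambda>v. F n v + f v) \<and> D n f)"
  proof (rule dependent_nat_choice)
    show "\<exists>F. P 0 F"
      using smooth_on_const[OF fin rel_open_whole] by (auto simp: P_def)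
    fix F n assume F: "P n F"
    obtain f where f: "smooth_on I ?S f"
      "\<And>L v. set L \<subseteq> I \<Longrightarrow> length L < n \<Longrightarrow> v \<in> ?S \<Longrightarrow> \<bar>foldr partial L f v\<bar> \<le> (1 / 2) ^ n"
      "\<And>L. set L \<subseteq> I \<Longrightarrow> length L \<le> n \<Longrightarrow> a \<in> ?S \<Longrightarrow>
        foldr partial L f a = (if length L = n then c (mset L) - multi_partial (mset L) F a else 0)"
      by (rule small_function_with_jet[OF fin, of "(1 / 2) ^ n" n a
            "\<lambda>\<alpha>. c \<alpha> - multi_partial \<alpha> F a"]) auto
    have sF: "smooth_on I ?S F" using F by (simp add: P_def)
    have "foldr partial L (\<lambda>v. F v + f v) a = c (mset L)" if L: "set L \<subseteq> I" "length L < Suc n" for L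
    proof -
      have "foldr partial L (\<lambda>v. F v + f v) a = foldr partial L F a + foldr partial L f a"
        using foldr_partial_add[OF fin rel_open_whole sF f(1)] L a by simp
      also have "\<dots> = c (mset L)"
        using f(3)[OF L(1) _ a] L F foldr_partial_eq_multi_partial[OF fin rel_open_whole sF a L(1)]
        by (cases "length L = n") (auto simp: P_def)
      finally show ?thesis .
    qed
    then have "P (Suc n) (\<lambda>v. F v + f v)"
      using smooth_on_add[OF fin rel_open_whole sF f(1)] by (simp add: P_def)
    moreover have "D n f" using f(1,2) by (simp add: D_def)
    ultimately show "\<exists>F'. P (Suc n) F' \<and> (\<exists>f. F' = (\<lambda>v. F v + f v) \<and> D n f)" by blast
  qed
  then obtain F f where F: "\<And>n. P n (F n)" and f: "\<And>n. D n (f n)"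
    and step: "\<And>n. F (Suc n) = (\<lambda>v. F n v + f n v)"
    by metis
  have sf: "smooth_on I ?S (f n)" and sF: "smooth_on I ?S (F n)" for n
    using f F by (auto simp: D_def P_def)
  define \<Phi> where "\<Phi> L v = (\<Sum>n. foldr partial L (f n) v)" for L v
  have bound: "\<forall>\<^sub>F n in sequentially. \<forall>v\<in>?S. norm (foldr partial L (f n) v) \<le> (1 / 2) ^ n"
    if "set L \<subseteq> I" for L
    using eventually_gt_at_top[of "length L"]
    by eventually_elim (use f that in \<open>auto simp: D_def\<close>)
  have geo: "summable (\<lambda>n. (1 / 2 :: real) ^ n)" by (simp add: summable_geometric)
  have unif: "uniform_limit ?S (\<lambda>n v. \<Sum>i<n. foldr partial L (f i) v) (\<Phi> L) sequentially"
    if "set L \<subseteq> I" for L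
    unfolding \<Phi>_def by (rule Weierstrass_m_test_ev[OF bound[OF that] geo])
  have summ: "summable (\<lambda>n. foldr partial L (f n) v)" if "set L \<subseteq> I" "v \<in> ?S" for L v
    by (rule summable_comparison_test_ev[OF _ geo])
      (use bound[OF that(1)] that(2) in \<open>auto elim: eventually_mono\<close>)
  have cont: "continuous_on ?S (\<Phi> L)" if "set L \<subseteq> I" for L
    by (rule uniform_limit_theorem[OF _ unif[OF that]])
      (intro always_eventually allI continuous_on_sum smooth_on_continuous[of I]
         smooth_on_foldr_partial sf that trivial_limit_sequentially)+
  have der: "((\<lambda>t. \<Phi> L (v(i := t))) has_field_derivative \<Phi> (i # L) v) (at (v i))"
    if L: "set L \<subseteq> I" and i: "i \<in> I" and v: "v \<in> ?S" for L i v
  proof -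
    have in_S: "v(i := t) \<in> ?S" for t using v i by (rule coord_space_update)
    have "((\<lambda>t. \<Sum>n. foldr partial L (f n) (v(i := t))) has_field_derivative
       (\<Sum>n. foldr partial (i # L) (f n) (v(i := v i)))) (at (v i))"
    proof (rule has_field_derivative_series'(2)[where S = UNIV and ?x0.0 = "v i"])
      show "((\<lambda>t. foldr partial L (f n) (v(i := t))) has_real_derivative
          foldr partial (i # L) (f n) (v(i := t))) (at t within UNIV)" for n t
        using C_diff_on_has_partial[of 0 I ?S "foldr partial L (f n)" v i t] in_S i
          smooth_onD[OF smooth_on_foldr_partial[OF sf L]] by simp
      show "uniformly_convergent_on UNIV (\<lambda>n t. \<Sum>k<n. foldr partial (i # L) (f k) (v(i := t)))"
        by (rule Weierstrass_m_test'_ev[OF _ geo])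
          (use bound[of "i # L"] L i in_S in \<open>auto elim!: eventually_mono\<close>)
      show "summable (\<lambda>n. foldr partial L (f n) (v(i := v i)))"
        using summ[OF L v] by simp
    qed auto
    then show ?thesis by (simp add: \<Phi>_def)
  qed
  have fam: "smooth_on I (coord_space I) (\<Phi> L)"
    "v \<in> coord_space I \<Longrightarrow> foldr partial L (\<Phi> []) v = \<Phi> L v" if "set L \<subseteq> I" for L v
    using derivative_family[OF fin rel_open_whole, of \<Phi>, OF cont der _] that by simp_all
  have sums: "(\<Sum>k<n. foldr partial L (f k) a) = foldr partial L (F n) a - foldr partial L (F 0) a"
    if "set L \<subseteq> I" for L n
    by (induction n) (use foldr_partial_add[OF fin rel_open_whole sF sf that a] step in auto)
  show ?thesis
  proof (rule that)
    show "smooth_on I ?S (\<lambda>v. F 0 v + \<Phi> [] v)"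
      using sF fam(1)[of "[]"] by (intro smooth_on_add[OF fin rel_open_whole]) simp_all
    fix \<alpha> assume \<alpha>: "set_mset \<alpha> \<subseteq> I"
    define L where "L = sorted_list_of_multiset \<alpha>"
    have L: "set L \<subseteq> I" "mset L = \<alpha>" using \<alpha> by (auto simp: L_def)
    have "(\<lambda>n. \<Sum>k<n. foldr partial L (f k) a) \<longlonglongrightarrow> \<Phi> L a"
      unfolding \<Phi>_def using summ[OF L(1) a] by (rule summable_LIMSEQ)
    moreover have "\<forall>\<^sub>F n in sequentially. (\<Sum>k<n. foldr partial L (f k) a) = c \<alpha> - foldr partial L (F 0) a"
      using eventually_gt_at_top[of "length L"]
      by eventually_elim (use F L sums in \<open>auto simp: P_def\<close>)
    ultimately have "\<Phi> L a = c \<alpha> - foldr partial L (F 0) a"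
      using LIMSEQ_unique[OF _ tendsto_eventually] by blast
    moreover have "multi_partial \<alpha> (\<lambda>v. F 0 v + \<Phi> [] v) a =
        foldr partial L (F 0) a + foldr partial L (\<Phi> []) a"
      unfolding multi_partial_def L_def[symmetric]
      using foldr_partial_add[OF fin rel_open_whole sF fam(1)[of "[]"] L(1) a] by simp
    ultimately show "multi_partial \<alpha> (\<lambda>v. F 0 v + \<Phi> [] v) a = c \<alpha>"
      using fam(2)[OF L(1) a] by simp
  qed
qed

section \<open>Charts\<close>

text \<open>
  A homeomorphism onto a relatively open set of the coordinate space, without any requirement
  of smoothness.  The jet charts are first shown to have this property.
\<close>

definition top_chart :: "'a topology \<Rightarrow> ('a, 'i) chart \<Rightarrow> bool" where
  "top_chart T c \<longleftrightarrow>
     openin T (chart_dom c) \<and> finite (chart_idx c) \<and> inj_on (chart_map c) (chart_dom c) \<and>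
     (\<forall>S. openin T S \<and> S \<subseteq> chart_dom c \<longrightarrow> rel_open (chart_idx c) (chart_map c ` S)) \<and>
     (\<forall>W. rel_open (chart_idx c) W \<longrightarrow> openin T {p \<in> chart_dom c. chart_map c p \<in> W})"

text \<open>
  Smoothness on S of a real function, read in the chart c.
\<close>

definition smooth_in :: "('a, 'i) chart \<Rightarrow> 'a set \<Rightarrow> ('a \<Rightarrow> real) \<Rightarrow> bool" where
  "smooth_in c S F \<longleftrightarrow> smooth_on (chart_idx c) (chart_map c ` S) (\<lambda>v. F (chart_inv c v))"

definition sub_chart :: "('a, 'i) chart \<Rightarrow> 'a set \<Rightarrow> 'i set \<Rightarrow> ('a, 'i) chart" where
  "sub_chart c S K = \<lparr>chart_dom = chart_dom c \<inter> S, chart_idx = K, chart_map = chart_map c\<rparr>"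

lemma sub_chart_simps [simp]:
  "chart_dom (sub_chart c S K) = chart_dom c \<inter> S"
  "chart_idx (sub_chart c S K) = K"
  "chart_map (sub_chart c S K) = chart_map c"
  by (simp_all add: sub_chart_def)

text \<open>
  Maps between charts are treated one target coordinate at a time.
\<close>

lemma smooth_rep_iff:
  "smooth_rep c d f \<longleftrightarrow>
    (\<forall>j\<in>chart_idx d. smooth_in c {p \<in> chart_dom c. f p \<in> chart_dom d} (\<lambda>p. chart_map d (f p) j))"
  by (simp add: smooth_rep_def smooth_in_def)

lemma top_chartD:
  assumes "top_chart T c"
  shows "openin T (chart_dom c)" "finite (chart_idx c)" "inj_on (chart_map c) (chart_dom c)"
    "\<And>S. openin T S \<Longrightarrow> S \<subseteq> chart_dom c \<Longrightarrow> rel_open (chart_idx c) (chart_map c ` S)"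
    "\<And>W. rel_open (chart_idx c) W \<Longrightarrow> openin T {p \<in> chart_dom c. chart_map c p \<in> W}"
    "\<And>p. p \<in> chart_dom c \<Longrightarrow> chart_map c p \<in> coord_space (chart_idx c)"
    "\<And>p. p \<in> chart_dom c \<Longrightarrow> chart_inv c (chart_map c p) = p"
proof -
  show *: "openin T (chart_dom c)" "finite (chart_idx c)" "inj_on (chart_map c) (chart_dom c)"
    "\<And>S. openin T S \<Longrightarrow> S \<subseteq> chart_dom c \<Longrightarrow> rel_open (chart_idx c) (chart_map c ` S)"
    "\<And>W. rel_open (chart_idx c) W \<Longrightarrow> openin T {p \<in> chart_dom c. chart_map c p \<in> W}"
    using assms by (auto simp: top_chart_def)
  show "\<And>p. p \<in> chart_dom c \<Longrightarrow> chart_map c p \<in> coord_space (chart_idx c)"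
    using rel_open_subset[OF *(4)[OF *(1)]] by blast
  show "\<And>p. p \<in> chart_dom c \<Longrightarrow> chart_inv c (chart_map c p) = p"
    unfolding chart_inv_def using *(3) by (rule inv_into_f_f)
qed

lemma top_chart_iff_homeomorphic:
  "top_chart T c \<longleftrightarrow>
     openin T (chart_dom c) \<and> finite (chart_idx c) \<and>
     rel_open (chart_idx c) (chart_map c ` chart_dom c) \<and>
     homeomorphic_map (subtopology T (chart_dom c))
       (top_of_set (chart_map c ` chart_dom c)) (chart_map c)" (is "?L \<longleftrightarrow> ?R")
proof
  assume L: ?L
  note c = top_chartD[OF L]
  have ts: "topspace (subtopology T (chart_dom c)) = chart_dom c"
    using openin_subset[OF c(1)] by auto
  have "homeomorphic_map (subtopology T (chart_dom c))
       (top_of_set (chart_map c ` chart_dom c)) (chart_map c)"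
  proof (rule bijective_open_imp_homeomorphic_map)
    show "continuous_map (subtopology T (chart_dom c)) (top_of_set (chart_map c ` chart_dom c)) (chart_map c)"
      unfolding continuous_map_def ts
    proof safe
      fix U assume "openin (top_of_set (chart_map c ` chart_dom c)) U"
      then have "rel_open (chart_idx c) U"
        using openin_trans c(4)[OF c(1) order_refl] by blast
      then show "openin (subtopology T (chart_dom c)) {p \<in> chart_dom c. chart_map c p \<in> U}"
        using c(5)[of U] by (auto simp: openin_open_subtopology[OF c(1)])
    qed simp
    show "open_map (subtopology T (chart_dom c)) (top_of_set (chart_map c ` chart_dom c)) (chart_map c)"
      unfolding open_map_def
    proof safe
      fix U assume "openin (subtopology T (chart_dom c)) U"
      then have U: "openin T U" "U \<subseteq> chart_dom c"
        using openin_open_subtopology[OF c(1)] by auto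
      then show "openin (top_of_set (chart_map c ` chart_dom c)) (chart_map c ` U)"
        by (intro openin_subset_trans[OF c(4)[OF U]] image_mono) (use c(6) in auto)
    qed
  qed (simp_all only: ts topspace_euclidean_subtopology c(3))
  then show ?R using c(1,2) c(4)[OF c(1)] by blast
next
  assume R: ?R
  then have op: "openin T (chart_dom c)" and im: "rel_open (chart_idx c) (chart_map c ` chart_dom c)"
    and h: "homeomorphic_map (subtopology T (chart_dom c))
       (top_of_set (chart_map c ` chart_dom c)) (chart_map c)" by auto
  have ts: "topspace (subtopology T (chart_dom c)) = chart_dom c"
    using openin_subset[OF op] by auto
  have "inj_on (chart_map c) (chart_dom c)"
    using homeomorphic_imp_injective_map[OF h] unfolding ts .
  moreover have "rel_open (chart_idx c) (chart_map c ` S)" if "openin T S" "S \<subseteq> chart_dom c" for S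
  proof -
    have "openin (subtopology T (chart_dom c)) S"
      using that openin_open_subtopology[OF op] by auto
    then have "openin (top_of_set (chart_map c ` chart_dom c)) (chart_map c ` S)"
      using homeomorphic_imp_open_map[OF h] by (auto simp: open_map_def)
    then show ?thesis using openin_trans im by blast
  qed
  moreover have "openin T {p \<in> chart_dom c. chart_map c p \<in> W}" if W: "rel_open (chart_idx c) W" for W
  proof -
    have "openin (top_of_set (chart_map c ` chart_dom c)) (chart_map c ` chart_dom c \<inter> W)"
      using W im by (meson inf_le1 openin_Int openin_imp_subset openin_subset_trans)
    then have "openin (subtopology T (chart_dom c))
        {p \<in> chart_dom c. chart_map c p \<in> chart_map c ` chart_dom c \<inter> W}"
      using homeomorphic_imp_continuous_map[OF h] unfolding continuous_map_def ts by blast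
    moreover have "{p \<in> chart_dom c. chart_map c p \<in> chart_map c ` chart_dom c \<inter> W} =
        {p \<in> chart_dom c. chart_map c p \<in> W}" by blast
    ultimately show ?thesis using openin_open_subtopology[OF op] by auto
  qed
  ultimately show ?L using R by (auto simp: top_chart_def)
qed

lemma chart_of_iff:
  "chart_of M c \<longleftrightarrow> top_chart (mtop M) c \<and>
     (\<forall>d\<in>atlas M. smooth_rep c d (\<lambda>p. p) \<and> smooth_rep d c (\<lambda>p. p))"
  by (auto simp: chart_of_def top_chart_iff_homeomorphic)

lemma smooth_in_mono: "smooth_in c S F \<Longrightarrow> S' \<subseteq> S \<Longrightarrow> smooth_in c S' F"
  unfolding smooth_in_def by (rule smooth_on_mono) auto

lemma smooth_in_cong:
  assumes c: "top_chart T c" and S: "openin T S" "S \<subseteq> chart_dom c"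
    and eq: "\<And>p. p \<in> S \<Longrightarrow> F p = G p" and "smooth_in c S F"
  shows "smooth_in c S G"
  unfolding smooth_in_def
proof (rule smooth_on_cong[OF top_chartD(2)[OF c] top_chartD(4)[OF c S]])
  show "smooth_on (chart_idx c) (chart_map c ` S) (\<lambda>v. F (chart_inv c v))"
    using assms(5) by (simp add: smooth_in_def)
  show "F (chart_inv c v) = G (chart_inv c v)" if "v \<in> chart_map c ` S" for v
    using that eq top_chartD(7)[OF c] S(2) by auto
qed

lemma smooth_in_local:
  assumes c: "top_chart T c" and S: "S \<subseteq> chart_dom c"
    and loc: "\<And>p. p \<in> S \<Longrightarrow> \<exists>S'. openin T S' \<and> p \<in> S' \<and> S' \<subseteq> S \<and> smooth_in c S' F"
  shows "smooth_in c S F"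
  unfolding smooth_in_def
proof (rule smooth_on_local)
  fix v assume "v \<in> chart_map c ` S"
  then obtain p where p: "p \<in> S" "v = chart_map c p" by blast
  then obtain S' where S': "openin T S'" "p \<in> S'" "S' \<subseteq> S" "smooth_in c S' F" using loc by blast
  have "openin (top_of_set (chart_map c ` S)) (chart_map c ` S')"
  proof (rule openin_subset_trans)
    show "rel_open (chart_idx c) (chart_map c ` S')"
      using S' S by (intro top_chartD(4)[OF c]) auto
    show "chart_map c ` S \<subseteq> coord_space (chart_idx c)" using top_chartD(6)[OF c] S by auto
  qed (use S' in auto)
  then show "\<exists>V. openin (top_of_set (chart_map c ` S)) V \<and> v \<in> V \<and>
      smooth_on (chart_idx c) V (\<lambda>v. F (chart_inv c v))"
    using S'(2,4) p(2) by (auto simp: smooth_in_def)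
qed

lemma smooth_in_compose:
  fixes c :: "('a, 'i) chart" and e :: "('b, 'j) chart"
  assumes c: "top_chart T c" and S: "openin T S" "S \<subseteq> chart_dom c"
    and e: "top_chart T' e" and S': "openin T' S'" "S' \<subseteq> chart_dom e"
    and f: "\<And>p. p \<in> S \<Longrightarrow> f p \<in> S'"
    and smooth: "\<And>j. j \<in> chart_idx e \<Longrightarrow> smooth_in c S (\<lambda>p. chart_map e (f p) j)" "smooth_in e S' G"
  shows "smooth_in c S (\<lambda>p. G (f p))"
    and "p \<in> S \<Longrightarrow> i \<in> chart_idx c \<Longrightarrow> partial i (\<lambda>v. G (f (chart_inv c v))) (chart_map c p) =
      (\<Sum>j\<in>chart_idx e. partial j (\<lambda>u. G (chart_inv e u)) (chart_map e (f p)) *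
        partial i (\<lambda>v. chart_map e (f (chart_inv c v)) j) (chart_map c p))"
proof -
  note oc = top_chartD(2)[OF c] top_chartD(4)[OF c S]
  note oe = top_chartD(2)[OF e] top_chartD(4)[OF e S']
  have inv: "chart_inv c v \<in> S" if "v \<in> chart_map c ` S" for v
    using that top_chartD(7)[OF c] S(2) by auto
  have F: "chart_map e (f (chart_inv c v)) \<in> chart_map e ` S'" if "v \<in> chart_map c ` S" for v
    using f[OF inv[OF that]] by blast
  have eq: "G (chart_inv e (chart_map e (f (chart_inv c v)))) = G (f (chart_inv c v))"
    if "v \<in> chart_map c ` S" for v
    using top_chartD(7)[OF e subsetD[OF S'(2) f[OF inv[OF that]]]] by simp
  have sm: "\<And>j. j \<in> chart_idx e \<Longrightarrow>
      smooth_on (chart_idx c) (chart_map c ` S) (\<lambda>v. chart_map e (f (chart_inv c v)) j)"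
    "smooth_on (chart_idx e) (chart_map e ` S') (\<lambda>u. G (chart_inv e u))"
    using smooth by (simp_all add: smooth_in_def)
  have "smooth_on (chart_idx c) (chart_map c ` S)
      (\<lambda>v. G (chart_inv e (chart_map e (f (chart_inv c v)))))"
    by (rule smooth_on_compose[OF oc oe, of "\<lambda>v. chart_map e (f (chart_inv c v))"
          "\<lambda>u. G (chart_inv e u)"]) (simp_all add: F sm)
  with eq show "smooth_in c S (\<lambda>p. G (f p))"
    unfolding smooth_in_def by (rule smooth_on_cong[OF oc])
  assume p: "p \<in> S" and i: "i \<in> chart_idx c"
  have "partial i (\<lambda>v. G (f (chart_inv c v))) (chart_map c p) =
    partial i (\<lambda>v. G (chart_inv e (chart_map e (f (chart_inv c v))))) (chart_map c p)"
    by (rule partial_cong[OF oc eq[symmetric] _ i]) (use p in auto)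
  also have "\<dots> = (\<Sum>j\<in>chart_idx e. partial j (\<lambda>u. G (chart_inv e u))
      (chart_map e (f (chart_inv c (chart_map c p)))) *
        partial i (\<lambda>v. chart_map e (f (chart_inv c v)) j) (chart_map c p))"
    by (rule partial_compose[OF oc oe, of "\<lambda>v. chart_map e (f (chart_inv c v))"
          "\<lambda>u. G (chart_inv e u)"]) (use F sm p i in auto)
  finally show "partial i (\<lambda>v. G (f (chart_inv c v))) (chart_map c p) =
      (\<Sum>j\<in>chart_idx e. partial j (\<lambda>u. G (chart_inv e u)) (chart_map e (f p)) *
        partial i (\<lambda>v. chart_map e (f (chart_inv c v)) j) (chart_map c p))"
    using top_chartD(7)[OF c subsetD[OF S(2) p]] by simp
qed

text \<open>
  Two charts are by definition only compatible with the charts of the atlas.  Near each point the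
  change between them factors through an atlas chart, for which homeomorphy onto an open set is enough.
\<close>

lemma chart_change_smooth:
  assumes c: "chart_of M c" and d: "chart_of M d"
    and cover: "\<And>p. p \<in> points M \<Longrightarrow> \<exists>e\<in>atlas M. p \<in> chart_dom e \<and> top_chart (mtop M) e"
  shows "smooth_rep c d (\<lambda>p. p)"
  unfolding smooth_rep_iff
proof
  fix j assume j: "j \<in> chart_idx d"
  have tc: "top_chart (mtop M) c" and td: "top_chart (mtop M) d"
    using c d by (auto simp: chart_of_iff)
  show "smooth_in c {p \<in> chart_dom c. p \<in> chart_dom d} (\<lambda>p. chart_map d p j)"
  proof (rule smooth_in_local[OF tc])
    fix p assume p: "p \<in> {p \<in> chart_dom c. p \<in> chart_dom d}"
    then have "p \<in> points M" using openin_subset[OF top_chartD(1)[OF tc]] by auto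
    then obtain e where e: "e \<in> atlas M" "p \<in> chart_dom e" "top_chart (mtop M) e"
      using cover by blast
    \<comment> \<open>e is the atlas chart through which the change of charts factors near p.\<close>
    let ?S = "chart_dom c \<inter> chart_dom e \<inter> chart_dom d"
    let ?S' = "chart_dom e \<inter> chart_dom d"
    have op: "openin (mtop M) ?S" "openin (mtop M) ?S'"
      using tc td e(3) by (auto intro!: openin_Int dest: top_chartD(1))
    have "smooth_in c ?S (\<lambda>p. chart_map d p j)"
    proof (rule smooth_in_compose(1)[OF tc op(1) _ e(3) op(2), of "\<lambda>p. p"])
      show "smooth_in e ?S' (\<lambda>p. chart_map d p j)"
        using d e(1) j by (auto simp: chart_of_iff smooth_rep_iff intro: smooth_in_mono)
      show "smooth_in c ?S (\<lambda>p. chart_map e p i)" if "i \<in> chart_idx e" for i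
        using c e(1) that by (auto simp: chart_of_iff smooth_rep_iff intro: smooth_in_mono)
    qed auto
    then show "\<exists>S'. openin (mtop M) S' \<and> p \<in> S' \<and> S' \<subseteq> {p \<in> chart_dom c. p \<in> chart_dom d} \<and>
        smooth_in c S' (\<lambda>p. chart_map d p j)"
      using op(1) p e(2) by (intro exI[of _ ?S]) auto
  qed auto
qed

lemma manifold_chart_change_smooth:
  assumes "manifold M" "chart_of M c" "chart_of M d"
  shows "smooth_rep c d (\<lambda>p. p)"
proof (rule chart_change_smooth[OF assms(2,3)])
  fix p assume "p \<in> points M"
  then show "\<exists>e\<in>atlas M. p \<in> chart_dom e \<and> top_chart (mtop M) e"
    using assms(1) unfolding manifold_def chart_of_iff by blast
qed

lemma top_chart_restrict_open:
  assumes c: "top_chart T c" and U: "openin T U"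
  shows "top_chart T (sub_chart c U (chart_idx c))"
  unfolding top_chart_def sub_chart_simps
proof (intro conjI allI impI)
  note c' = top_chartD[OF c]
  show "openin T (chart_dom c \<inter> U)" using c'(1) U by blast
  show "finite (chart_idx c)" by (rule c'(2))
  show "inj_on (chart_map c) (chart_dom c \<inter> U)" using c'(3) by (rule inj_on_subset) simp
  show "rel_open (chart_idx c) (chart_map c ` S)" if "openin T S \<and> S \<subseteq> chart_dom c \<inter> U" for S
    using that by (intro c'(4)) auto
  show "openin T {p \<in> chart_dom c \<inter> U. chart_map c p \<in> W}" if "rel_open (chart_idx c) W" for W
  proof -
    have "openin T ({p \<in> chart_dom c. chart_map c p \<in> W} \<inter> U)"
      using c'(5)[OF that] U by blast
    moreover have "{p \<in> chart_dom c. chart_map c p \<in> W} \<inter> U = {p \<in> chart_dom c \<inter> U. chart_map c p \<in> W}"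
      by blast
    ultimately show ?thesis by simp
  qed
qed

lemma smooth_in_sub_chart:
  assumes c: "top_chart T c" and sc: "top_chart T' (sub_chart c N K)" and K: "K \<subseteq> chart_idx c"
    and S': "openin T' S'" "S' \<subseteq> S" "S' \<subseteq> N" and S: "S \<subseteq> chart_dom c" and F: "smooth_in c S F"
  shows "smooth_in (sub_chart c N K) S' F"
  unfolding smooth_in_def
proof (rule smooth_on_cong)
  let ?s = "sub_chart c N K"
  show "finite (chart_idx ?s)" by (rule top_chartD(2)[OF sc])
  show "rel_open (chart_idx ?s) (chart_map ?s ` S')"
    using S' S by (intro top_chartD(4)[OF sc]) auto
  show "F (chart_inv c v) = F (chart_inv ?s v)" if v: "v \<in> chart_map ?s ` S'" for v
  proof -
    obtain p where p: "p \<in> S'" "v = chart_map c p" using v by auto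
    have "chart_inv c (chart_map c p) = p" using p(1) S' S by (intro top_chartD(7)[OF c]) auto
    moreover have "chart_inv ?s (chart_map ?s p) = p"
      using p(1) S' S by (intro top_chartD(7)[OF sc]) auto
    ultimately show ?thesis using p(2) by simp
  qed
  show "smooth_on (chart_idx ?s) (chart_map ?s ` S') (\<lambda>v. F (chart_inv c v))"
    using F K S'(2) unfolding smooth_in_def by (auto intro: smooth_on_mono)
qed

text \<open>
  The slice is the intersection of the image with the smaller coordinate space, and this
  carries open sets to open sets.
\<close>

lemma slice_top_chart:
  assumes "slice_chart M S c K"
  shows "top_chart (subtopology (mtop M) S) (sub_chart c S K)"
  unfolding top_chart_def sub_chart_simps
proof (intro conjI allI impI)
  have c: "chart_of M c" and K: "K \<subseteq> chart_idx c"
    and sl: "\<And>p. p \<in> chart_dom c \<Longrightarrow> p \<in> S \<longleftrightarrow> (\<forall>i\<in>chart_idx c - K. chart_map c p i = 0)"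
    using assms by (auto simp: slice_chart_def)
  have tc: "top_chart (mtop M) c" using c by (simp add: chart_of_iff)
  note c' = top_chartD[OF tc]
  have sub: "coord_space K \<subseteq> coord_space (chart_idx c)" using K by (auto simp: coord_space_def)
  have sl': "p \<in> S \<longleftrightarrow> chart_map c p \<in> coord_space K" if "p \<in> chart_dom c" for p
    using sl[OF that] c'(6)[OF that] by (auto simp: coord_space_def)
  show "openin (subtopology (mtop M) S) (chart_dom c \<inter> S)"
    using c'(1) by (rule openin_subtopology_Int)
  show "finite K" using c'(2) K by (rule rev_finite_subset)
  show "inj_on (chart_map c) (chart_dom c \<inter> S)" using c'(3) by (rule inj_on_subset) simp
  show "rel_open K (chart_map c ` S')"
    if S': "openin (subtopology (mtop M) S) S' \<and> S' \<subseteq> chart_dom c \<inter> S" for S'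
  proof -
    obtain Q where Q: "openin (mtop M) Q" "S' = Q \<inter> S" using S' by (auto simp: openin_subtopology)
    have "rel_open (chart_idx c) (chart_map c ` (Q \<inter> chart_dom c))"
      using Q(1) c'(1) by (intro c'(4)) auto
    then obtain R where R: "open R" "chart_map c ` (Q \<inter> chart_dom c) = coord_space (chart_idx c) \<inter> R"
      by (auto simp: openin_open)
    have "chart_map c ` S' = chart_map c ` (Q \<inter> chart_dom c) \<inter> coord_space K"
      using S' Q(2) sl' by auto
    also have "\<dots> = coord_space K \<inter> R" using R(2) sub by blast
    finally show ?thesis using R(1) by (auto simp: openin_open)
  qed
  show "openin (subtopology (mtop M) S) {p \<in> chart_dom c \<inter> S. chart_map c p \<in> W}"
    if W: "rel_open K W" for W
  proof -
    obtain R where R: "open R" "W = coord_space K \<inter> R" using W by (auto simp: openin_open)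
    have "rel_open (chart_idx c) (coord_space (chart_idx c) \<inter> R)"
      using R(1) by (auto simp: openin_open)
    then have "openin (mtop M) {p \<in> chart_dom c. chart_map c p \<in> coord_space (chart_idx c) \<inter> R}"
      by (rule c'(5))
    moreover have "{p \<in> chart_dom c \<inter> S. chart_map c p \<in> W} =
        {p \<in> chart_dom c. chart_map c p \<in> coord_space (chart_idx c) \<inter> R} \<inter> S"
      using sl' sub R(2) by auto
    ultimately show ?thesis by (simp add: openin_subtopology_Int)
  qed
qed

lemma smooth_rep_restrict_open:
  assumes c: "top_chart T c" and d: "top_chart T' d" and f: "smooth_rep c d f"
    and U: "openin T U" and op: "openin T {p \<in> chart_dom c. f p \<in> chart_dom d}"
  shows "smooth_rep (sub_chart c U (chart_idx c)) d f"
  unfolding smooth_rep_iff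
proof
  fix j assume j: "j \<in> chart_idx d"
  have eq: "{p \<in> chart_dom (sub_chart c U (chart_idx c)). f p \<in> chart_dom d} =
    {p \<in> chart_dom c. f p \<in> chart_dom d} \<inter> U" by auto
  show "smooth_in (sub_chart c U (chart_idx c))
      {p \<in> chart_dom (sub_chart c U (chart_idx c)). f p \<in> chart_dom d} (\<lambda>p. chart_map d (f p) j)"
    unfolding eq
    by (rule smooth_in_sub_chart[OF c top_chart_restrict_open[OF c U] order_refl, where
          S = "{p \<in> chart_dom c. f p \<in> chart_dom d}"])
      (use f j op U in \<open>auto simp: smooth_rep_iff\<close>)
qed

lemma chart_of_restrict_open:
  assumes c: "chart_of M c" and U: "openin (mtop M) U" and atlas: "\<And>d. d \<in> atlas M \<Longrightarrow> top_chart (mtop M) d"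
  shows "chart_of M (sub_chart c U (chart_idx c))"
proof -
  have tc: "top_chart (mtop M) c" using c by (simp add: chart_of_iff)
  let ?s = "sub_chart c U (chart_idx c)"
  have "smooth_rep ?s d (\<lambda>p. p) \<and> smooth_rep d ?s (\<lambda>p. p)" if d: "d \<in> atlas M" for d
  proof
    note td = atlas[OF d]
    have eq: "{p \<in> chart_dom c. p \<in> chart_dom d} = chart_dom c \<inter> chart_dom d" by auto
    show "smooth_rep ?s d (\<lambda>p. p)"
    proof (rule smooth_rep_restrict_open[OF tc td _ U])
      show "smooth_rep c d (\<lambda>p. p)" using c d by (simp add: chart_of_iff)
      show "openin (mtop M) {p \<in> chart_dom c. p \<in> chart_dom d}"
        unfolding eq using top_chartD(1)[OF tc] top_chartD(1)[OF td] by blast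
    qed
    show "smooth_rep d ?s (\<lambda>p. p)"
      unfolding smooth_rep_iff
    proof
      fix j assume "j \<in> chart_idx ?s"
      then have "smooth_in d {p \<in> chart_dom d. p \<in> chart_dom c} (\<lambda>p. chart_map c p j)"
        using c d by (simp add: chart_of_iff smooth_rep_iff)
      then show "smooth_in d {p \<in> chart_dom d. p \<in> chart_dom ?s} (\<lambda>p. chart_map ?s p j)"
        by (simp, elim smooth_in_mono) auto
    qed
  qed
  then show ?thesis
    unfolding chart_of_iff using top_chart_restrict_open[OF tc U] by blast
qed

section \<open>Sections in fibered charts\<close>

lemma smooth_in_unrestrict:
  assumes c: "top_chart T c" and U: "openin T U" and S: "openin T S" "S \<subseteq> chart_dom c \<inter> U"
    and F: "smooth_in (sub_chart c U (chart_idx c)) S F"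
  shows "smooth_in c S F"
  unfolding smooth_in_def
proof (rule smooth_on_cong)
  let ?s = "sub_chart c U (chart_idx c)"
  note sc = top_chart_restrict_open[OF c U]
  show "finite (chart_idx c)" by (rule top_chartD(2)[OF c])
  show "rel_open (chart_idx c) (chart_map c ` S)" using S by (intro top_chartD(4)[OF c]) auto
  show "smooth_on (chart_idx c) (chart_map c ` S) (\<lambda>v. F (chart_inv ?s v))"
    using F by (simp add: smooth_in_def)
  show "F (chart_inv ?s v) = F (chart_inv c v)" if v: "v \<in> chart_map c ` S" for v
  proof -
    obtain p where p: "p \<in> S" "v = chart_map c p" using v by auto
    have "chart_inv c (chart_map c p) = p" using p(1) S by (intro top_chartD(7)[OF c]) auto
    moreover have "chart_inv ?s (chart_map ?s p) = p"
      using p(1) S by (intro top_chartD(7)[OF sc]) auto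
    ultimately show ?thesis using p(2) by simp
  qed
qed

lemma manifold_top_chart: "manifold M \<Longrightarrow> d \<in> atlas M \<Longrightarrow> top_chart (mtop M) d"
  by (auto simp: manifold_def chart_of_iff)

lemma fibered_chartD:
  assumes "fibered_chart X E \<pi> x c"
  shows "chart_of X x" "chart_of E c" "top_chart (mtop X) x" "top_chart (mtop E) c"
    "\<And>e. e \<in> chart_dom c \<Longrightarrow> \<pi> e \<in> chart_dom x"
    "\<And>i. Inl i \<in> chart_idx c \<longleftrightarrow> i \<in> chart_idx x"
    "\<And>e i. e \<in> chart_dom c \<Longrightarrow> chart_map c e (Inl i) = chart_map x (\<pi> e) i"
proof -
  show 1: "chart_of X x" "chart_of E c" "top_chart (mtop X) x" "top_chart (mtop E) c"
    "\<And>e. e \<in> chart_dom c \<Longrightarrow> \<pi> e \<in> chart_dom x"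
    "\<And>i. Inl i \<in> chart_idx c \<longleftrightarrow> i \<in> chart_idx x"
    using assms by (auto simp: fibered_chart_def chart_of_iff)
  show "chart_map c e (Inl i) = chart_map x (\<pi> e) i" if "e \<in> chart_dom c" for e i
  proof (cases "i \<in> chart_idx x")
    case True
    then show ?thesis using assms that by (auto simp: fibered_chart_def)
  next
    case False
    then show ?thesis
      using top_chartD(6)[OF 1(3) 1(5)[OF that]] top_chartD(6)[OF 1(4) that] 1(6)[of i]
      by (auto simp: coord_space_def)
  qed
qed

lemma section_onD:
  assumes "section_on X E \<pi> U \<phi>"
  shows "openin (mtop X) U" "\<And>q. q \<in> U \<Longrightarrow> \<pi> (\<phi> q) = q" "\<And>q. q \<in> U \<Longrightarrow> \<phi> q \<in> points E"
    "\<And>Q. openin (mtop E) Q \<Longrightarrow> openin (mtop X) {q \<in> U. \<phi> q \<in> Q}"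
proof -
  show U: "openin (mtop X) U" "\<And>q. q \<in> U \<Longrightarrow> \<pi> (\<phi> q) = q"
    using assms by (auto simp: section_on_def)
  have cont: "continuous_map (subtopology (mtop X) U) (mtop E) \<phi>"
    using assms by (simp add: section_on_def smooth_map_def submanifold_def)
  have ts: "topspace (subtopology (mtop X) U) = U" using openin_subset[OF U(1)] by auto
  show "\<And>q. q \<in> U \<Longrightarrow> \<phi> q \<in> points E"
    using cont unfolding continuous_map_def ts by blast
  show "openin (mtop X) {q \<in> U. \<phi> q \<in> Q}" if "openin (mtop E) Q" for Q
    using cont that unfolding continuous_map_def ts openin_open_subtopology[OF U(1)] by blast
qed

text \<open>
  Smoothness of a section over U refers to the slice charts of U and to the atlas of E.  The chart
  x restricted to U is such a slice chart, and charts of the atlas of E are changed to c.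
\<close>

lemma section_smooth_in_fibered_chart:
  assumes X: "manifold X" and E: "manifold E" and sec: "section_on X E \<pi> U \<phi>"
    and fib: "fibered_chart X E \<pi> x c" and j: "j \<in> chart_idx c"
  shows "smooth_in x {q \<in> chart_dom x \<inter> U. \<phi> q \<in> chart_dom c} (\<lambda>q. chart_map c (\<phi> q) j)"
proof -
  note fc = fibered_chartD[OF fib] and s = section_onD[OF sec]
  define x' where "x' = sub_chart x U (chart_idx x)"
  have tx': "top_chart (mtop X) x'"
    unfolding x'_def by (rule top_chart_restrict_open[OF fc(3) s(1)])
  have "chart_of X x'"
    unfolding x'_def by (rule chart_of_restrict_open[OF fc(1) s(1) manifold_top_chart[OF X]])
  then have "slice_chart X U x' (chart_idx x)"
    by (auto simp: slice_chart_def x'_def)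
  moreover have "x' = \<lparr>chart_dom = chart_dom x' \<inter> U, chart_idx = chart_idx x, chart_map = chart_map x'\<rparr>"
    by (auto simp: x'_def sub_chart_def)
  ultimately have "x' \<in> atlas (submanifold X U)"
    unfolding submanifold_def by auto
  then have rep: "smooth_rep x' d \<phi>" if "d \<in> atlas E" for d
    using sec that by (auto simp: section_on_def smooth_map_def)
  show ?thesis
  proof (rule smooth_in_local[OF fc(3)])
    fix p assume p: "p \<in> {q \<in> chart_dom x \<inter> U. \<phi> q \<in> chart_dom c}"
    then obtain d where d: "d \<in> atlas E" "\<phi> p \<in> chart_dom d"
      using E s(3)[of p] unfolding manifold_def by blast
    have td: "top_chart (mtop E) d" using E d(1) by (rule manifold_top_chart)
    let ?S' = "chart_dom d \<inter> chart_dom c"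
    let ?S = "chart_dom x \<inter> {q \<in> U. \<phi> q \<in> ?S'}"
    have op': "openin (mtop E) ?S'" using top_chartD(1)[OF td] top_chartD(1)[OF fc(4)] by blast
    have op: "openin (mtop X) ?S" using s(4)[OF op'] top_chartD(1)[OF fc(3)] by blast
    have "smooth_in x' ?S (\<lambda>q. chart_map c (\<phi> q) j)"
    proof (rule smooth_in_compose(1)[OF tx' op _ td op', of \<phi>])
      show "smooth_in d ?S' (\<lambda>e. chart_map c e j)"
        using fc(2) d(1) j by (auto simp: chart_of_iff smooth_rep_iff intro: smooth_in_mono)
      show "smooth_in x' ?S (\<lambda>q. chart_map d (\<phi> q) i)" if "i \<in> chart_idx d" for i
      proof (rule smooth_in_mono)
        show "smooth_in x' {q \<in> chart_dom x'. \<phi> q \<in> chart_dom d} (\<lambda>q. chart_map d (\<phi> q) i)"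
          using rep[OF d(1)] that by (simp add: smooth_rep_iff)
      qed (auto simp: x'_def)
    qed (auto simp: x'_def)
    then have "smooth_in x ?S (\<lambda>q. chart_map c (\<phi> q) j)"
      unfolding x'_def by (intro smooth_in_unrestrict[OF fc(3) s(1) op]) auto
    then show "\<exists>S'. openin (mtop X) S' \<and> p \<in> S' \<and> S' \<subseteq> {q \<in> chart_dom x \<inter> U. \<phi> q \<in> chart_dom c} \<and>
        smooth_in x S' (\<lambda>q. chart_map c (\<phi> q) j)"
      using op p d(2) by (intro exI[of _ ?S]) auto
  qed auto
qed

text \<open>
  The section is the inverse of the fibered chart applied to the graph of h.  It projects to the base
  point because the base coordinates of c are those of x.
\<close>

lemma section_with_coordinates:
  assumes X: "manifold X" and E: "manifold E" and fib: "fibered_chart X E \<pi> x c"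
    and h: "\<And>a. Inr a \<in> chart_idx c \<Longrightarrow> smooth_on (chart_idx x) (coord_space (chart_idx x)) (h a)"
    and e0: "e0 \<in> chart_dom c"
    and h0: "\<And>a. Inr a \<in> chart_idx c \<Longrightarrow> h a (chart_map x (\<pi> e0)) = chart_map c e0 (Inr a)"
  obtains \<psi> where "section_at X E \<pi> (\<pi> e0) \<psi>" "\<psi> (\<pi> e0) = e0"
    "\<And>\<alpha> a. set_mset \<alpha> \<subseteq> chart_idx x \<Longrightarrow> Inr a \<in> chart_idx c \<Longrightarrow>
      section_partial x c \<alpha> a \<psi> (\<pi> e0) = multi_partial \<alpha> (h a) (chart_map x (\<pi> e0))"
proof -
  note fc = fibered_chartD[OF fib]
  note tx = top_chartD[OF fc(3)] and tc = top_chartD[OF fc(4)]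
  let ?I = "chart_idx x" and ?C = "chart_idx c"
  define Q where "Q v s = (case s of Inl i \<Rightarrow> v i | Inr a \<Rightarrow> if Inr a \<in> ?C then h a v else 0)" for v s
  have QC: "Q v \<in> coord_space ?C" if "v \<in> coord_space ?I" for v
    using that fc(6) by (auto simp: Q_def coord_space_def split: sum.splits)
  have Qsm: "smooth_on ?I (coord_space ?I) (\<lambda>v. Q v s)" for s
  proof (cases s)
    case (Inl i)
    then show ?thesis unfolding Q_def by (simp add: smooth_on_coord[OF tx(2) rel_open_whole])
  next
    case (Inr a)
    then show ?thesis unfolding Q_def
      by (cases "Inr a \<in> ?C") (simp_all add: smooth_on_const[OF tx(2) rel_open_whole] h)
  qed
  have contQ: "continuous_on (coord_space ?I) Q"
    by (rule continuous_on_coordinatewise_then_product) (rule smooth_on_continuous[OF Qsm])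
  have openQ: "rel_open ?I {v \<in> coord_space ?I. Q v \<in> W}" if "rel_open ?C W" for W
  proof -
    have "rel_open ?I (coord_space ?I \<inter> Q -` W)"
      using contQ _ that by (rule continuous_openin_preimage) (use QC in auto)
    then show ?thesis by (simp add: vimage_def Collect_conj_eq)
  qed
  define \<psi> where "\<psi> q = chart_inv c (Q (chart_map x q))" for q
  define U where "U = {q \<in> chart_dom x. Q (chart_map x q) \<in> chart_map c ` chart_dom c}"
  have cinv: "chart_inv c v \<in> chart_dom c \<and> chart_map c (chart_inv c v) = v"
    if "v \<in> chart_map c ` chart_dom c" for v
    using that tc(7) by auto
  have \<psi>: "\<psi> q \<in> chart_dom c" "chart_map c (\<psi> q) = Q (chart_map x q)" "q \<in> chart_dom x"
    if "q \<in> U" for q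
    using that cinv unfolding U_def \<psi>_def by auto
  have openU: "openin (mtop X) {q \<in> U. \<psi> q \<in> S}" if S: "openin (mtop E) S" for S
  proof -
    let ?W = "chart_map c ` (chart_dom c \<inter> S)"
    have "rel_open ?C ?W" using S tc(1) by (intro tc(4)) auto
    then have "openin (mtop X) {q \<in> chart_dom x. chart_map x q \<in> {v \<in> coord_space ?I. Q v \<in> ?W}}"
      by (intro tx(5) openQ)
    moreover have "{q \<in> chart_dom x. chart_map x q \<in> {v \<in> coord_space ?I. Q v \<in> ?W}} = {q \<in> U. \<psi> q \<in> S}"
      using tx(6) tc(7) unfolding U_def \<psi>_def by force
    ultimately show ?thesis by simp
  qed
  have opU: "openin (mtop X) U"
    using openU[OF tc(1)] \<psi>(1) by (simp add: Collect_conj_eq Int_absorb2 subset_iff)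
  have Uts: "topspace (subtopology (mtop X) U) = U" using openin_subset[OF opU] by auto
  have proj: "\<pi> (\<psi> q) = q" if q: "q \<in> U" for q
  proof -
    have "chart_map x (\<pi> (\<psi> q)) i = chart_map x q i" for i
      using fc(7)[OF \<psi>(1)[OF q], of i] \<psi>(2)[OF q] by (simp add: Q_def)
    then have "chart_map x (\<pi> (\<psi> q)) = chart_map x q" by blast
    then show ?thesis
      using tx(3) fc(5)[OF \<psi>(1)[OF q]] \<psi>(3)[OF q] by (auto dest: inj_onD)
  qed
  have sm: "smooth_in x {q \<in> U. \<psi> q \<in> chart_dom d} (\<lambda>q. chart_map d (\<psi> q) j)"
    if d: "d \<in> atlas E" and j: "j \<in> chart_idx d" for d j
  proof -
    note td = top_chartD[OF manifold_top_chart[OF E d]]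
    let ?S = "{q \<in> U. \<psi> q \<in> chart_dom d}"
    have opS: "openin (mtop X) ?S" using td(1) by (rule openU)
    show ?thesis
    proof (rule smooth_in_compose(1)[OF fc(3) opS _ fc(4), of "chart_dom c \<inter> chart_dom d" \<psi>])
      show "openin (mtop E) (chart_dom c \<inter> chart_dom d)" using td(1) tc(1) by blast
      have "smooth_rep c d (\<lambda>e. e)" using fc(2) d by (simp add: chart_of_iff)
      then show "smooth_in c (chart_dom c \<inter> chart_dom d) (\<lambda>e. chart_map d e j)"
        using j by (auto simp: smooth_rep_iff intro: smooth_in_mono)
      show "smooth_in x ?S (\<lambda>q. chart_map c (\<psi> q) s)" if "s \<in> ?C" for s
        unfolding smooth_in_def
      proof (rule smooth_on_cong[OF tx(2) tx(4)[OF opS]])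
        show "?S \<subseteq> chart_dom x" using \<psi>(3) by auto
        show "smooth_on ?I (chart_map x ` ?S) (\<lambda>v. Q v s)"
          using Qsm by (rule smooth_on_mono) (use \<psi>(3) tx(6) in auto)
        show "Q v s = chart_map c (\<psi> (chart_inv x v)) s" if "v \<in> chart_map x ` ?S" for v
          using that \<psi>(2,3) tx(7) by auto
      qed
    qed (use \<psi> in auto)
  qed
  have sec: "section_on X E \<pi> U \<psi>"
    unfolding section_on_def smooth_map_def
  proof (intro conjI ballI opU proj)
    show "continuous_map (mtop (submanifold X U)) (mtop E) \<psi>"
      unfolding submanifold_def manifold.simps continuous_map_def Uts
    proof (intro conjI allI impI)
      show "\<psi> \<in> U \<rightarrow> points E" using \<psi>(1) openin_subset[OF tc(1)] by blast
      show "openin (subtopology (mtop X) U) {q \<in> U. \<psi> q \<in> S}" if "openin (mtop E) S" for S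
        using openU[OF that] openin_open_subtopology[OF opU] by blast
    qed
    fix s d assume s: "s \<in> atlas (submanifold X U)" and d: "d \<in> atlas E"
    obtain c0 K where s_def: "s = sub_chart c0 U K" and sl: "slice_chart X U c0 K"
      using s by (auto simp: submanifold_def sub_chart_def)
    have c0: "chart_of X c0" and K: "K \<subseteq> chart_idx c0" using sl by (auto simp: slice_chart_def)
    have tc0: "top_chart (mtop X) c0" using c0 by (simp add: chart_of_iff)
    show "smooth_rep s d \<psi>"
      unfolding smooth_rep_iff
    proof
      fix j assume j: "j \<in> chart_idx d"
      let ?S' = "{q \<in> U. \<psi> q \<in> chart_dom d}"
      let ?S = "chart_dom c0 \<inter> ?S'"
      have opS': "openin (mtop X) ?S'"
        using top_chartD(1)[OF manifold_top_chart[OF E d]] by (rule openU)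
      have opS: "openin (mtop X) ?S" using opS' top_chartD(1)[OF tc0] by blast
      have "smooth_in c0 ?S (\<lambda>q. chart_map d (\<psi> q) j)"
      proof (rule smooth_in_compose(1)[OF tc0 opS _ fc(3) opS', of "\<lambda>q. q"])
        show "smooth_in x ?S' (\<lambda>q. chart_map d (\<psi> q) j)" by (rule sm[OF d j])
        have "smooth_rep c0 x (\<lambda>q. q)" by (rule manifold_chart_change_smooth[OF X c0 fc(1)])
        then show "smooth_in c0 ?S (\<lambda>q. chart_map x q i)" if "i \<in> ?I" for i
          using that \<psi>(3) by (auto simp: smooth_rep_iff intro: smooth_in_mono)
      qed (use \<psi>(3) in auto)
      then have "smooth_in (sub_chart c0 U K) ?S (\<lambda>q. chart_map d (\<psi> q) j)"
        using openin_open_subtopology[OF opU] opS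
        by (intro smooth_in_sub_chart[OF tc0 slice_top_chart[OF sl] K, of ?S ?S]) auto
      moreover have "{q \<in> chart_dom s. \<psi> q \<in> chart_dom d} = ?S" by (auto simp: s_def)
      ultimately show "smooth_in s {q \<in> chart_dom s. \<psi> q \<in> chart_dom d} (\<lambda>q. chart_map d (\<psi> q) j)"
        by (simp add: s_def)
    qed
  qed
  have Q0: "Q (chart_map x (\<pi> e0)) = chart_map c e0"
  proof
    fix s show "Q (chart_map x (\<pi> e0)) s = chart_map c e0 s"
    proof (cases s)
      case (Inl i)
      then show ?thesis using fc(7)[OF e0] by (simp add: Q_def)
    next
      case (Inr a)
      then show ?thesis using h0 tc(6)[OF e0] by (auto simp: Q_def coord_space_def)
    qed
  qed
  have p0: "\<pi> e0 \<in> U" using fc(5)[OF e0] Q0 e0 by (auto simp: U_def)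
  show ?thesis
  proof (rule that[of \<psi>])
    show "section_at X E \<pi> (\<pi> e0) \<psi>" using sec p0 by (auto simp: section_at_def)
    show "\<psi> (\<pi> e0) = e0" unfolding \<psi>_def Q0 by (rule tc(7)[OF e0])
    fix \<alpha> a assume \<alpha>: "set_mset \<alpha> \<subseteq> ?I" and a: "Inr a \<in> ?C"
    show "section_partial x c \<alpha> a \<psi> (\<pi> e0) = multi_partial \<alpha> (h a) (chart_map x (\<pi> e0))"
      unfolding section_partial_def multi_partial_def
    proof (rule foldr_partial_cong[OF tx(2) tx(4)[OF opU]])
      show "U \<subseteq> chart_dom x" using \<psi>(3) by auto
      show "chart_map c (\<psi> (chart_inv x v)) (Inr a) = h a v" if "v \<in> chart_map x ` U" for v
        using that \<psi>(2,3) tx(7) a by (auto simp: Q_def)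
    qed (use \<alpha> p0 in auto)
  qed
qed

lemma section_with_derivatives:
  assumes X: "manifold X" and E: "manifold E" and fib: "fibered_chart X E \<pi> x c"
    and e0: "e0 \<in> chart_dom c"
    and w0: "\<And>a. Inr a \<in> chart_idx c \<Longrightarrow> w {#} a = chart_map c e0 (Inr a)"
  obtains \<psi> where "section_at X E \<pi> (\<pi> e0) \<psi>" "\<psi> (\<pi> e0) = e0"
    "\<And>\<alpha> a. set_mset \<alpha> \<subseteq> chart_idx x \<Longrightarrow> Inr a \<in> chart_idx c \<Longrightarrow>
      section_partial x c \<alpha> a \<psi> (\<pi> e0) = w \<alpha> a"
proof -
  note fc = fibered_chartD[OF fib]
  let ?I = "chart_idx x" and ?v = "chart_map x (\<pi> e0)"
  have v: "?v \<in> coord_space ?I" using top_chartD(6)[OF fc(3) fc(5)[OF e0]] .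
  have "\<exists>f. smooth_on ?I (coord_space ?I) f \<and> (\<forall>\<alpha>. set_mset \<alpha> \<subseteq> ?I \<longrightarrow> multi_partial \<alpha> f ?v = w \<alpha> a)" for a
    using borel_lemma[OF top_chartD(2)[OF fc(3)] v, of "\<lambda>\<alpha>. w \<alpha> a"] by metis
  then obtain h where h: "\<And>a. smooth_on ?I (coord_space ?I) (h a)"
    "\<And>a \<alpha>. set_mset \<alpha> \<subseteq> ?I \<Longrightarrow> multi_partial \<alpha> (h a) ?v = w \<alpha> a" by metis
  have h0: "h a ?v = chart_map c e0 (Inr a)" if "Inr a \<in> chart_idx c" for a
    using h(2)[of "{#}" a] w0[OF that] by simp
  obtain \<psi> where "section_at X E \<pi> (\<pi> e0) \<psi>" "\<psi> (\<pi> e0) = e0"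
    "\<And>\<alpha> a. set_mset \<alpha> \<subseteq> ?I \<Longrightarrow> Inr a \<in> chart_idx c \<Longrightarrow>
      section_partial x c \<alpha> a \<psi> (\<pi> e0) = multi_partial \<alpha> (h a) ?v"
    using section_with_coordinates[OF X E fib h(1) e0 h0] by blast
  then show ?thesis using h(2) by (intro that[of \<psi>]) auto
qed

section \<open>Change of jet coordinates\<close>

text \<open>
  The labels of jet coordinates, for arbitrary label types.
\<close>

definition jet_labels :: "'i set \<Rightarrow> ('i + 'j) set \<Rightarrow> nat \<Rightarrow> ('i + 'i multiset \<times> 'j) set" where
  "jet_labels I C n = I <+> {(\<alpha>, a). size \<alpha> \<le> n \<and> set_mset \<alpha> \<subseteq> I \<and> Inr a \<in> C}"

definition jet_coords ::
  "'i::linorder set \<Rightarrow> ('i + 'j) set \<Rightarrow> nat \<Rightarrow> ('j \<Rightarrow> ('i \<Rightarrow> real) \<Rightarrow> real) \<Rightarrow> ('i \<Rightarrow> real) \<Rightarrow>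
   'i + 'i multiset \<times> 'j \<Rightarrow> real" where
  "jet_coords I C n h v s = (if s \<in> jet_labels I C n
     then case s of Inl i \<Rightarrow> v i | Inr (\<alpha>, a) \<Rightarrow> multi_partial \<alpha> (h a) v else 0)"

text \<open>
  The projection from k-jets to the total space, in coordinates.
\<close>

definition order_zero :: "('i + 'i multiset \<times> 'j \<Rightarrow> real) \<Rightarrow> 'i + 'j \<Rightarrow> real" where
  "order_zero w s = (case s of Inl i \<Rightarrow> w (Inl i) | Inr a \<Rightarrow> w (Inr ({#}, a)))"

definition truncate ::
  "'i set \<Rightarrow> ('i + 'j) set \<Rightarrow> nat \<Rightarrow> ('i + 'i multiset \<times> 'j \<Rightarrow> real) \<Rightarrow> 'i + 'i multiset \<times> 'j \<Rightarrow> real"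
  where "truncate I C n w s = (if s \<in> jet_labels I C n then w s else 0)"

lemma Inl_in_jet_labels [simp]: "Inl i \<in> jet_labels I C n \<longleftrightarrow> i \<in> I"
  and Inr_in_jet_labels [simp]:
    "Inr (\<alpha>, a) \<in> jet_labels I C n \<longleftrightarrow> size \<alpha> \<le> n \<and> set_mset \<alpha> \<subseteq> I \<and> Inr a \<in> C"
  by (auto simp: jet_labels_def)

lemma finite_jet_labels:
  assumes "finite I" "finite C"
  shows "finite (jet_labels I C n)"
proof -
  have "finite ((\<Union>m\<le>n. multisets_of_size I m) \<times> (Inr -` C))"
    using assms by (intro finite_cartesian_product finite_UN_I finite_vimageI) auto
  then have "finite {(\<alpha>, a). size \<alpha> \<le> n \<and> set_mset \<alpha> \<subseteq> I \<and> Inr a \<in> C}"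
    by (rule finite_subset[rotated]) (auto simp: multisets_of_size_def)
  then show ?thesis unfolding jet_labels_def using assms(1) by (rule finite_Plus[rotated])
qed

lemma jet_labels_mono: "m \<le> n \<Longrightarrow> jet_labels I C m \<subseteq> jet_labels I C n"
  by (auto simp: jet_labels_def)

lemma jet_coords_in: "jet_coords I C n h v \<in> coord_space (jet_labels I C n)"
  by (simp add: jet_coords_def coord_space_def)

lemma truncate_in: "truncate I C n w \<in> coord_space (jet_labels I C n)"
  by (simp add: truncate_def coord_space_def)

lemma truncate_jet_coords:
  "m \<le> n \<Longrightarrow> truncate I C m (jet_coords I C n h v) = jet_coords I C m h v"
  using jet_labels_mono[of m n I C] by (auto simp: fun_eq_iff truncate_def jet_coords_def)

lemma order_zero_in:
  assumes "w \<in> coord_space (jet_labels I C n)" and "\<And>i. Inl i \<in> C \<longleftrightarrow> i \<in> I"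
  shows "order_zero w \<in> coord_space C"
  using assms by (auto simp: coord_space_def order_zero_def split: sum.splits)

lemma order_zero_truncate:
  assumes "w \<in> coord_space (jet_labels I C m)"
  shows "order_zero (truncate I C n w) = order_zero w"
  using assms by (auto simp: fun_eq_iff order_zero_def truncate_def coord_space_def split: sum.splits)

lemma continuous_on_order_zero: "continuous_on A order_zero"
proof (rule continuous_on_coordinatewise_then_product)
  fix s
  show "continuous_on A (\<lambda>w. order_zero w s)"
    unfolding order_zero_def
    by (cases s) (simp_all add: continuous_on_subset[OF continuous_on_product_coordinates subset_UNIV])
qed

lemma continuous_on_truncate: "continuous_on A (truncate I C n)"
proof (rule continuous_on_coordinatewise_then_product)
  fix s
  show "continuous_on A (\<lambda>w. truncate I C n w s)"
    unfolding truncate_def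
    by (cases "s \<in> jet_labels I C n")
      (simp_all add: continuous_on_subset[OF continuous_on_product_coordinates subset_UNIV])
qed

lemma rel_open_order_zero:
  assumes O: "rel_open C Q" and IC: "\<And>i. Inl i \<in> C \<longleftrightarrow> i \<in> I"
  shows "rel_open (jet_labels I C n) {w \<in> coord_space (jet_labels I C n). order_zero w \<in> Q}"
proof -
  have "rel_open (jet_labels I C n) (coord_space (jet_labels I C n) \<inter> order_zero -` Q)"
    using continuous_on_order_zero _ O
    by (rule continuous_openin_preimage) (use order_zero_in IC in blast)
  then show ?thesis by (simp add: vimage_def Collect_conj_eq)
qed

lemma order_zero_jet_coords:
  "order_zero (jet_coords I C n h v) (Inl i) = (if i \<in> I then v i else 0)"
  "order_zero (jet_coords I C n h v) (Inr a) = (if Inr a \<in> C then h a v else 0)"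
  by (simp_all add: order_zero_def jet_coords_def)

text \<open>
  Changing fibered charts turns the section h into \<open>u \<mapsto> \<tau>(\<sigma> u, h(\<sigma> u))\<close>, where \<open>\<sigma>\<close> is the
  change of the base coordinates with inverse \<open>\<rho>\<close>, and \<open>\<tau>\<close> is a new fibre coordinate.  Each derivative of
  this function is a smooth function T of the derivatives of h of at most the same order, and T is
  independent of h: differentiating \<open>T(jet of h at \<sigma> u)\<close> once more gives, by the chain rule, an expression
  in the next jet of h (the total derivative of T).
\<close>

lemma partial_composite_jet_coordinates:
  fixes I :: "'i::linorder set" and C :: "('i + 'j) set" and I' :: "'k set"
  assumes fin: "finite I" "finite C" "finite I'" and IC: "\<And>i. Inl i \<in> C \<longleftrightarrow> i \<in> I"
    and Q: "rel_open C Q" and \<tau>: "smooth_on C Q \<tau>"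
    and Y: "rel_open I' Y" and \<sigma>: "\<And>u. u \<in> Y \<Longrightarrow> \<sigma> u \<in> coord_space I"
      "\<And>i. i \<in> I \<Longrightarrow> smooth_on I' Y (\<lambda>u. \<sigma> u i)"
    and Z: "rel_open I Z" and \<rho>: "\<And>v. v \<in> Z \<Longrightarrow> \<rho> v \<in> Y"
      "\<And>i. i \<in> I' \<Longrightarrow> smooth_on I Z (\<lambda>v. \<rho> v i)" "\<And>u. u \<in> Y \<Longrightarrow> \<rho> (\<sigma> u) = u"
    and QZ: "\<And>v. v \<in> Q \<Longrightarrow> (\<lambda>i. v (Inl i)) \<in> Z"
    and L: "set L \<subseteq> I'"
  shows "\<exists>T. smooth_on (jet_labels I C (length L))
      {w \<in> coord_space (jet_labels I C (length L)). order_zero w \<in> Q} T \<and>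
    (\<forall>V h. rel_open I V \<longrightarrow> (\<forall>a. Inr a \<in> C \<longrightarrow> smooth_on I V (h a)) \<longrightarrow>
      (\<forall>v\<in>V. order_zero (jet_coords I C 0 h v) \<in> Q) \<longrightarrow>
      (\<forall>u\<in>Y. \<sigma> u \<in> V \<longrightarrow>
        foldr partial L (\<lambda>u. \<tau> (order_zero (jet_coords I C 0 h (\<sigma> u)))) u =
          T (jet_coords I C (length L) h (\<sigma> u))))"
  using L
proof (induction L)
  case Nil
  let ?J = "jet_labels I C 0"
  let ?A = "{w \<in> coord_space ?J. order_zero w \<in> Q}"
  have finJ: "finite ?J" using fin by (intro finite_jet_labels)
  have opA: "rel_open ?J ?A" by (rule rel_open_order_zero[OF Q IC])
  have "smooth_on ?J ?A (\<lambda>w. \<tau> (order_zero w))"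
  proof (rule smooth_on_compose[OF finJ opA fin(2) Q _ _ \<tau>])
    fix s assume "s \<in> C"
    have "(\<lambda>w. order_zero w s) = (\<lambda>w. w (case s of Inl i \<Rightarrow> Inl i | Inr a \<Rightarrow> Inr ({#}, a)))"
      by (auto simp: order_zero_def split: sum.splits)
    then show "smooth_on ?J ?A (\<lambda>w. order_zero w s)"
      by (simp add: smooth_on_coord[OF finJ opA])
  qed auto
  then show ?case by (intro exI[of _ "\<lambda>w. \<tau> (order_zero w)"]) simp
next
  case (Cons i L)
  define n where "n = length L"
  define J where "J = jet_labels I C n"
  define J' where "J' = jet_labels I C (Suc n)"
  define A where "A = {w \<in> coord_space J. order_zero w \<in> Q}"
  define A' where "A' = {w \<in> coord_space J'. order_zero w \<in> Q}"
  have finJ: "finite J" "finite J'" unfolding J_def J'_def using fin by (auto intro: finite_jet_labels)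
  have opA: "rel_open J A" "rel_open J' A'"
    unfolding A_def A'_def J_def J'_def by (rule rel_open_order_zero[OF Q IC])+
  have i: "i \<in> I'" and LI: "set L \<subseteq> I'" using Cons.prems by auto
  from Cons.IH[OF LI] obtain T where T1: "smooth_on J A T" and T2:
    "\<forall>V h. rel_open I V \<longrightarrow> (\<forall>a. Inr a \<in> C \<longrightarrow> smooth_on I V (h a)) \<longrightarrow>
      (\<forall>v\<in>V. order_zero (jet_coords I C 0 h v) \<in> Q) \<longrightarrow>
      (\<forall>u\<in>Y. \<sigma> u \<in> V \<longrightarrow>
        foldr partial L (\<lambda>u. \<tau> (order_zero (jet_coords I C 0 h (\<sigma> u)))) u =
          T (jet_coords I C n h (\<sigma> u)))"
    unfolding J_def A_def n_def by (elim exE conjE)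
  have T: "foldr partial L (\<lambda>u. \<tau> (order_zero (jet_coords I C 0 h (\<sigma> u)))) u =
      T (jet_coords I C n h (\<sigma> u))"
    if "rel_open I V" "\<And>a. Inr a \<in> C \<Longrightarrow> smooth_on I V (h a)"
      "\<And>v. v \<in> V \<Longrightarrow> order_zero (jet_coords I C 0 h v) \<in> Q" "u \<in> Y" "\<sigma> u \<in> V" for V h u
    using T2[rule_format, of V h u] that by simp
  define \<kappa> where "\<kappa> b w = partial i (\<lambda>u. \<sigma> u b) (\<rho> (\<lambda>k. w (Inl k)))"
    for b and w :: "'i + 'i multiset \<times> 'j \<Rightarrow> real"
  define \<mu> where "\<mu> s w = (case s of Inl b \<Rightarrow> \<kappa> b w
      | Inr (\<alpha>, a) \<Rightarrow> \<Sum>b\<in>I. w (Inr (add_mset b \<alpha>, a)) * \<kappa> b w)" for s w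
  \<comment> \<open>T' is the total derivative of T; \<mu> is the derivative of the coordinate s along the prolonged section.\<close>
  define T' where "T' w = (\<Sum>s\<in>J. partial s T (truncate I C n w) * \<mu> s w)" for w
  have base: "(\<lambda>k. w (Inl k)) \<in> Z" if "w \<in> A'" for w
  proof -
    have "(\<lambda>k. order_zero w (Inl k)) \<in> Z" using that QZ by (simp add: A'_def)
    then show ?thesis by (simp add: order_zero_def)
  qed
  have sm_\<kappa>: "smooth_on J' A' (\<kappa> b)" if b: "b \<in> I" for b
    unfolding \<kappa>_def
  proof (rule smooth_on_compose[OF finJ(2) opA(2) fin(3) Y,
        of "\<lambda>w. \<rho> (\<lambda>k. w (Inl k))" "partial i (\<lambda>u. \<sigma> u b)"])
    show "smooth_on I' Y (partial i (\<lambda>u. \<sigma> u b))" by (rule smooth_on_partial[OF \<sigma>(2)[OF b] i])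
    show "\<rho> (\<lambda>k. w (Inl k)) \<in> Y" if "w \<in> A'" for w using \<rho>(1) base[OF that] by blast
    show "smooth_on J' A' (\<lambda>w. \<rho> (\<lambda>k. w (Inl k)) j)" if "j \<in> I'" for j
      by (rule smooth_on_compose[OF finJ(2) opA(2) fin(1) Z, of "\<lambda>w k. w (Inl k)" "\<lambda>v. \<rho> v j"])
        (simp_all add: base \<rho>(2) that smooth_on_coord[OF finJ(2) opA(2)])
  qed
  have sm_T': "smooth_on J' A' T'"
    unfolding T'_def
  proof (intro smooth_on_sum[OF finJ(2) opA(2)] smooth_on_mult[OF finJ(2) opA(2)])
    fix s assume s: "s \<in> J"
    show "smooth_on J' A' (\<lambda>w. partial s T (truncate I C n w))"
    proof (rule smooth_on_compose[OF finJ(2) opA(2) finJ(1) opA(1),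
          of "truncate I C n" "partial s T"])
      show "smooth_on J A (partial s T)" by (rule smooth_on_partial[OF T1 s])
      show "truncate I C n w \<in> A" if "w \<in> A'" for w
        using that truncate_in[of I C n w] order_zero_truncate[of w I C "Suc n" n]
        by (simp add: A_def A'_def J_def J'_def)
      show "smooth_on J' A' (\<lambda>w. truncate I C n w r)" if "r \<in> J" for r
        using that by (simp add: truncate_def J_def[symmetric] smooth_on_coord[OF finJ(2) opA(2)])
    qed
    show "smooth_on J' A' (\<mu> s)"
    proof (cases s)
      case (Inl b)
      then show ?thesis using s sm_\<kappa>[of b] by (simp add: \<mu>_def[abs_def] J_def)
    next
      case (Inr r)
      obtain \<alpha> a where r: "r = (\<alpha>, a)" by fastforce
      show ?thesis unfolding Inr r \<mu>_def sum.case prod.case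
        by (intro smooth_on_sum[OF finJ(2) opA(2)] smooth_on_mult[OF finJ(2) opA(2)]
            smooth_on_coord[OF finJ(2) opA(2)] sm_\<kappa>)
    qed
  qed
  have eq: "foldr partial (i # L) (\<lambda>u. \<tau> (order_zero (jet_coords I C 0 h (\<sigma> u)))) u =
      T' (jet_coords I C (Suc n) h (\<sigma> u))"
    if V: "rel_open I V" and h: "\<And>a. Inr a \<in> C \<Longrightarrow> smooth_on I V (h a)"
      and VQ: "\<And>v. v \<in> V \<Longrightarrow> order_zero (jet_coords I C 0 h v) \<in> Q" and u: "u \<in> Y" "\<sigma> u \<in> V"
    for V h u
  proof -
    define Y' where "Y' = {u \<in> Y. \<sigma> u \<in> V}"
    have cont\<sigma>: "continuous_on Y \<sigma>"
    proof (rule continuous_on_coordinatewise_then_product)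
      fix k
      show "continuous_on Y (\<lambda>u. \<sigma> u k)"
      proof (cases "k \<in> I")
        case False
        then show ?thesis
          using \<sigma>(1) continuous_on_cong[of Y Y "\<lambda>u. \<sigma> u k" "\<lambda>u. 0"] by (auto simp: coord_space_def)
      qed (use smooth_on_continuous \<sigma>(2) in blast)
    qed
    have "openin (top_of_set Y) (Y \<inter> \<sigma> -` V)"
      using cont\<sigma> _ V by (rule continuous_openin_preimage) (use \<sigma>(1) in auto)
    then have Y': "rel_open I' Y'"
      using openin_trans Y unfolding Y'_def by (simp add: vimage_def Collect_conj_eq) blast
    have uY': "u \<in> Y'" and YY: "Y' \<subseteq> Y" using u by (auto simp: Y'_def)
    have sm\<sigma>: "smooth_on I' Y' (\<lambda>u. \<sigma> u k)" if "k \<in> I" for k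
      using \<sigma>(2)[OF that] YY by (rule smooth_on_mono) simp
    have jA: "jet_coords I C n h (\<sigma> u) \<in> A" if "u \<in> Y'" for u
    proof -
      have "order_zero (jet_coords I C n h (\<sigma> u)) = order_zero (jet_coords I C 0 h (\<sigma> u))"
        by (auto simp: fun_eq_iff order_zero_def jet_coords_def split: sum.splits)
      then show ?thesis using VQ that jet_coords_in[of I C n h "\<sigma> u"] by (auto simp: A_def J_def Y'_def)
    qed
    have comp: "smooth_on I' Y' (\<lambda>u. jet_coords I C n h (\<sigma> u) s) \<and>
        partial i (\<lambda>u. jet_coords I C n h (\<sigma> u) s) u = \<mu> s (jet_coords I C (Suc n) h (\<sigma> u))"
      if s: "s \<in> J" for s
    proof -
      have base_u: "\<rho> (\<lambda>k. jet_coords I C (Suc n) h (\<sigma> u) (Inl k)) = u"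
      proof -
        have "(\<lambda>k. jet_coords I C (Suc n) h (\<sigma> u) (Inl k)) = \<sigma> u"
          using \<sigma>(1)[OF u(1)] by (auto simp: fun_eq_iff jet_coords_def coord_space_def)
        then show ?thesis using \<rho>(3)[OF u(1)] by simp
      qed
      show ?thesis
      proof (cases s)
        case (Inl b)
        then have b: "b \<in> I" using s by (simp add: J_def)
        then have "(\<lambda>u. jet_coords I C n h (\<sigma> u) s) = (\<lambda>u. \<sigma> u b)"
          by (simp add: Inl jet_coords_def)
        then show ?thesis using sm\<sigma>[OF b] base_u by (simp add: Inl \<mu>_def \<kappa>_def)
      next
        case (Inr r)
        obtain \<alpha> a where r: "r = (\<alpha>, a)" by fastforce
        have \<alpha>: "size \<alpha> \<le> n" "set_mset \<alpha> \<subseteq> I" "Inr a \<in> C" using s by (auto simp: J_def Inr r)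
        then have eq: "(\<lambda>u. jet_coords I C n h (\<sigma> u) s) = (\<lambda>u. multi_partial \<alpha> (h a) (\<sigma> u))"
          by (simp add: Inr r jet_coords_def)
        have sm: "smooth_on I V (multi_partial \<alpha> (h a))"
          by (rule smooth_on_multi_partial[OF h[OF \<alpha>(3)] \<alpha>(2)])
        have inV: "\<sigma> u \<in> V" if "u \<in> Y'" for u using that by (simp add: Y'_def)
        have "partial i (\<lambda>u. multi_partial \<alpha> (h a) (\<sigma> u)) u =
            (\<Sum>b\<in>I. partial b (multi_partial \<alpha> (h a)) (\<sigma> u) * partial i (\<lambda>u. \<sigma> u b) u)"
          by (rule partial_compose[OF fin(3) Y' fin(1) V inV sm\<sigma> sm uY' i])
        also have "\<dots> = (\<Sum>b\<in>I. multi_partial (add_mset b \<alpha>) (h a) (\<sigma> u) * partial i (\<lambda>u. \<sigma> u b) u)"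
          using partial_multi_partial[OF fin(1) V h[OF \<alpha>(3)] u(2) _ \<alpha>(2)] by (intro sum.cong) auto
        also have "\<dots> = \<mu> s (jet_coords I C (Suc n) h (\<sigma> u))"
          unfolding Inr r \<mu>_def sum.case prod.case \<kappa>_def base_u
          using \<alpha> by (intro sum.cong) (auto simp: jet_coords_def)
        finally show ?thesis
          unfolding eq using smooth_on_compose[OF fin(3) Y' fin(1) V inV sm\<sigma> sm] by blast
      qed
    qed
    have "foldr partial (i # L) (\<lambda>u. \<tau> (order_zero (jet_coords I C 0 h (\<sigma> u)))) u =
      partial i (foldr partial L (\<lambda>u. \<tau> (order_zero (jet_coords I C 0 h (\<sigma> u))))) u"
      by simp
    also have "\<dots> = partial i (\<lambda>u. T (jet_coords I C n h (\<sigma> u))) u"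
      by (rule partial_cong[OF fin(3) Y' _ uY' i]) (use T[OF V h VQ] in \<open>auto simp: Y'_def\<close>)
    also have "\<dots> = (\<Sum>s\<in>J. partial s T (jet_coords I C n h (\<sigma> u)) *
        partial i (\<lambda>u. jet_coords I C n h (\<sigma> u) s) u)"
      by (rule partial_compose[OF fin(3) Y' finJ(1) opA(1) jA _ T1 uY' i]) (use comp in auto)
    also have "\<dots> = T' (jet_coords I C (Suc n) h (\<sigma> u))"
      unfolding T'_def using comp by (simp add: truncate_jet_coords)
    finally show ?thesis .
  qed
  show ?case
    using sm_T' eq unfolding A'_def J'_def by (intro exI[of _ T']) (simp add: n_def)
qed

section \<open>Jets and jet charts\<close>

definition section_coords ::
  "('x, nat) chart \<Rightarrow> ('e, nat + 'j) chart \<Rightarrow> ('x \<Rightarrow> 'e) \<Rightarrow> 'j \<Rightarrow> (nat \<Rightarrow> real) \<Rightarrow> real" where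
  "section_coords x c \<phi> a v = chart_map c (\<phi> (chart_inv x v)) (Inr a)"

definition jet_coords_at ::
  "('x, nat) chart \<Rightarrow> ('e, nat + 'j) chart \<Rightarrow> nat \<Rightarrow> ('x \<Rightarrow> 'e) \<Rightarrow> 'x \<Rightarrow> nat + nat multiset \<times> 'j \<Rightarrow> real" where
  "jet_coords_at x c n \<phi> p =
     jet_coords (chart_idx x) (chart_idx c) n (section_coords x c \<phi>) (chart_map x p)"

lemma section_partial_eq:
  "section_partial x c \<alpha> a \<phi> p = multi_partial \<alpha> (section_coords x c \<phi> a) (chart_map x p)"
  by (simp add: section_partial_def section_coords_def[abs_def])

lemma mem_orders_upto [simp]: "d \<in> orders_upto (int n) \<longleftrightarrow> d \<le> n"
  by (simp add: orders_upto_def)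

lemma jet_idx_eq: "jet_idx x c (int n) = jet_labels (chart_idx x) (chart_idx c) n"
  by (simp add: jet_idx_def jet_labels_def)

lemma order_zero_jet_coords_at:
  assumes fib: "fibered_chart X E \<pi> x c" and \<phi>: "\<phi> p \<in> chart_dom c" "\<pi> (\<phi> p) = p"
  shows "order_zero (jet_coords_at x c n \<phi> p) = chart_map c (\<phi> p)"
proof
  fix s
  note fc = fibered_chartD[OF fib]
  have p: "p \<in> chart_dom x" using fc(5)[OF \<phi>(1)] \<phi>(2) by simp
  show "order_zero (jet_coords_at x c n \<phi> p) s = chart_map c (\<phi> p) s"
  proof (cases s)
    case (Inl i)
    then show ?thesis
      using fc(7)[OF \<phi>(1), of i] \<phi>(2) top_chartD(6)[OF fc(3) p]
      by (auto simp: jet_coords_at_def order_zero_jet_coords coord_space_def)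
  next
    case (Inr a)
    then show ?thesis
      using top_chartD(6)[OF fc(4) \<phi>(1)] top_chartD(7)[OF fc(3) p]
      by (auto simp: jet_coords_at_def order_zero_jet_coords section_coords_def coord_space_def)
  qed
qed

lemma section_atE:
  assumes "section_at X E \<pi> p \<phi>"
  obtains U where "p \<in> U" "section_on X E \<pi> U \<phi>" "\<pi> (\<phi> p) = p"
  using assms unfolding section_at_def section_on_def by blast

lemma jet_coordinate_change:
  assumes X: "manifold X" and E: "manifold E"
    and fib: "fibered_chart X E \<pi> x c" and fib': "fibered_chart X E \<pi> x' c'"
    and L: "set L \<subseteq> chart_idx x'" and a': "Inr a' \<in> chart_idx c'"
  obtains T where
    "continuous_on {w \<in> coord_space (jet_labels (chart_idx x) (chart_idx c) (length L)).
       order_zero w \<in> chart_map c ` (chart_dom c \<inter> chart_dom c')} T"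
    "\<And>p \<phi>. section_at X E \<pi> p \<phi> \<Longrightarrow> \<phi> p \<in> chart_dom c \<Longrightarrow> \<phi> p \<in> chart_dom c' \<Longrightarrow>
       foldr partial L (section_coords x' c' \<phi> a') (chart_map x' p) = T (jet_coords_at x c (length L) \<phi> p)"
proof -
  note fc = fibered_chartD[OF fib] and fc' = fibered_chartD[OF fib']
  note tx = top_chartD[OF fc(3)] and tc = top_chartD[OF fc(4)]
    and tx' = top_chartD[OF fc'(3)] and tc' = top_chartD[OF fc'(4)]
  let ?I = "chart_idx x" and ?C = "chart_idx c" and ?I' = "chart_idx x'"
  let ?D = "chart_dom x \<inter> chart_dom x'" and ?B = "chart_dom c \<inter> chart_dom c'"
  define \<tau> where "\<tau> v = chart_map c' (chart_inv c v) (Inr a')" for v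
  define \<sigma> where "\<sigma> u = chart_map x (chart_inv x' u)" for u
  define \<rho> where "\<rho> v = chart_map x' (chart_inv x v)" for v
  have opD: "openin (mtop X) ?D" using tx(1) tx'(1) by blast
  have opB: "openin (mtop E) ?B" using tc(1) tc'(1) by blast
  have \<tau>: "smooth_on ?C (chart_map c ` ?B) \<tau>"
  proof -
    have "smooth_rep c c' (\<lambda>e. e)" by (rule manifold_chart_change_smooth[OF E fc(2) fc'(2)])
    then have "smooth_in c ?B (\<lambda>e. chart_map c' e (Inr a'))"
      using a' by (auto simp: smooth_rep_iff intro: smooth_in_mono)
    then show ?thesis by (simp add: smooth_in_def \<tau>_def[abs_def])
  qed
  have \<sigma>: "smooth_on ?I' (chart_map x' ` ?D) (\<lambda>u. \<sigma> u i)" if "i \<in> ?I" for i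
  proof -
    have "smooth_rep x' x (\<lambda>q. q)" by (rule manifold_chart_change_smooth[OF X fc'(1) fc(1)])
    then have "smooth_in x' ?D (\<lambda>q. chart_map x q i)"
      using that by (auto simp: smooth_rep_iff intro: smooth_in_mono)
    then show ?thesis by (simp add: smooth_in_def \<sigma>_def)
  qed
  have \<rho>: "smooth_on ?I (chart_map x ` ?D) (\<lambda>v. \<rho> v i)" if "i \<in> ?I'" for i
  proof -
    have "smooth_rep x x' (\<lambda>q. q)" by (rule manifold_chart_change_smooth[OF X fc(1) fc'(1)])
    then have "smooth_in x ?D (\<lambda>q. chart_map x' q i)"
      using that by (auto simp: smooth_rep_iff intro: smooth_in_mono)
    then show ?thesis by (simp add: smooth_in_def \<rho>_def)
  qed
  have "\<exists>T. smooth_on (jet_labels ?I ?C (length L))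
      {w \<in> coord_space (jet_labels ?I ?C (length L)). order_zero w \<in> chart_map c ` ?B} T \<and>
    (\<forall>V h. rel_open ?I V \<longrightarrow> (\<forall>a. Inr a \<in> ?C \<longrightarrow> smooth_on ?I V (h a)) \<longrightarrow>
      (\<forall>v\<in>V. order_zero (jet_coords ?I ?C 0 h v) \<in> chart_map c ` ?B) \<longrightarrow>
      (\<forall>u\<in>chart_map x' ` ?D. \<sigma> u \<in> V \<longrightarrow>
        foldr partial L (\<lambda>u. \<tau> (order_zero (jet_coords ?I ?C 0 h (\<sigma> u)))) u =
          T (jet_coords ?I ?C (length L) h (\<sigma> u))))"
  proof (rule partial_composite_jet_coordinates[OF tx(2) tc(2) tx'(2) fc(6) _ \<tau> _ _ \<sigma> _ _ \<rho> _ _ L])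
    show "rel_open ?C (chart_map c ` ?B)" by (rule tc(4)[OF opB]) simp
    show "rel_open ?I' (chart_map x' ` ?D)" by (rule tx'(4)[OF opD]) simp
    show "rel_open ?I (chart_map x ` ?D)" by (rule tx(4)[OF opD]) simp
    show "\<sigma> u \<in> coord_space ?I" if "u \<in> chart_map x' ` ?D" for u
      using that tx(6) tx'(7) by (auto simp: \<sigma>_def)
    show "\<rho> v \<in> chart_map x' ` ?D" if "v \<in> chart_map x ` ?D" for v
      using that tx(7) by (auto simp: \<rho>_def)
    show "\<rho> (\<sigma> u) = u" if "u \<in> chart_map x' ` ?D" for u
      using that tx(7) tx'(7) by (auto simp: \<rho>_def \<sigma>_def)
    show "(\<lambda>i. v (Inl i)) \<in> chart_map x ` ?D" if v: "v \<in> chart_map c ` ?B" for v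
    proof -
      obtain e where e: "e \<in> ?B" "v = chart_map c e" using v by blast
      then have "(\<lambda>i. v (Inl i)) = chart_map x (\<pi> e)" using fc(7)[of e] by auto
      then show ?thesis using fc(5)[of e] fc'(5)[of e] e(1) by blast
    qed
  qed
  then obtain T where T1: "smooth_on (jet_labels ?I ?C (length L))
      {w \<in> coord_space (jet_labels ?I ?C (length L)). order_zero w \<in> chart_map c ` ?B} T" and
    T2: "\<forall>V h. rel_open ?I V \<longrightarrow> (\<forall>a. Inr a \<in> ?C \<longrightarrow> smooth_on ?I V (h a)) \<longrightarrow>
      (\<forall>v\<in>V. order_zero (jet_coords ?I ?C 0 h v) \<in> chart_map c ` ?B) \<longrightarrow>
      (\<forall>u\<in>chart_map x' ` ?D. \<sigma> u \<in> V \<longrightarrow>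
        foldr partial L (\<lambda>u. \<tau> (order_zero (jet_coords ?I ?C 0 h (\<sigma> u)))) u =
          T (jet_coords ?I ?C (length L) h (\<sigma> u)))"
    by (elim exE conjE)
  show ?thesis
  proof (rule that[of T])
    show "continuous_on {w \<in> coord_space (jet_labels ?I ?C (length L)). order_zero w \<in> chart_map c ` ?B} T"
      by (rule smooth_on_continuous[OF T1])
    fix p \<phi> assume sec: "section_at X E \<pi> p \<phi>" and \<phi>p: "\<phi> p \<in> chart_dom c" "\<phi> p \<in> chart_dom c'"
    obtain U where U: "p \<in> U" "section_on X E \<pi> U \<phi>" using sec by (rule section_atE)
    note s = section_onD[OF U(2)]
    define N where "N = {q \<in> U. \<phi> q \<in> ?B} \<inter> ?D"
    have opN: "openin (mtop X) N" unfolding N_def using s(4)[OF opB] opD by blast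
    have N: "q \<in> U" "\<pi> (\<phi> q) = q" "\<phi> q \<in> chart_dom c" "\<phi> q \<in> chart_dom c'"
      "q \<in> chart_dom x" "q \<in> chart_dom x'" if "q \<in> N" for q
      using that s(2) by (auto simp: N_def)
    have pN: "p \<in> N"
      using U(1) \<phi>p s(2)[OF U(1)] fc(5)[OF \<phi>p(1)] fc'(5)[OF \<phi>p(2)] by (auto simp: N_def)
    let ?h = "section_coords x c \<phi>"
    have smh: "smooth_on ?I (chart_map x ` N) (?h a)" if "Inr a \<in> ?C" for a
    proof -
      have "smooth_in x N (\<lambda>q. chart_map c (\<phi> q) (Inr a))"
        using section_smooth_in_fibered_chart[OF X E U(2) fib that]
        by (rule smooth_in_mono) (use N in auto)
      then show ?thesis by (simp add: smooth_in_def section_coords_def[abs_def])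
    qed
    have oz: "order_zero (jet_coords ?I ?C 0 ?h (chart_map x q)) = chart_map c (\<phi> q)" if "q \<in> N" for q
      using order_zero_jet_coords_at[where \<phi> = \<phi> and p = q, OF fib N(3,2)[OF that], of 0] by (simp add: jet_coords_at_def)
    have opxN: "rel_open ?I (chart_map x ` N)" by (rule tx(4)[OF opN]) (use N in auto)
    have opxN': "rel_open ?I' (chart_map x' ` N)" by (rule tx'(4)[OF opN]) (use N in auto)
    have "foldr partial L (section_coords x' c' \<phi> a') (chart_map x' p) =
      foldr partial L (\<lambda>u. \<tau> (order_zero (jet_coords ?I ?C 0 ?h (\<sigma> u)))) (chart_map x' p)"
    proof (rule foldr_partial_cong[OF tx'(2) opxN' _ L])
      fix u assume "u \<in> chart_map x' ` N"
      then obtain q where q: "q \<in> N" "u = chart_map x' q" by blast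
      have "chart_inv x' u = q" using tx'(7)[OF N(6)[OF q(1)]] q(2) by simp
      then show "section_coords x' c' \<phi> a' u = \<tau> (order_zero (jet_coords ?I ?C 0 ?h (\<sigma> u)))"
        using tc(7)[OF N(3)[OF q(1)]] by (simp add: \<sigma>_def oz[OF q(1)] \<tau>_def section_coords_def)
    qed (use pN in blast)
    also have "\<dots> = T (jet_coords ?I ?C (length L) ?h (\<sigma> (chart_map x' p)))"
    proof (rule T2[rule_format, OF opxN])
      show "order_zero (jet_coords ?I ?C 0 ?h v) \<in> chart_map c ` ?B" if "v \<in> chart_map x ` N" for v
        using that oz N(3,4) by auto
      show "chart_map x' p \<in> chart_map x' ` ?D" using N(5,6)[OF pN] by blast
      show "\<sigma> (chart_map x' p) \<in> chart_map x ` N" using pN tx'(7)[OF N(6)[OF pN]] by (simp add: \<sigma>_def)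
    qed (rule smh)
    also have "\<sigma> (chart_map x' p) = chart_map x p" using tx'(7)[OF N(6)[OF pN]] by (simp add: \<sigma>_def)
    finally show "foldr partial L (section_coords x' c' \<phi> a') (chart_map x' p) =
        T (jet_coords_at x c (length L) \<phi> p)" by (simp add: jet_coords_at_def)
  qed
qed

text \<open>
  Jets are defined by comparing derivatives in all fibered charts; one chart suffices since the
  derivatives in any other chart are functions of those.
\<close>

lemma same_jet_if_coords_eq:
  assumes X: "manifold X" and E: "manifold E" and fib: "fibered_chart X E \<pi> x c"
    and sec: "section_at X E \<pi> p \<phi>" "section_at X E \<pi> p \<psi>"
    and eq: "\<phi> p = \<psi> p" and dom: "\<psi> p \<in> chart_dom c"
    and D: "\<And>m n. n \<in> D \<Longrightarrow> m \<le> n \<Longrightarrow> m \<in> D"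
    and coords: "\<And>\<alpha> a. size \<alpha> \<in> D \<Longrightarrow> set_mset \<alpha> \<subseteq> chart_idx x \<Longrightarrow> Inr a \<in> chart_idx c \<Longrightarrow>
      section_partial x c \<alpha> a \<phi> p = section_partial x c \<alpha> a \<psi> p"
  shows "same_jet X E \<pi> D p \<phi> \<psi>"
  unfolding same_jet_def
proof (intro conjI impI allI)
  fix x' c' \<alpha> a
  assume "fibered_chart X E \<pi> x' c' \<and> \<psi> p \<in> chart_dom c' \<and> size \<alpha> \<in> D \<and>
    set_mset \<alpha> \<subseteq> chart_idx x' \<and> Inr a \<in> chart_idx c'"
  then have fib': "fibered_chart X E \<pi> x' c'" and dom': "\<psi> p \<in> chart_dom c'"
    and \<alpha>: "size \<alpha> \<in> D" "set_mset \<alpha> \<subseteq> chart_idx x'" and a: "Inr a \<in> chart_idx c'"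
    by auto
  define L where "L = sorted_list_of_multiset \<alpha>"
  have L: "set L \<subseteq> chart_idx x'" "length L = size \<alpha>"
    using \<alpha>(2) by (simp_all add: L_def flip: size_mset)
  obtain T where T: "\<And>p \<phi>. section_at X E \<pi> p \<phi> \<Longrightarrow> \<phi> p \<in> chart_dom c \<Longrightarrow> \<phi> p \<in> chart_dom c' \<Longrightarrow>
       foldr partial L (section_coords x' c' \<phi> a) (chart_map x' p) = T (jet_coords_at x c (length L) \<phi> p)"
    by (rule jet_coordinate_change[OF X E fib fib' L(1) a]) (rule that)
  have "jet_coords_at x c (length L) \<phi> p = jet_coords_at x c (length L) \<psi> p"
    using coords D[OF \<alpha>(1)]
    by (auto simp: fun_eq_iff jet_coords_at_def jet_coords_def section_partial_eq L(2) split: sum.splits)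
  then show "section_partial x' c' \<alpha> a \<phi> p = section_partial x' c' \<alpha> a \<psi> p"
    using T[OF sec(1)] T[OF sec(2)] eq dom dom'
    by (simp add: section_partial_eq multi_partial_def L_def)
qed (rule eq)

lemma same_jet_refl: "same_jet X E \<pi> D p \<phi> \<phi>"
  by (simp add: same_jet_def)

lemma same_jet_sym: "same_jet X E \<pi> D p \<phi> \<psi> \<Longrightarrow> 0 \<in> D \<Longrightarrow> same_jet X E \<pi> D p \<psi> \<phi>"
  unfolding same_jet_def by (metis (no_types, lifting))

lemma same_jet_trans:
  "same_jet X E \<pi> D p \<phi> \<psi> \<Longrightarrow> same_jet X E \<pi> D p \<psi> \<theta> \<Longrightarrow> 0 \<in> D \<Longrightarrow> same_jet X E \<pi> D p \<phi> \<theta>"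
  unfolding same_jet_def by (metis (no_types, lifting))

lemma same_jet_mono: "same_jet X E \<pi> D p \<phi> \<psi> \<Longrightarrow> D' \<subseteq> D \<Longrightarrow> same_jet X E \<pi> D' p \<phi> \<psi>"
  unfolding same_jet_def by blast

lemma fst_jet [simp]: "fst (jet X E \<pi> D p \<psi>) = p"
  by (simp add: jet_def)

lemma jet_eqI:
  assumes "0 \<in> D" "same_jet X E \<pi> D p \<phi> \<psi>"
  shows "jet X E \<pi> D p \<phi> = jet X E \<pi> D p \<psi>"
  using same_jet_trans[OF _ assms(2,1)] same_jet_trans[OF _ same_jet_sym[OF assms(2,1)] assms(1)]
  unfolding jet_def by blast

lemma jet_eqD:
  assumes "section_at X E \<pi> p \<phi>" "jet X E \<pi> D p \<phi> = jet X E \<pi> D p' \<psi>"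
  shows "p' = p" "same_jet X E \<pi> D p \<phi> \<psi>"
proof -
  show "p' = p" using assms(2) by (simp add: jet_def)
  moreover have "\<phi> \<in> {\<phi>'. section_at X E \<pi> p \<phi>' \<and> same_jet X E \<pi> D p \<phi>' \<phi>}"
    using assms(1) by (simp add: same_jet_refl)
  moreover have "snd (jet X E \<pi> D p \<phi>) = snd (jet X E \<pi> D p' \<psi>)" using assms(2) by simp
  ultimately show "same_jet X E \<pi> D p \<phi> \<psi>" unfolding jet_def snd_conv by blast
qed

lemma jet_rep_jet:
  assumes "section_at X E \<pi> p \<psi>"
  shows "section_at X E \<pi> p (jet_rep (jet X E \<pi> D p \<psi>))"
    "same_jet X E \<pi> D p (jet_rep (jet X E \<pi> D p \<psi>)) \<psi>"
proof -
  have "\<psi> \<in> snd (jet X E \<pi> D p \<psi>)" using assms by (simp add: jet_def same_jet_refl)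
  then have "jet_rep (jet X E \<pi> D p \<psi>) \<in> snd (jet X E \<pi> D p \<psi>)"
    unfolding jet_rep_def by (rule someI[of "\<lambda>\<phi>. \<phi> \<in> snd (jet X E \<pi> D p \<psi>)"])
  then show "section_at X E \<pi> p (jet_rep (jet X E \<pi> D p \<psi>))"
    "same_jet X E \<pi> D p (jet_rep (jet X E \<pi> D p \<psi>)) \<psi>" by (simp_all add: jet_def)
qed

text \<open>
  Projections of jets may be computed with any representing section.
\<close>

lemma jet_proj_jet:
  assumes "section_at X E \<pi> p \<psi>" "orders_upto (int n) \<subseteq> D"
  shows "jet_proj X E \<pi> (int n) (jet X E \<pi> D p \<psi>) = jet X E \<pi> (orders_upto (int n)) p \<psi>"
  unfolding jet_proj_def fst_jet
  by (rule jet_eqI[OF _ same_jet_mono[OF jet_rep_jet(2)[OF assms(1)] assms(2)]]) simp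

lemma jet_chart_simps [simp]:
  "chart_dom (jet_chart X E \<pi> k x c) =
     {jet X E \<pi> (orders_upto k) p \<psi> |p \<psi>. section_at X E \<pi> p \<psi> \<and> \<psi> p \<in> chart_dom c}"
  "chart_idx (jet_chart X E \<pi> k x c) = jet_idx x c k"
  by (simp_all add: jet_chart_def)

lemma jet_chart_map:
  assumes fib: "fibered_chart X E \<pi> x c" and sec: "section_at X E \<pi> p \<psi>" and dom: "\<psi> p \<in> chart_dom c"
  shows "chart_map (jet_chart X E \<pi> (int n) x c) (jet X E \<pi> (orders_upto (int n)) p \<psi>) =
    jet_coords_at x c n \<psi> p"
proof -
  have "section_partial x c \<alpha> a (jet_rep (jet X E \<pi> (orders_upto (int n)) p \<psi>)) p =
      section_partial x c \<alpha> a \<psi> p"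
    if "size \<alpha> \<le> n" "set_mset \<alpha> \<subseteq> chart_idx x" "Inr a \<in> chart_idx c" for \<alpha> a
    using jet_rep_jet(2)[OF sec, of "orders_upto (int n)"] fib dom that
    by (simp add: same_jet_def)
  then show ?thesis
    by (auto simp: fun_eq_iff jet_chart_def jet_idx_eq jet_coords_at_def jet_coords_def
        section_partial_eq[symmetric] split: sum.splits)
qed

lemma jet_in_chart_dom_iff:
  assumes "section_at X E \<pi> p \<psi>"
  shows "jet X E \<pi> (orders_upto (int n)) p \<psi> \<in> chart_dom (jet_chart X E \<pi> (int n) x c) \<longleftrightarrow>
    \<psi> p \<in> chart_dom c"
proof
  assume "jet X E \<pi> (orders_upto (int n)) p \<psi> \<in> chart_dom (jet_chart X E \<pi> (int n) x c)"
  then obtain p' \<psi>' where *: "jet X E \<pi> (orders_upto (int n)) p \<psi> = jet X E \<pi> (orders_upto (int n)) p' \<psi>'"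
    "\<psi>' p' \<in> chart_dom c" by auto
  then show "\<psi> p \<in> chart_dom c"
    using jet_eqD[OF assms *(1)] by (simp add: same_jet_def)
qed (use assms in auto)

lemma jet_with_coords:
  assumes X: "manifold X" and E: "manifold E" and fib: "fibered_chart X E \<pi> x c"
    and w: "w \<in> coord_space (jet_labels (chart_idx x) (chart_idx c) n)"
    and e0: "e0 \<in> chart_dom c" "order_zero w = chart_map c e0"
  obtains \<psi> where "section_at X E \<pi> (\<pi> e0) \<psi>" "\<psi> (\<pi> e0) = e0" "jet_coords_at x c n \<psi> (\<pi> e0) = w"
proof -
  have w0: "w (Inr ({#}, a)) = chart_map c e0 (Inr a)" for a
    using fun_cong[OF e0(2), of "Inr a"] by (simp add: order_zero_def)
  obtain \<psi> where \<psi>: "section_at X E \<pi> (\<pi> e0) \<psi>" "\<psi> (\<pi> e0) = e0"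
    "\<And>\<alpha> a. set_mset \<alpha> \<subseteq> chart_idx x \<Longrightarrow> Inr a \<in> chart_idx c \<Longrightarrow>
      section_partial x c \<alpha> a \<psi> (\<pi> e0) = w (Inr (\<alpha>, a))"
    by (rule section_with_derivatives[OF X E fib e0(1), of "\<lambda>\<alpha> a. w (Inr (\<alpha>, a))", OF w0])
      (rule that)
  have base: "chart_map x (\<pi> e0) i = w (Inl i)" for i
    using fun_cong[OF e0(2), of "Inl i"] fibered_chartD(7)[OF fib e0(1), of i]
    by (simp add: order_zero_def)
  have "jet_coords_at x c n \<psi> (\<pi> e0) s = w s" for s
  proof (cases "s \<in> jet_labels (chart_idx x) (chart_idx c) n")
    case True
    then show ?thesis
      using base \<psi>(3)
      by (auto simp: jet_coords_at_def jet_coords_def section_partial_eq[symmetric] split: sum.splits)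
  next
    case False
    then show ?thesis using w by (simp add: jet_coords_at_def jet_coords_def coord_space_def)
  qed
  then show ?thesis using \<psi>(1,2) by (intro that[of \<psi>]) auto
qed

lemma jet_manifold_atlas:
  "atlas (jet_manifold X E \<pi> k) = {jet_chart X E \<pi> k x c |x c. fibered_chart X E \<pi> x c}"
  by (simp add: jet_manifold_def)

lemma jet_manifold_basis:
  assumes "d \<in> atlas (jet_manifold X E \<pi> k)" "open W"
  shows "openin (mtop (jet_manifold X E \<pi> k)) {z \<in> chart_dom d. chart_map d z \<in> W}"
  using assms by (auto simp: jet_manifold_def intro!: topology_generated_by_Basis)

lemma jet_chart_transition:
  assumes X: "manifold X" and E: "manifold E"
    and fib: "fibered_chart X E \<pi> x c" and fib': "fibered_chart X E \<pi> x' c'"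
  obtains T where
    "continuous_on {w \<in> coord_space (jet_labels (chart_idx x) (chart_idx c) n).
       order_zero w \<in> chart_map c ` (chart_dom c \<inter> chart_dom c')} T"
    "\<And>p \<phi>. section_at X E \<pi> p \<phi> \<Longrightarrow> \<phi> p \<in> chart_dom c \<Longrightarrow> \<phi> p \<in> chart_dom c' \<Longrightarrow>
       jet_coords_at x' c' n \<phi> p = T (jet_coords_at x c n \<phi> p)"
proof -
  note fc = fibered_chartD[OF fib] and fc' = fibered_chartD[OF fib']
  let ?I = "chart_idx x" and ?C = "chart_idx c" and ?I' = "chart_idx x'" and ?C' = "chart_idx c'"
  let ?D = "chart_dom x \<inter> chart_dom x'"
  let ?Q = "chart_map c ` (chart_dom c \<inter> chart_dom c')"
  let ?A = "\<lambda>m. {w \<in> coord_space (jet_labels ?I ?C m). order_zero w \<in> ?Q}"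
  define P where "P \<alpha> a T \<longleftrightarrow> continuous_on (?A (size \<alpha>)) T \<and>
    (\<forall>p \<phi>. section_at X E \<pi> p \<phi> \<longrightarrow> \<phi> p \<in> chart_dom c \<longrightarrow> \<phi> p \<in> chart_dom c' \<longrightarrow>
       section_partial x' c' \<alpha> a \<phi> p = T (jet_coords_at x c (size \<alpha>) \<phi> p))" for \<alpha> a T
  have "\<exists>T. P \<alpha> a T"
    if \<alpha>: "set_mset \<alpha> \<subseteq> ?I'" and a: "Inr a \<in> ?C'" for \<alpha> a
  proof -
    define L where "L = sorted_list_of_multiset \<alpha>"
    have L: "set L \<subseteq> chart_idx x'" "length L = size \<alpha>"
      using \<alpha> by (simp_all add: L_def flip: size_mset)
    have eq: "foldr partial L (section_coords x' c' \<phi> a) (chart_map x' p) = section_partial x' c' \<alpha> a \<phi> p"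
      for \<phi> p by (simp add: section_partial_eq multi_partial_def L_def)
    obtain T where "continuous_on (?A (size \<alpha>)) T"
      "\<And>p \<phi>. section_at X E \<pi> p \<phi> \<Longrightarrow> \<phi> p \<in> chart_dom c \<Longrightarrow> \<phi> p \<in> chart_dom c' \<Longrightarrow>
         section_partial x' c' \<alpha> a \<phi> p = T (jet_coords_at x c (size \<alpha>) \<phi> p)"
      by (rule jet_coordinate_change[OF X E fib fib' L(1) a]) (rule that, simp_all only: L(2) eq)
    then show ?thesis unfolding P_def by (intro exI[of _ T]) simp
  qed
  note ex = this
  define S where "S \<alpha> a = (SOME T. P \<alpha> a T)" for \<alpha> a
  have PS: "P \<alpha> a (S \<alpha> a)" if "set_mset \<alpha> \<subseteq> ?I'" "Inr a \<in> ?C'" for \<alpha> a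
    unfolding S_def using ex[OF that] by (rule someI_ex)
  have S: "continuous_on (?A (size \<alpha>)) (S \<alpha> a)"
    "section_at X E \<pi> p \<phi> \<Longrightarrow> \<phi> p \<in> chart_dom c \<Longrightarrow> \<phi> p \<in> chart_dom c' \<Longrightarrow>
       section_partial x' c' \<alpha> a \<phi> p = S \<alpha> a (jet_coords_at x c (size \<alpha>) \<phi> p)"
    if "set_mset \<alpha> \<subseteq> ?I'" "Inr a \<in> ?C'" for \<alpha> a p \<phi>
    using PS[OF that] unfolding P_def by simp_all
  define T where "T w s = (if s \<in> jet_labels ?I' ?C' n then case s of
      Inl i \<Rightarrow> chart_map x' (chart_inv x (\<lambda>k. w (Inl k))) i
    | Inr (\<alpha>, a) \<Rightarrow> S \<alpha> a (truncate ?I ?C (size \<alpha>) w) else 0)" for w s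
  show ?thesis
  proof (rule that[of T])
    have "continuous_on (?A n) (\<lambda>w. T w s)" for s
    proof (cases "s \<in> jet_labels ?I' ?C' n")
      case True
      show ?thesis
      proof (cases s)
        case (Inl i)
        then have i: "i \<in> ?I'" using True by simp
        have "smooth_rep x x' (\<lambda>q. q)" by (rule manifold_chart_change_smooth[OF X fc(1) fc'(1)])
        then have "smooth_in x ?D (\<lambda>q. chart_map x' q i)"
          using i by (auto simp: smooth_rep_iff intro: smooth_in_mono)
        then have "continuous_on (chart_map x ` ?D) (\<lambda>v. chart_map x' (chart_inv x v) i)"
          unfolding smooth_in_def by (rule smooth_on_continuous)
        then have "continuous_on (?A n) (\<lambda>w. chart_map x' (chart_inv x (\<lambda>k. w (Inl k))) i)"
        proof (rule continuous_on_compose2)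
          show "continuous_on (?A n) (\<lambda>w k. w (Inl k))"
            by (rule continuous_on_coordinatewise_then_product)
              (rule continuous_on_subset[OF continuous_on_product_coordinates subset_UNIV])
          show "(\<lambda>w k. w (Inl k)) ` ?A n \<subseteq> chart_map x ` ?D"
          proof safe
            fix w e
            assume e: "order_zero w = chart_map c e" "e \<in> chart_dom c" "e \<in> chart_dom c'"
            have "(\<lambda>k. w (Inl k)) = chart_map x (\<pi> e)"
            proof
              fix k show "w (Inl k) = chart_map x (\<pi> e) k"
                using fun_cong[OF e(1), of "Inl k"] fc(7)[OF e(2), of k] by (simp add: order_zero_def)
            qed
            then show "(\<lambda>k. w (Inl k)) \<in> chart_map x ` ?D"
              using fc(5)[OF e(2)] fc'(5)[OF e(3)] by blast
          qed
        qed
        then show ?thesis using i by (simp add: T_def Inl)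
      next
        case (Inr r)
        obtain \<alpha> a where r: "r = (\<alpha>, a)" by fastforce
        have \<alpha>: "size \<alpha> \<le> n" "set_mset \<alpha> \<subseteq> ?I'" "Inr a \<in> ?C'" using True by (auto simp: Inr r)
        have "continuous_on (?A n) (\<lambda>w. S \<alpha> a (truncate ?I ?C (size \<alpha>) w))"
        proof (rule continuous_on_compose2[OF S(1)[OF \<alpha>(2,3)] continuous_on_truncate])
          show "truncate ?I ?C (size \<alpha>) ` ?A n \<subseteq> ?A (size \<alpha>)"
            using truncate_in[of ?I ?C "size \<alpha>"] order_zero_truncate[of _ ?I ?C n "size \<alpha>"] by auto
        qed
        then show ?thesis using True by (simp add: T_def Inr r)
      qed
    qed (simp add: T_def)
    then show "continuous_on (?A n) T"
      by (rule continuous_on_coordinatewise_then_product)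
    fix p \<phi> assume sec: "section_at X E \<pi> p \<phi>" and \<phi>: "\<phi> p \<in> chart_dom c" "\<phi> p \<in> chart_dom c'"
    have "\<pi> (\<phi> p) = p" using sec by (rule section_atE)
    then have p: "p \<in> chart_dom x" using fc(5)[OF \<phi>(1)] by simp
    have "(\<lambda>k. jet_coords_at x c n \<phi> p (Inl k)) = chart_map x p"
      using top_chartD(6)[OF fc(3) p]
      by (auto simp: fun_eq_iff jet_coords_at_def jet_coords_def coord_space_def)
    then have base: "chart_inv x (\<lambda>k. jet_coords_at x c n \<phi> p (Inl k)) = p"
      using top_chartD(7)[OF fc(3) p] by simp
    show "jet_coords_at x' c' n \<phi> p = T (jet_coords_at x c n \<phi> p)"
    proof
      fix s
      show "jet_coords_at x' c' n \<phi> p s = T (jet_coords_at x c n \<phi> p) s"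
      proof (cases "s \<in> jet_labels ?I' ?C' n")
        case True
        show ?thesis
        proof (cases s)
          case (Inl i)
          then show ?thesis using True base by (simp add: T_def jet_coords_at_def[of x'] jet_coords_def)
        next
          case (Inr r)
          obtain \<alpha> a where r: "r = (\<alpha>, a)" by fastforce
          have \<alpha>: "size \<alpha> \<le> n" "set_mset \<alpha> \<subseteq> ?I'" "Inr a \<in> ?C'" using True by (auto simp: Inr r)
          have "truncate ?I ?C (size \<alpha>) (jet_coords_at x c n \<phi> p) = jet_coords_at x c (size \<alpha>) \<phi> p"
            unfolding jet_coords_at_def by (rule truncate_jet_coords[OF \<alpha>(1)])
          then show ?thesis
            using S(2)[OF \<alpha>(2,3) sec \<phi>] \<alpha>
            by (simp add: T_def Inr r jet_coords_at_def[of x'] jet_coords_def section_partial_eq)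
        qed
      qed (simp add: T_def jet_coords_at_def[of x'] jet_coords_def)
    qed
  qed
qed

text \<open>
  Injectivity is the fact that one chart determines a jet.  The image is open because it is
  described by the condition that the coordinates of order zero belong to the image of c: all further
  coordinates are realised by sections, by Borel's lemma.  The topology is
  generated by all jet charts, so openness of the chart as a map amounts to continuity of the changes of
  jet coordinates.
\<close>

lemma jet_chart_top_chart:
  assumes X: "manifold X" and E: "manifold E" and fib: "fibered_chart X E \<pi> x c"
  shows "top_chart (mtop (jet_manifold X E \<pi> (int n))) (jet_chart X E \<pi> (int n) x c)"
proof -
  note fc = fibered_chartD[OF fib]
  let ?T = "mtop (jet_manifold X E \<pi> (int n))"
  let ?J = "jet_labels (chart_idx x) (chart_idx c) n"
  let ?D = "orders_upto (int n)"
  define e where "e = jet_chart X E \<pi> (int n) x c"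
  have idx: "chart_idx e = ?J" by (simp add: e_def jet_idx_eq)
  have fin: "finite ?J"
    using top_chartD(2)[OF fc(3)] top_chartD(2)[OF fc(4)] by (rule finite_jet_labels)
  have eA: "e \<in> atlas (jet_manifold X E \<pi> (int n))"
    using fib by (auto simp: jet_manifold_atlas e_def)
  have map_in: "chart_map e z \<in> coord_space ?J" for z
    by (simp add: e_def jet_chart_def jet_idx_eq coord_space_def)
  have inj: "inj_on (chart_map e) (chart_dom e)"
  proof (rule inj_onI)
    fix z z' assume z: "z \<in> chart_dom e" "z' \<in> chart_dom e" and eq: "chart_map e z = chart_map e z'"
    from z(1) obtain p \<psi> where p: "z = jet X E \<pi> ?D p \<psi>" "section_at X E \<pi> p \<psi>" "\<psi> p \<in> chart_dom c"
      by (auto simp: e_def)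
    from z(2) obtain p' \<psi>' where p': "z' = jet X E \<pi> ?D p' \<psi>'" "section_at X E \<pi> p' \<psi>'" "\<psi>' p' \<in> chart_dom c"
      by (auto simp: e_def)
    have pr: "\<pi> (\<psi> p) = p" "\<pi> (\<psi>' p') = p'" using p(2) p'(2) by (auto elim: section_atE)
    have ceq: "jet_coords_at x c n \<psi> p = jet_coords_at x c n \<psi>' p'"
      using eq jet_chart_map[OF fib p(2,3), of n] jet_chart_map[OF fib p'(2,3), of n]
      by (simp add: e_def p(1) p'(1))
    have "chart_map c (\<psi> p) = chart_map c (\<psi>' p')"
      using order_zero_jet_coords_at[where \<phi> = \<psi> and p = p, OF fib p(3) pr(1), of n]
        order_zero_jet_coords_at[where \<phi> = \<psi>' and p = p', OF fib p'(3) pr(2), of n] ceq by simp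
    then have "\<psi> p = \<psi>' p'"
      using inj_onD[OF top_chartD(3)[OF fc(4)]] p(3) p'(3) by blast
    then have pp: "p' = p" "\<psi> p = \<psi>' p" using pr by auto
    have "same_jet X E \<pi> ?D p \<psi> \<psi>'"
    proof (rule same_jet_if_coords_eq[OF X E fib p(2)])
      show "\<psi> p = \<psi>' p" by (rule pp(2))
      show "section_at X E \<pi> p \<psi>'" "\<psi>' p \<in> chart_dom c" using p'(2,3) pp by auto
      show "section_partial x c \<alpha> a \<psi> p = section_partial x c \<alpha> a \<psi>' p"
        if "size \<alpha> \<in> ?D" "set_mset \<alpha> \<subseteq> chart_idx x" "Inr a \<in> chart_idx c" for \<alpha> a
        using fun_cong[OF ceq, of "Inr (\<alpha>, a)"] that pp(1)
        by (simp add: jet_coords_at_def jet_coords_def section_partial_eq)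
    qed auto
    then show "z = z'" unfolding p(1) p'(1) pp(1) by (intro jet_eqI) auto
  qed
  have surj: "\<exists>p \<psi>. section_at X E \<pi> p \<psi> \<and> \<psi> p = e0 \<and> jet_coords_at x c n \<psi> p = w"
    if "w \<in> coord_space ?J" "e0 \<in> chart_dom c" "order_zero w = chart_map c e0" for w e0
  proof -
    obtain \<psi> where "section_at X E \<pi> (\<pi> e0) \<psi>" "\<psi> (\<pi> e0) = e0" "jet_coords_at x c n \<psi> (\<pi> e0) = w"
      by (rule jet_with_coords[OF X E fib \<open>w \<in> coord_space ?J\<close> \<open>e0 \<in> chart_dom c\<close>
            \<open>order_zero w = chart_map c e0\<close>])
    then show ?thesis by (intro exI[of _ "\<pi> e0"] exI[of _ \<psi>] conjI)
  qed
  have basic: "rel_open ?J (chart_map e ` ({z \<in> chart_dom e'. chart_map e' z \<in> W} \<inter> chart_dom e))"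
    if e': "e' \<in> atlas (jet_manifold X E \<pi> (int n))" and W: "open W" for e' W
  proof -
    obtain x' c' where e'_def: "e' = jet_chart X E \<pi> (int n) x' c'" and fib': "fibered_chart X E \<pi> x' c'"
      using e' by (auto simp: jet_manifold_atlas)
    let ?Q = "chart_map c ` (chart_dom c \<inter> chart_dom c')"
    let ?A = "{w \<in> coord_space ?J. order_zero w \<in> ?Q}"
    obtain T where T: "continuous_on ?A T"
      "\<And>p \<phi>. section_at X E \<pi> p \<phi> \<Longrightarrow> \<phi> p \<in> chart_dom c \<Longrightarrow> \<phi> p \<in> chart_dom c' \<Longrightarrow>
         jet_coords_at x' c' n \<phi> p = T (jet_coords_at x c n \<phi> p)"
      by (rule jet_chart_transition[OF X E fib fib', of n]) (rule that)
    have "openin (mtop E) (chart_dom c \<inter> chart_dom c')"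
      using top_chartD(1)[OF fc(4)] top_chartD(1)[OF fibered_chartD(4)[OF fib']] by blast
    then have "rel_open (chart_idx c) ?Q" by (rule top_chartD(4)[OF fc(4)]) simp
    then have opA: "rel_open ?J ?A" using fc(6) by (rule rel_open_order_zero)
    have "openin (top_of_set ?A) (?A \<inter> T -` W)"
      using T(1) W by (rule continuous_openin_preimage_gen)
    then have op: "rel_open ?J (?A \<inter> T -` W)" using opA openin_trans by blast
    have "chart_map e ` ({z \<in> chart_dom e'. chart_map e' z \<in> W} \<inter> chart_dom e) = ?A \<inter> T -` W"
    proof (intro equalityI subsetI)
      fix w assume "w \<in> chart_map e ` ({z \<in> chart_dom e'. chart_map e' z \<in> W} \<inter> chart_dom e)"
      then obtain z where z: "w = chart_map e z" "z \<in> chart_dom e'" "chart_map e' z \<in> W" "z \<in> chart_dom e"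
        by blast
      from z(4) obtain p \<psi> where p: "z = jet X E \<pi> ?D p \<psi>" "section_at X E \<pi> p \<psi>" "\<psi> p \<in> chart_dom c"
        by (auto simp: e_def)
      have p': "\<psi> p \<in> chart_dom c'"
        using z(2) jet_in_chart_dom_iff[OF p(2), of n x' c'] by (simp only: e'_def p(1))
      have pr: "\<pi> (\<psi> p) = p" using p(2) by (rule section_atE)
      have w: "w = jet_coords_at x c n \<psi> p"
        using jet_chart_map[OF fib p(2,3), of n] by (simp add: z(1) e_def p(1))
      have "chart_map e' z = jet_coords_at x' c' n \<psi> p"
        using jet_chart_map[OF fib' p(2) p', of n] by (simp add: e'_def p(1))
      then have "T w \<in> W" using z(3) T(2)[OF p(2,3) p'] w by simp
      moreover have "order_zero w \<in> ?Q"
        using order_zero_jet_coords_at[where \<phi> = \<psi> and p = p, OF fib p(3) pr, of n] w p(3) p' by simp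
      ultimately show "w \<in> ?A \<inter> T -` W" using map_in z(1) by simp
    next
      fix w assume w: "w \<in> ?A \<inter> T -` W"
      then obtain e0 where e0: "e0 \<in> chart_dom c" "e0 \<in> chart_dom c'" "order_zero w = chart_map c e0" by blast
      obtain p \<psi> where p: "section_at X E \<pi> p \<psi>" "\<psi> p = e0" "jet_coords_at x c n \<psi> p = w"
        using surj[of w e0] w e0 by blast
      let ?z = "jet X E \<pi> ?D p \<psi>"
      have z: "?z \<in> chart_dom e" "?z \<in> chart_dom e'"
        unfolding e_def e'_def jet_in_chart_dom_iff[OF p(1)] using e0 p(2) by auto
      have "chart_map e ?z = w"
        using jet_chart_map[OF fib p(1), of n] e0 p by (simp add: e_def)
      moreover have "chart_map e' ?z = T w"
        using jet_chart_map[OF fib' p(1), of n] T(2)[OF p(1)] e0 p by (simp add: e'_def)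
      ultimately show "w \<in> chart_map e ` ({z \<in> chart_dom e'. chart_map e' z \<in> W} \<inter> chart_dom e)"
        using z w by (intro image_eqI[of _ _ ?z]) auto
    qed
    then show ?thesis using op by simp
  qed
  have open_map: "rel_open ?J (chart_map e ` S)" if S: "openin ?T S" "S \<subseteq> chart_dom e" for S
  proof -
    have "generate_topology_on {{z \<in> chart_dom d. chart_map d z \<in> W} |d W.
        d \<in> atlas (jet_manifold X E \<pi> (int n)) \<and> open W} S"
      using S(1) by (simp add: jet_manifold_def openin_topology_generated_by_iff)
    then have "rel_open ?J (chart_map e ` (S \<inter> chart_dom e))"
    proof (induction rule: generate_topology_on.induct)
      case Empty
      then show ?case by simp
    next
      case (Int a b)
      have "chart_map e ` (a \<inter> b \<inter> chart_dom e) =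
          chart_map e ` (a \<inter> chart_dom e) \<inter> chart_map e ` (b \<inter> chart_dom e)"
        using inj by (subst inj_on_image_Int[OF inj, symmetric]) (auto intro: arg_cong)
      then show ?case using Int.IH by (simp add: openin_Int)
    next
      case (UN K)
      have "chart_map e ` (\<Union>K \<inter> chart_dom e) = (\<Union>k\<in>K. chart_map e ` (k \<inter> chart_dom e))" by blast
      then show ?case using UN.IH by (auto intro!: openin_Union)
    next
      case (Basis s)
      then show ?case using basic by blast
    qed
    moreover have "S \<inter> chart_dom e = S" using S(2) by blast
    ultimately show ?thesis by simp
  qed
  have "top_chart ?T e"
    unfolding top_chart_def idx
  proof (intro conjI allI impI fin inj)
    show "openin ?T (chart_dom e)" using jet_manifold_basis[OF eA open_UNIV] by simp
    show "rel_open ?J (chart_map e ` S)" if "openin ?T S \<and> S \<subseteq> chart_dom e" for S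
      using that open_map by blast
    show "openin ?T {z \<in> chart_dom e. chart_map e z \<in> W}" if W: "rel_open ?J W" for W
    proof -
      obtain R where R: "open R" "W = coord_space ?J \<inter> R" using W by (auto simp: openin_open)
      have "{z \<in> chart_dom e. chart_map e z \<in> W} = {z \<in> chart_dom e. chart_map e z \<in> R}"
        using map_in R(2) by blast
      then show ?thesis using jet_manifold_basis[OF eA R(1)] by simp
    qed
  qed
  then show ?thesis by (simp add: e_def)
qed

lemma jet_manifold_cover:
  assumes "manifold X" "manifold E" "z \<in> points (jet_manifold X E \<pi> (int n))"
  shows "\<exists>e\<in>atlas (jet_manifold X E \<pi> (int n)). z \<in> chart_dom e \<and>
    top_chart (mtop (jet_manifold X E \<pi> (int n))) e"
proof -
  have "z \<in> \<Union>{{z \<in> chart_dom d. chart_map d z \<in> W} |d W.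
        d \<in> atlas (jet_manifold X E \<pi> (int n)) \<and> open W}"
    using assms(3) unfolding jet_manifold_def Let_def manifold.simps topology_generated_by_topspace .
  then obtain d where d: "d \<in> atlas (jet_manifold X E \<pi> (int n))" "z \<in> chart_dom d" by blast
  then show ?thesis
    using jet_chart_top_chart[OF assms(1,2)] unfolding jet_manifold_atlas by blast
qed

section \<open>Submersions and submanifolds\<close>

lemma continuous_map_preimage_in_chart:
  assumes "continuous_map T T' f" "openin T (chart_dom c)" "openin T' S"
  shows "openin T {p \<in> chart_dom c. f p \<in> S}"
proof -
  have "openin T (chart_dom c \<inter> {p \<in> topspace T. f p \<in> S})"
    using assms by (intro openin_Int openin_continuous_map_preimage)
  moreover have "chart_dom c \<inter> {p \<in> topspace T. f p \<in> S} = {p \<in> chart_dom c. f p \<in> S}"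
    using openin_subset[OF assms(2)] by blast
  ultimately show ?thesis by simp
qed

text \<open>
  Locally the composition factors through a chart of N; surjectivity of the differential
  follows from the chain rule.
\<close>

lemma submersion_compose:
  assumes M: "\<And>c. c \<in> atlas M \<Longrightarrow> top_chart (mtop M) c"
    and N: "\<And>c. c \<in> atlas N \<Longrightarrow> top_chart (mtop N) c"
      "\<And>q. q \<in> points N \<Longrightarrow> \<exists>c\<in>atlas N. q \<in> chart_dom c"
    and P: "\<And>c. c \<in> atlas P \<Longrightarrow> top_chart (mtop P) c"
    and f: "submersion M N f" and g: "submersion N P g"
  shows "submersion M P (\<lambda>p. g (f p))"
proof -
  have cf: "continuous_map (mtop M) (mtop N) f" and cg: "continuous_map (mtop N) (mtop P) g"
    using f g by (auto simp: submersion_def smooth_map_def)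
  have local: "openin (mtop M) {q \<in> chart_dom c. f q \<in> {r \<in> chart_dom e. g r \<in> chart_dom d}} \<and>
    (\<forall>j\<in>chart_idx d. smooth_in c {q \<in> chart_dom c. f q \<in> {r \<in> chart_dom e. g r \<in> chart_dom d}}
        (\<lambda>q. chart_map d (g (f q)) j)) \<and>
    surj_diff_rep c d (\<lambda>q. g (f q)) p"
    if c: "c \<in> atlas M" and e: "e \<in> atlas N" and d: "d \<in> atlas P"
      and p: "p \<in> chart_dom c" "f p \<in> chart_dom e" "g (f p) \<in> chart_dom d" for c e d p
  proof -
    let ?S' = "{r \<in> chart_dom e. g r \<in> chart_dom d}"
    let ?S = "{q \<in> chart_dom c. f q \<in> ?S'}"
    have opS': "openin (mtop N) ?S'"
      by (rule continuous_map_preimage_in_chart[OF cg top_chartD(1)[OF N(1)[OF e]]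
            top_chartD(1)[OF P[OF d]]])
    have opS: "openin (mtop M) ?S"
      by (rule continuous_map_preimage_in_chart[OF cf top_chartD(1)[OF M[OF c]] opS'])
    have pS: "p \<in> ?S" using p by simp
    have smf: "smooth_in c ?S (\<lambda>q. chart_map e (f q) l)" if "l \<in> chart_idx e" for l
      using f c e that by (auto simp: submersion_def smooth_map_def smooth_rep_iff intro: smooth_in_mono)
    have smg: "smooth_in e ?S' (\<lambda>r. chart_map d (g r) j)" if "j \<in> chart_idx d" for j
      using g e d that by (auto simp: submersion_def smooth_map_def smooth_rep_iff)
    have subS: "?S \<subseteq> chart_dom c" "?S' \<subseteq> chart_dom e" and fS: "\<And>q. q \<in> ?S \<Longrightarrow> f q \<in> ?S'" by auto
    have comp1: "smooth_in c ?S (\<lambda>q. chart_map d (g (f q)) j)" if "j \<in> chart_idx d" for j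
      by (rule smooth_in_compose(1)[OF M[OF c] opS subS(1) N(1)[OF e] opS' subS(2) fS smf smg[OF that]])
    have comp2: "partial i (\<lambda>v. chart_map d (g (f (chart_inv c v))) j) (chart_map c p) =
      (\<Sum>l\<in>chart_idx e. partial l (\<lambda>u. chart_map d (g (chart_inv e u)) j) (chart_map e (f p)) *
        partial i (\<lambda>v. chart_map e (f (chart_inv c v)) l) (chart_map c p))"
      if "j \<in> chart_idx d" "i \<in> chart_idx c" for i j
      by (rule smooth_in_compose(2)[OF M[OF c] opS subS(1) N(1)[OF e] opS' subS(2) fS smf
            smg[OF that(1)] pS that(2)])
    have "surj_diff_rep c d (\<lambda>q. g (f q)) p"
      unfolding surj_diff_rep_def
    proof
      fix w :: "'f \<Rightarrow> real"
      have "surj_diff_rep e d g (f p)" using g e d p by (auto simp: submersion_def)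
      then obtain h2 where h2: "\<And>j. j \<in> chart_idx d \<Longrightarrow> (\<Sum>l\<in>chart_idx e.
          h2 l * partial l (\<lambda>u. chart_map d (g (chart_inv e u)) j) (chart_map e (f p))) = w j"
        unfolding surj_diff_rep_def by meson
      have "surj_diff_rep c e f p" using f c e p by (auto simp: submersion_def)
      then obtain h1 where h1: "\<And>l. l \<in> chart_idx e \<Longrightarrow> (\<Sum>i\<in>chart_idx c.
          h1 i * partial i (\<lambda>v. chart_map e (f (chart_inv c v)) l) (chart_map c p)) = h2 l"
        unfolding surj_diff_rep_def by meson
      have "(\<Sum>i\<in>chart_idx c. h1 i *
          partial i (\<lambda>v. chart_map d (g (f (chart_inv c v))) j) (chart_map c p)) = w j"
        if j: "j \<in> chart_idx d" for j
      proof -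
        let ?G = "\<lambda>l. partial l (\<lambda>u. chart_map d (g (chart_inv e u)) j) (chart_map e (f p))"
        let ?F = "\<lambda>i l. partial i (\<lambda>v. chart_map e (f (chart_inv c v)) l) (chart_map c p)"
        have "(\<Sum>i\<in>chart_idx c. h1 i *
            partial i (\<lambda>v. chart_map d (g (f (chart_inv c v))) j) (chart_map c p)) =
          (\<Sum>i\<in>chart_idx c. h1 i * (\<Sum>l\<in>chart_idx e. ?G l * ?F i l))"
          using comp2[OF j] by (intro sum.cong) auto
        also have "\<dots> = (\<Sum>i\<in>chart_idx c. \<Sum>l\<in>chart_idx e. (h1 i * ?F i l) * ?G l)"
          by (simp add: sum_distrib_left mult_ac)
        also have "\<dots> = (\<Sum>l\<in>chart_idx e. \<Sum>i\<in>chart_idx c. (h1 i * ?F i l) * ?G l)"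
          by (rule sum.swap)
        also have "\<dots> = (\<Sum>l\<in>chart_idx e. h2 l * ?G l)"
          using h1 by (intro sum.cong) (auto simp: sum_distrib_right[symmetric])
        also have "\<dots> = w j" by (rule h2[OF j])
        finally show ?thesis .
      qed
      then show "\<exists>h. \<forall>j\<in>chart_idx d. (\<Sum>i\<in>chart_idx c. h i *
          partial i (\<lambda>v. chart_map d (g (f (chart_inv c v))) j) (chart_map c p)) = w j" by blast
    qed
    then show ?thesis using opS comp1 by blast
  qed
  show ?thesis
    unfolding submersion_def smooth_map_def
  proof (intro conjI ballI impI)
    show "continuous_map (mtop M) (mtop P) (\<lambda>p. g (f p))"
      using continuous_map_compose[OF cf cg] by (simp add: o_def)
    have ex: "\<exists>e\<in>atlas N. f p \<in> chart_dom e" if "c \<in> atlas M" "p \<in> chart_dom c" for c p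
    proof (rule N(2))
      have "p \<in> points M" using openin_subset[OF top_chartD(1)[OF M[OF that(1)]]] that(2) by blast
      then show "f p \<in> points N" using cf by (auto simp: continuous_map_def)
    qed
    fix c d assume c: "c \<in> atlas M" and d: "d \<in> atlas P"
    show "smooth_rep c d (\<lambda>p. g (f p))"
      unfolding smooth_rep_iff
    proof
      fix j assume j: "j \<in> chart_idx d"
      show "smooth_in c {p \<in> chart_dom c. g (f p) \<in> chart_dom d} (\<lambda>p. chart_map d (g (f p)) j)"
      proof (rule smooth_in_local[OF M[OF c]])
        fix p assume p: "p \<in> {p \<in> chart_dom c. g (f p) \<in> chart_dom d}"
        then obtain e where e: "e \<in> atlas N" "f p \<in> chart_dom e" using ex[OF c, of p] by blast
        have *: "p \<in> chart_dom c" "g (f p) \<in> chart_dom d" using p by auto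
        show "\<exists>S'. openin (mtop M) S' \<and> p \<in> S' \<and> S' \<subseteq> {p \<in> chart_dom c. g (f p) \<in> chart_dom d} \<and>
            smooth_in c S' (\<lambda>p. chart_map d (g (f p)) j)"
          using local[OF c e(1) d *(1) e(2) *(2)] j * e(2)
          by (intro exI[of _ "{q \<in> chart_dom c. f q \<in> {r \<in> chart_dom e. g r \<in> chart_dom d}}"]) auto
      qed auto
    qed
    fix p assume p: "p \<in> chart_dom c" "g (f p) \<in> chart_dom d"
    obtain e where e: "e \<in> atlas N" "f p \<in> chart_dom e" using ex[OF c p(1)] by blast
    show "surj_diff_rep c d (\<lambda>p. g (f p)) p" using local[OF c e(1) d p(1) e(2) p(2)] by blast
  qed
qed

text \<open>
  The differential of a change of charts has that of the inverse change as a right inverse.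
\<close>

lemma submersion_id:
  assumes N: "\<And>c. c \<in> atlas N \<Longrightarrow> top_chart (mtop N) c"
    and change: "\<And>c d. c \<in> atlas N \<Longrightarrow> d \<in> atlas N \<Longrightarrow> smooth_rep c d (\<lambda>p. p)"
  shows "submersion N N (\<lambda>p. p)"
  unfolding submersion_def smooth_map_def
proof (intro conjI ballI impI change)
  show "continuous_map (mtop N) (mtop N) (\<lambda>p. p)" by simp
  fix c d p assume c: "c \<in> atlas N" and d: "d \<in> atlas N" and p: "p \<in> chart_dom c" "p \<in> chart_dom d"
  note tc = top_chartD[OF N[OF c]] and td = top_chartD[OF N[OF d]]
  let ?S = "chart_dom c \<inter> chart_dom d"
  have opS: "openin (mtop N) ?S" using tc(1) td(1) by blast
  have sm: "smooth_in d ?S (\<lambda>p. chart_map c p l)" if "l \<in> chart_idx c" for l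
    using change[OF d c] that by (auto simp: smooth_rep_iff intro: smooth_in_mono)
  have sm': "smooth_in c ?S (\<lambda>p. chart_map d p j)" if "j \<in> chart_idx d" for j
    using change[OF c d] that by (auto simp: smooth_rep_iff intro: smooth_in_mono)
  let ?F = "\<lambda>i l. partial i (\<lambda>v. chart_map c (chart_inv d v) l) (chart_map d p)"
  let ?G = "\<lambda>l j. partial l (\<lambda>u. chart_map d (chart_inv c u) j) (chart_map c p)"
  have \<delta>: "(\<Sum>l\<in>chart_idx c. ?G l j * ?F i l) = (if i = j then 1 else 0)"
    if i: "i \<in> chart_idx d" and j: "j \<in> chart_idx d" for i j
  proof -
    have "(\<Sum>l\<in>chart_idx c. ?G l j * ?F i l) =
        partial i (\<lambda>v. chart_map d (chart_inv d v) j) (chart_map d p)"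
      by (rule smooth_in_compose(2)[OF N[OF d] opS _ N[OF c] opS _ _ sm sm'[OF j] _ i, symmetric])
        (use p in auto)
    also have "\<dots> = partial i (\<lambda>v. v j) (chart_map d p)"
      by (rule partial_cong[OF td(2) td(4)[OF td(1) order_refl] _ _ i]) (use p td(7) in auto)
    also have "\<dots> = (if i = j then 1 else 0)"
      by (auto simp: partial_def)
    finally show ?thesis .
  qed
  show "surj_diff_rep c d (\<lambda>p. p) p"
    unfolding surj_diff_rep_def
  proof
    fix w :: "'b \<Rightarrow> real"
    have "(\<Sum>l\<in>chart_idx c. (\<Sum>i\<in>chart_idx d. w i * ?F i l) * ?G l j) = w j" if j: "j \<in> chart_idx d" for j
    proof -
      have "(\<Sum>l\<in>chart_idx c. (\<Sum>i\<in>chart_idx d. w i * ?F i l) * ?G l j) =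
          (\<Sum>l\<in>chart_idx c. \<Sum>i\<in>chart_idx d. w i * (?G l j * ?F i l))"
        by (intro sum.cong refl) (simp add: sum_distrib_left sum_distrib_right mult_ac)
      also have "\<dots> = (\<Sum>i\<in>chart_idx d. \<Sum>l\<in>chart_idx c. w i * (?G l j * ?F i l))"
        by (rule sum.swap)
      also have "\<dots> = (\<Sum>i\<in>chart_idx d. w i * (if i = j then 1 else 0))"
        using \<delta>[OF _ j] by (intro sum.cong) (auto simp: sum_distrib_left[symmetric])
      also have "\<dots> = (\<Sum>i\<in>chart_idx d. if i = j then w i else 0)"
        by (intro sum.cong) auto
      also have "\<dots> = w j" using j td(2) by simp
      finally show ?thesis .
    qed
    then show "\<exists>h. \<forall>j\<in>chart_idx d. (\<Sum>i\<in>chart_idx c. h i *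
          partial i (\<lambda>v. chart_map d (chart_inv c v) j) (chart_map c p)) = w j"
      by (intro exI[of _ "\<lambda>l. \<Sum>i\<in>chart_idx d. w i * ?F i l"]) auto
  qed
qed

lemma submersion_cong:
  assumes M: "\<And>c. c \<in> atlas M \<Longrightarrow> top_chart (mtop M) c"
    and P: "\<And>c. c \<in> atlas P \<Longrightarrow> top_chart (mtop P) c"
    and f: "submersion M P f" and eq: "\<And>p. p \<in> points M \<Longrightarrow> f p = g p"
  shows "submersion M P g"
  unfolding submersion_def smooth_map_def
proof (intro conjI ballI impI)
  have cf: "continuous_map (mtop M) (mtop P) f" using f by (simp add: submersion_def smooth_map_def)
  show "continuous_map (mtop M) (mtop P) g" using cf eq by (rule continuous_map_eq)
  fix c d assume c: "c \<in> atlas M" and d: "d \<in> atlas P"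
  note tc = top_chartD[OF M[OF c]]
  have eq': "f p = g p" if "p \<in> chart_dom c" for p
    using eq that openin_subset[OF tc(1)] by blast
  let ?S = "{p \<in> chart_dom c. f p \<in> chart_dom d}"
  have S: "{p \<in> chart_dom c. g p \<in> chart_dom d} = ?S" using eq' by auto
  have opS: "openin (mtop M) ?S"
    by (rule continuous_map_preimage_in_chart[OF cf tc(1) top_chartD(1)[OF P[OF d]]])
  show "smooth_rep c d g"
    unfolding smooth_rep_iff S
  proof
    fix j assume "j \<in> chart_idx d"
    then have "smooth_in c ?S (\<lambda>p. chart_map d (f p) j)"
      using f c d by (auto simp: submersion_def smooth_map_def smooth_rep_iff)
    then show "smooth_in c ?S (\<lambda>p. chart_map d (g p) j)"
      by (rule smooth_in_cong[OF M[OF c] opS, rotated 2]) (use eq' in auto)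
  qed
  fix p assume p: "p \<in> chart_dom c" "g p \<in> chart_dom d"
  have "surj_diff_rep c d f p" using f c d p eq' by (auto simp: submersion_def)
  moreover have "partial i (\<lambda>v. chart_map d (f (chart_inv c v)) j) (chart_map c p) =
      partial i (\<lambda>v. chart_map d (g (chart_inv c v)) j) (chart_map c p)" if "i \<in> chart_idx c" for i j
    by (rule partial_cong[OF tc(2) tc(4)[OF tc(1) order_refl] _ _ that]) (use p tc(7) eq' in auto)
  ultimately show "surj_diff_rep c d g p" unfolding surj_diff_rep_def by simp
qed

lemma submanifold_top_chart:
  assumes "s \<in> atlas (submanifold M S)"
  shows "top_chart (mtop (submanifold M S)) s"
proof -
  obtain c K where "slice_chart M S c K" "s = sub_chart c S K"
    using assms by (auto simp: submanifold_def sub_chart_def)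
  then show ?thesis using slice_top_chart by (simp add: submanifold_def)
qed

lemma points_submanifold:
  assumes "is_submanifold M S"
  shows "points (submanifold M S) = S"
  using assms by (auto simp: is_submanifold_def submanifold_def)

lemma submanifold_cover:
  assumes "is_submanifold M S" "p \<in> S"
  shows "\<exists>s\<in>atlas (submanifold M S). p \<in> chart_dom s"
proof -
  obtain c K where c: "slice_chart M S c K" "p \<in> chart_dom c"
    using assms by (auto simp: is_submanifold_def)
  then have "sub_chart c S K \<in> atlas (submanifold M S)"
    by (auto simp: submanifold_def sub_chart_def)
  then show ?thesis using c(2) assms(2) by (intro bexI[of _ "sub_chart c S K"]) auto
qed

text \<open>
  Changes of slice charts are restrictions of changes of charts of the ambient manifold.
\<close>

lemma submanifold_chart_change:
  assumes cover: "\<And>p. p \<in> points M \<Longrightarrow> \<exists>e\<in>atlas M. p \<in> chart_dom e \<and> top_chart (mtop M) e"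
    and s: "s \<in> atlas (submanifold M S)" and t: "t \<in> atlas (submanifold M S)"
  shows "smooth_rep s t (\<lambda>p. p)"
proof -
  obtain c K where sl: "slice_chart M S c K" and s_def: "s = sub_chart c S K"
    using s by (auto simp: submanifold_def sub_chart_def)
  obtain d L where sl': "slice_chart M S d L" and t_def: "t = sub_chart d S L"
    using t by (auto simp: submanifold_def sub_chart_def)
  have c: "chart_of M c" "K \<subseteq> chart_idx c" and d: "chart_of M d" "L \<subseteq> chart_idx d"
    using sl sl' by (auto simp: slice_chart_def)
  have rep: "smooth_rep c d (\<lambda>p. p)" by (rule chart_change_smooth[OF c(1) d(1) cover])
  note ts = slice_top_chart[OF sl] and tt = slice_top_chart[OF sl']
  show ?thesis
    unfolding smooth_rep_iff
  proof
    fix j assume j: "j \<in> chart_idx t"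
    have "smooth_in (sub_chart c S K) {p \<in> chart_dom s. p \<in> chart_dom t} (\<lambda>p. chart_map d p j)"
    proof (rule smooth_in_sub_chart[where T = "mtop M" and S = "{p \<in> chart_dom c. p \<in> chart_dom d}",
            OF _ ts c(2)])
      show "top_chart (mtop M) c" using c(1) by (simp add: chart_of_iff)
      have "openin (subtopology (mtop M) S) (chart_dom s \<inter> chart_dom t)"
        using top_chartD(1)[OF ts] top_chartD(1)[OF tt] by (simp add: s_def t_def openin_Int del: sub_chart_simps)
      moreover have "{p \<in> chart_dom s. p \<in> chart_dom t} = chart_dom s \<inter> chart_dom t" by blast
      ultimately show "openin (subtopology (mtop M) S) {p \<in> chart_dom s. p \<in> chart_dom t}" by simp
      show "smooth_in c {p \<in> chart_dom c. p \<in> chart_dom d} (\<lambda>p. chart_map d p j)"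
        using rep j d(2) by (auto simp: smooth_rep_iff t_def)
    qed (auto simp: s_def t_def)
    then show "smooth_in s {p \<in> chart_dom s. p \<in> chart_dom t} (\<lambda>p. chart_map t p j)"
      by (simp add: s_def t_def)
  qed
qed

section \<open>The manifold of formal solutions\<close>

text \<open>
  A compatible sequence of finite jets is an infinite jet: in a single fibered chart the
  representatives prescribe all derivatives consistently, and Borel's lemma provides one section with
  these derivatives.
\<close>

lemma section_with_compatible_jets:
  assumes X: "manifold X" and E: "manifold E"
    and z: "\<And>n. z n \<in> points (jet_manifold X E \<pi> (int (k + n)))"
    and proj: "\<And>n. jet_proj X E \<pi> (int (k + n)) (z (Suc n)) = z n"
  obtains p \<psi> where "section_at X E \<pi> p \<psi>"
    "\<And>n. jet X E \<pi> (orders_upto (int (k + n))) p \<psi> = z n"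
proof -
  have "\<exists>x c p \<psi>. fibered_chart X E \<pi> x c \<and> section_at X E \<pi> p \<psi> \<and> \<psi> p \<in> chart_dom c \<and>
      z n = jet X E \<pi> (orders_upto (int (k + n))) p \<psi>" for n
  proof -
    obtain e where "e \<in> atlas (jet_manifold X E \<pi> (int (k + n)))" "z n \<in> chart_dom e"
      using jet_manifold_cover[OF X E z] by blast
    then show ?thesis by (fastforce simp: jet_manifold_atlas)
  qed
  then obtain x c p \<psi> where *: "\<And>n. fibered_chart X E \<pi> (x n) (c n)" "\<And>n. section_at X E \<pi> (p n) (\<psi> n)"
    "\<And>n. \<psi> n (p n) \<in> chart_dom (c n)" "\<And>n. z n = jet X E \<pi> (orders_upto (int (k + n))) (p n) (\<psi> n)"
    by metis
  have succ: "p (Suc n) = p n \<and> same_jet X E \<pi> (orders_upto (int (k + n))) (p n) (\<psi> n) (\<psi> (Suc n))" for n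
  proof -
    have "orders_upto (int (k + n)) \<subseteq> orders_upto (int (k + Suc n))" by (auto simp: orders_upto_def)
    then have "jet X E \<pi> (orders_upto (int (k + n))) (p (Suc n)) (\<psi> (Suc n)) =
        jet X E \<pi> (orders_upto (int (k + n))) (p n) (\<psi> n)"
      using proj[of n] jet_proj_jet[OF *(2)[of "Suc n"], of "k + n" "orders_upto (int (k + Suc n))"]
      unfolding *(4) by simp
    from jet_eqD[OF *(2)[of n] this[symmetric]] show ?thesis by blast
  qed
  define q where "q = p 0"
  have p: "p n = q" for n
    by (induction n) (simp_all add: q_def succ)
  have sec: "section_at X E \<pi> q (\<psi> n)" for n using *(2)[of n] by (simp add: p)
  have same: "same_jet X E \<pi> (orders_upto (int (k + n))) q (\<psi> n) (\<psi> m)" if "n \<le> m" for n m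
    using that
  proof (induction m rule: dec_induct)
    case base
    show ?case by (rule same_jet_refl)
  next
    case (step m)
    have "same_jet X E \<pi> (orders_upto (int (k + m))) q (\<psi> m) (\<psi> (Suc m))"
      using succ[of m] by (simp add: p)
    then have "same_jet X E \<pi> (orders_upto (int (k + n))) q (\<psi> m) (\<psi> (Suc m))"
      by (rule same_jet_mono) (use step.hyps in \<open>auto simp: orders_upto_def\<close>)
    with step.IH show ?case by (rule same_jet_trans) (simp add: orders_upto_def)
  qed
  define e where "e = \<psi> 0 q"
  have val: "\<psi> n q = e" for n
    unfolding e_def using same[of 0 n] by (simp add: same_jet_def orders_upto_def)
  let ?x = "x 0" and ?c = "c 0"
  have e0: "e \<in> chart_dom ?c" using *(3)[of 0] by (simp add: p val)
  have pq: "\<pi> e = q" unfolding e_def using sec[of 0] by (rule section_atE)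
  \<comment> \<open>Any index m with k + m at least the size of the multi-index would do; the size itself is one.\<close>
  define w where "w \<alpha> a = section_partial ?x ?c \<alpha> a (\<psi> (size \<alpha>)) q" for \<alpha> a
  have qx: "chart_inv ?x (chart_map ?x q) = q"
    using fibered_chartD(5)[OF *(1) e0] pq by (intro top_chartD(7)[OF fibered_chartD(3)[OF *(1)]]) simp
  have w0: "w {#} a = chart_map ?c e (Inr a)" for a
    by (simp add: w_def section_partial_def qx val)
  obtain \<phi> where \<phi>: "section_at X E \<pi> (\<pi> e) \<phi>" "\<phi> (\<pi> e) = e"
    "\<And>\<alpha> a. set_mset \<alpha> \<subseteq> chart_idx ?x \<Longrightarrow> Inr a \<in> chart_idx ?c \<Longrightarrow>
      section_partial ?x ?c \<alpha> a \<phi> (\<pi> e) = w \<alpha> a"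
    by (rule section_with_derivatives[OF X E *(1) e0, of w, OF w0]) (rule that)
  have "same_jet X E \<pi> (orders_upto (int (k + n))) q \<phi> (\<psi> n)" for n
  proof (rule same_jet_if_coords_eq[where c = ?c, OF X E *(1)])
    show "section_at X E \<pi> q \<phi>" "\<phi> q = \<psi> n q" "\<psi> n q \<in> chart_dom ?c"
      using \<phi>(1,2) e0 by (simp_all add: pq val)
    show "section_partial ?x ?c \<alpha> a \<phi> q = section_partial ?x ?c \<alpha> a (\<psi> n) q"
      if "size \<alpha> \<in> orders_upto (int (k + n))" "set_mset \<alpha> \<subseteq> chart_idx ?x" "Inr a \<in> chart_idx ?c" for \<alpha> a
    proof -
      have sz: "size \<alpha> \<le> k + n" using that(1) by (simp add: orders_upto_def)
      have cmp: "section_partial ?x ?c \<alpha> a (\<psi> i) q = section_partial ?x ?c \<alpha> a (\<psi> j) q"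
        if "i \<le> j" "size \<alpha> \<le> k + i" for i j
        using same[OF that(1)] *(1)[of 0] e0 that(2) \<open>set_mset \<alpha> \<subseteq> _\<close> \<open>Inr a \<in> _\<close>
        by (simp add: same_jet_def val orders_upto_def)
      have "section_partial ?x ?c \<alpha> a (\<psi> (size \<alpha>)) q = section_partial ?x ?c \<alpha> a (\<psi> n) q"
      proof (cases "n \<le> size \<alpha>")
        case True
        then show ?thesis using cmp[of n "size \<alpha>"] sz by simp
      next
        case False
        then show ?thesis using cmp[of "size \<alpha>" n] by simp
      qed
      then show ?thesis using \<phi>(3)[OF that(2,3)] by (simp add: pq w_def)
    qed
  qed (auto simp: sec orders_upto_def)
  then have "jet X E \<pi> (orders_upto (int (k + n))) q \<phi> = z n" for n
    unfolding *(4) p by (intro jet_eqI) (auto simp: orders_upto_def)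
  then show ?thesis using \<phi>(1) that[of q \<phi>] by (simp add: pq)
qed

theorem mainTheorem4:
  fixes X :: "('x, nat) manifold" and E :: "('e, nat) manifold" and F :: "('f, nat) manifold"
    and \<pi> :: "'e \<Rightarrow> 'x" and k :: nat and R :: "('x, 'e) jet set"
  assumes "smooth_fiber_bundle X E F \<pi>"
    and "is_pde X E \<pi> k R"
    and "formally_integrable X E \<pi> k R"
  shows "profinite_submanifold (infinite_jet_manifold X E \<pi>) (formal_solutions X E \<pi> k R)"
proof -
  have X: "manifold X" and E: "manifold E" using assms(1) by (auto simp: smooth_fiber_bundle_def)
  let ?J = "\<lambda>i. jet_manifold X E \<pi> (int (k + i))"
  let ?R = "prolongation X E \<pi> k R"
  let ?pr = "\<lambda>i. jet_proj X E \<pi> (int (k + i))"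
  let ?M = "\<lambda>i. submanifold (?J i) (?R i)"
  let ?N = "formal_solutions X E \<pi> k R"
  have sub: "is_submanifold (?J i) (?R i)" for i
    using assms(3) unfolding formally_integrable_def by blast
  have fibered: "fibered_manifold (?M (Suc i)) (?M i) (?pr i)" for i
    using assms(3)[unfolded formally_integrable_def, rule_format, of i] by simp
  have pts: "points (?M i) = ?R i" for i by (rule points_submanifold[OF sub])
  have onto: "?pr i ` ?R (Suc i) = ?R i" for i
    using fibered[of i] unfolding fibered_manifold_def pts by blast
  have R_points: "?R i \<subseteq> points (?J i)" for i using sub by (simp add: is_submanifold_def)
  have R_jet: "\<exists>p \<psi>. section_at X E \<pi> p \<psi> \<and> z = jet X E \<pi> (orders_upto (int (k + i))) p \<psi>"
    if z: "z \<in> ?R i" for z i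
  proof -
    obtain e where "e \<in> atlas (?J i)" "z \<in> chart_dom e"
      using jet_manifold_cover[OF X E subsetD[OF R_points z]] by blast
    then show ?thesis by (fastforce simp: jet_manifold_atlas)
  qed
  have inf_proj: "?pr i (jet X E \<pi> UNIV p \<psi>) = jet X E \<pi> (orders_upto (int (k + i))) p \<psi>"
    if "section_at X E \<pi> p \<psi>" for i p \<psi>
    by (rule jet_proj_jet[OF that]) simp
  have image: "?pr i ` ?N = ?R i" for i
  proof
    show "?pr i ` ?N \<subseteq> ?R i" by (auto simp: formal_solutions_def)
    show "?R i \<subseteq> ?pr i ` ?N"
    proof
      fix z0 assume z0: "z0 \<in> ?R i"
      \<comment> \<open>Formal integrability lifts the jet step by step to all higher orders.\<close>
      have "\<exists>z. \<forall>n. (z n \<in> ?R (i + n) \<and> (n = 0 \<longrightarrow> z n = z0)) \<and> ?pr (i + n) (z (Suc n)) = z n"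
      proof (rule dependent_nat_choice)
        show "\<exists>z. z \<in> ?R (i + 0) \<and> (0 = (0::nat) \<longrightarrow> z = z0)"
          by (rule exI[of _ z0]) (simp add: z0)
        fix z n assume "z \<in> ?R (i + n) \<and> (n = 0 \<longrightarrow> z = z0)"
        then have "z \<in> ?pr (i + n) ` ?R (Suc (i + n))" using onto[of "i + n"] by blast
        then obtain y where "y \<in> ?R (Suc (i + n))" "?pr (i + n) y = z" by blast
        then show "\<exists>y. (y \<in> ?R (i + Suc n) \<and> (Suc n = 0 \<longrightarrow> y = z0)) \<and> ?pr (i + n) y = z"
          by (intro exI[of _ y]) simp
      qed
      then obtain z where z: "\<And>n. z n \<in> ?R (i + n)" "z 0 = z0" "\<And>n. ?pr (i + n) (z (Suc n)) = z n"
        by blast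
      obtain p \<psi> where \<psi>: "section_at X E \<pi> p \<psi>"
        "\<And>n. jet X E \<pi> (orders_upto (int (k + i + n))) p \<psi> = z n"
      proof (rule section_with_compatible_jets[OF X E, of z \<pi> "k + i"])
        show "z n \<in> points (jet_manifold X E \<pi> (int (k + i + n)))" for n
          using subsetD[OF R_points z(1)[of n]] by (simp only: add.assoc)
        show "jet_proj X E \<pi> (int (k + i + n)) (z (Suc n)) = z n" for n
          using z(3)[of n] by (simp only: add.assoc)
      qed (rule that)
      have above: "?pr j (jet X E \<pi> UNIV p \<psi>) \<in> ?R j" if "i \<le> j" for j
      proof -
        obtain n where j: "j = i + n" using \<open>i \<le> j\<close> le_Suc_ex by blast
        show ?thesis
          using z(1)[of n] by (simp only: j inf_proj[OF \<psi>(1)] \<psi>(2)[of n, unfolded add.assoc])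
      qed
      have "?pr j (jet X E \<pi> UNIV p \<psi>) \<in> ?R j" for j
      proof (cases "i \<le> j")
        case False
        then have "j \<le> i" by simp
        then show ?thesis
        proof (induction rule: inc_induct)
          case base
          show ?case by (rule above) simp
        next
          case (step m)
          have "?pr m (?pr (Suc m) (jet X E \<pi> UNIV p \<psi>)) = ?pr m (jet X E \<pi> UNIV p \<psi>)"
            unfolding inf_proj[OF \<psi>(1)]
            by (rule jet_proj_jet[OF \<psi>(1)]) (auto simp: orders_upto_def)
          then show ?case using step.IH onto[of m] by (metis imageI)
        qed
      qed (rule above)
      then have "jet X E \<pi> UNIV p \<psi> \<in> ?N"
        using \<psi>(1) by (auto simp: formal_solutions_def infinite_jets_def)
      moreover have "?pr i (jet X E \<pi> UNIV p \<psi>) = z0"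
        using inf_proj[OF \<psi>(1), of i] \<psi>(2)[of 0] z(2) by simp
      ultimately show "z0 \<in> ?pr i ` ?N" by blast
    qed
  qed
  have top: "topspace (infinite_jet_topology X E \<pi>) \<subseteq> infinite_jets X E \<pi>"
    unfolding infinite_jet_topology_def topology_generated_by_topspace by blast
  have N_top: "?N \<subseteq> topspace (infinite_jet_topology X E \<pi>)"
  proof
    fix z assume z: "z \<in> ?N"
    have "openin (infinite_jet_topology X E \<pi>) {z \<in> infinite_jets X E \<pi>. ?pr 0 z \<in> points (?J 0)}"
      unfolding infinite_jet_topology_def
      by (rule topology_generated_by_Basis) (auto intro!: exI[of _ "int (k + 0)"] exI[of _ "points (?J 0)"])
    moreover have "z \<in> {z \<in> infinite_jets X E \<pi>. ?pr 0 z \<in> points (?J 0)}"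
      using z R_points[of 0] unfolding formal_solutions_def by blast
    ultimately show "z \<in> topspace (infinite_jet_topology X E \<pi>)"
      using openin_subset by blast
  qed
  have inter: "?N = (\<Inter>i. {m \<in> topspace (infinite_jet_topology X E \<pi>). ?pr i m \<in> ?pr i ` ?N})"
    unfolding image
  proof
    show "?N \<subseteq> (\<Inter>i. {m \<in> topspace (infinite_jet_topology X E \<pi>). ?pr i m \<in> ?R i})"
      using N_top unfolding formal_solutions_def by blast
    show "(\<Inter>i. {m \<in> topspace (infinite_jet_topology X E \<pi>). ?pr i m \<in> ?R i}) \<subseteq> ?N"
      using top unfolding formal_solutions_def by blast
  qed
  have charts: "s \<in> atlas (?M i) \<Longrightarrow> top_chart (mtop (?M i)) s" for s i
    by (rule submanifold_top_chart)
  have subm: "submersion (?M j) (?M i) (?pr i)" if "i \<le> j" for i j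
    using that
  proof (induction j rule: dec_induct)
    case base
    have "submersion (?M i) (?M i) (\<lambda>z. z)"
    \<comment> \<open>The case of equal indices is not covered by formal integrability: it says that slice charts are compatible.\<close>
    proof (rule submersion_id[OF charts])
      fix s t assume "s \<in> atlas (?M i)" "t \<in> atlas (?M i)"
      then show "smooth_rep s t (\<lambda>z. z)"
      proof (rule submanifold_chart_change[rotated])
        show "\<exists>e\<in>atlas (?J i). z \<in> chart_dom e \<and> top_chart (mtop (?J i)) e"
          if "z \<in> points (?J i)" for z
          using that by (rule jet_manifold_cover[OF X E])
      qed
    qed
    then show ?case
    proof (rule submersion_cong[rotated 2])
      fix z assume "z \<in> points (?M i)"
      then obtain p \<psi> where "section_at X E \<pi> p \<psi>" "z = jet X E \<pi> (orders_upto (int (k + i))) p \<psi>"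
        using R_jet unfolding pts by blast
      then show "z = ?pr i z" using jet_proj_jet[of X E \<pi> p \<psi> "k + i"] by simp
    qed (erule charts)+
  next
    case (step j)
    have "submersion (?M (Suc j)) (?M i) (\<lambda>z. ?pr i (?pr j z))"
    proof (rule submersion_compose[where N = "?M j" and f = "?pr j" and g = "?pr i"])
      show "submersion (?M j) (?M i) (?pr i)" by (rule step.IH)
      show "submersion (?M (Suc j)) (?M j) (?pr j)"
        using fibered[of j] unfolding fibered_manifold_def by (rule conjunct1)
      show "\<exists>c\<in>atlas (?M j). q \<in> chart_dom c" if "q \<in> points (?M j)" for q
        using submanifold_cover[OF sub] that unfolding pts by blast
    qed (erule charts)+
    then show ?case
    proof (rule submersion_cong[rotated 2])
      fix z assume "z \<in> points (?M (Suc j))"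
      then obtain p \<psi> where z: "section_at X E \<pi> p \<psi>" "z = jet X E \<pi> (orders_upto (int (k + Suc j))) p \<psi>"
        using R_jet unfolding pts by blast
      have "orders_upto (int (k + j)) \<subseteq> orders_upto (int (k + Suc j))"
        "orders_upto (int (k + i)) \<subseteq> orders_upto (int (k + j))"
        "orders_upto (int (k + i)) \<subseteq> orders_upto (int (k + Suc j))"
        using \<open>i \<le> j\<close> by (auto simp: orders_upto_def)
      then show "?pr i (?pr j z) = ?pr i z" unfolding z(2) by (simp only: jet_proj_jet[OF z(1)])
    qed (erule charts)+
  qed
  show ?thesis
    unfolding profinite_submanifold_def infinite_jet_manifold_def profinite.simps
  \<comment> \<open>The levels below k carry no condition.\<close>
  proof (intro conjI exI[of _ "\<lambda>i. int (k + i)"])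
    show "strict_mono (\<lambda>i. int (k + i))" by (simp add: strict_mono_def)
    show "range (\<lambda>i. int (k + i)) \<subseteq> {-1..}" by auto
    show "\<forall>i. is_submanifold (?J i) (?pr i ` ?N)" unfolding image using sub by blast
    show "\<forall>i j. i \<le> j \<longrightarrow> submersion (submanifold (?J j) (?pr j ` ?N))
        (submanifold (?J i) (?pr i ` ?N)) (?pr i)"
      unfolding image using subm by blast
  qed (rule N_top inter)+
qed

end
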